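(* Let $k$ be a field, let $G\le\mathcal{S}_n$ act on $S := k[x_1,\ldots,x_n]$ via permutations, and let $R := S^G$ be the ring of invariants. (a) If $G$ contains no transpositions, then $\operatorname{D}_{R\mid k}$ has a $k$-basis consisting of (the restrictions to $R$ of) the $G$-orbit sums of elements of the PBW-basis for $\operatorname{D}_{S\mid k}$ with respect to $x_1,\ldots,x_n$. (b) More generally, if $G\le\mathcal{S}_n$ is arbitrary and $N\unlhd G$ is the subgroup generated by the transpositions in $G$, then $S^N$ is a polynomial ring $k[y_1,\ldots,y_n]$, where $y_1,\ldots,y_n$ are the elementary symmetric polynomials in the variables of the various $N$-orbits, and $\operatorname{D}_{R\mid k}$ has a $k$-basis consisting of (the restrictions to $R$ of) the $G/N$-orbit sums of the elements of the PBW-basis for $\operatorname{D}_{S^N\mid k}$ with respect to $y_1,\ldots,y_n$.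
   Context: The action is by $k$-algebra automorphisms with $\sigma\cdot x_i=x_{\sigma(i)}$. If $[n]=\{1,\dots,n\}=A_1\sqcup\cdots\sqcup A_r$ is the decomposition into $N$-orbits, then $y_1,\ldots,y_n$ are the elements of $\bigcup_i E(A_i)$, where $E(A_i)$ is the set of the $|A_i|$ elementary symmetric polynomials (of positive degree) in $\{x_j: j\in A_i\}$. The group $G$ permutes the $y_i$ and $N$ acts trivially on them, so $G/N$ acts on $S^N$ by permuting the $y_i$, and $R=(S^N)^{G/N}$. For a commutative $k$-algebra $R$, $\operatorname{D}_{R\mid k}$ is the ring of $k$-linear differential operators: $\operatorname{D}^{-1}_{R\mid k}=0$, $\operatorname{D}^m_{R\mid k}=\{\delta\in\operatorname{Hom}_k(R,R): \delta\circ r-r\circ\delta\in\operatorname{D}^{m-1}_{R\mid k}\ \forall r\in R\}$ for $m\geq 0$ (with $r$ also denoting multiplication by $r$), and $\operatorname{D}_{R\mid k}=\bigcup_m\operatorname{D}^m_{R\mid k}$. For a polynomial ring $P=k[z_1,\ldots,z_n]$, the PBW-basis of $\operatorname{D}_{P\mid k}$ with respect to $z_1,\ldots,z_n$ is $\{z^\alpha\cdot\partial_z^\beta:\alpha,\beta\in\mathbb{N}^n\}$, where $z^\alpha=z_1^{\alpha_1}\cdots z_n^{\alpha_n}$ and $\partial_z^\beta$ is the $k$-linear operator with $\partial_z^\beta(z^\gamma)=\binom{\gamma_1}{\beta_1}\cdots\binom{\gamma_n}{\beta_n}z^{\gamma-\beta}$ for $\gamma\in\mathbb{N}^n$. A group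 $H$ acting on $P$ by $k$-algebra automorphisms acts on $\operatorname{D}_{P\mid k}$ by conjugation, $(\sigma\cdot\partial)(s)=\sigma(\partial(\sigma^{-1}(s)))$; if $H$ permutes the variables $z_i$, then it permutes the PBW-basis, and an orbit sum is the sum of the elements of one (finite) orbit. An $H$-invariant operator maps $P^H$ into $P^H$, and hence restricts to a differential operator on $P^H$; orbit sums are regarded as operators on $R$ via this restriction. *)

theory Defs
  imports
    Complex_Main
    "HOL-Algebra.Sym_Groups"
    "HOL-Algebra.Group_Action"
    "HOL-Library.Poly_Mapping"
    "HOL-Library.Function_Algebras"
begin

text \<open>
  Multivariate polynomials are finitely supported maps from exponent vectors to
  coefficients; the multiplication of \<^theory>\<open>HOL-Library.Poly_Mapping\<close> is the convolution product.
  The type provides the variables \<open>x\<^sub>i\<close> for all natural \<open>i\<close>; the ring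
  \<open>k[x\<^sub>1,\<dots>,x\<^sub>n]\<close> is the subset \<open>poly_ring n\<close>.
\<close>

type_synonym 'k mpoly = "(nat \<Rightarrow>\<^sub>0 nat) \<Rightarrow>\<^sub>0 'k"

definition Const :: "'k::field \<Rightarrow> 'k mpoly" where
  "Const c = Poly_Mapping.single 0 c"

definition X :: "nat \<Rightarrow> 'k::field mpoly" where
  "X i = Poly_Mapping.single (Poly_Mapping.single i 1) 1"

definition poly_ring :: "nat \<Rightarrow> 'k::field mpoly set" where
  "poly_ring n = {p. \<forall>m \<in> Poly_Mapping.keys p. Poly_Mapping.keys m \<subseteq> {1..n}}"

text \<open>The \<open>k\<close>-algebra homomorphism with \<open>x\<^sub>i \<mapsto> f i\<close>.\<close>

definition subst :: "(nat \<Rightarrow> 'k::field mpoly) \<Rightarrow> 'k mpoly \<Rightarrow> 'k mpoly" where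
  "subst f p = (\<Sum>m \<in> Poly_Mapping.keys p.
     Const (Poly_Mapping.lookup p m) * (\<Prod>i \<in> Poly_Mapping.keys m. f i ^ Poly_Mapping.lookup m i))"

definition perm_act :: "(nat \<Rightarrow> nat) \<Rightarrow> 'k::field mpoly \<Rightarrow> 'k mpoly" where
  "perm_act \<sigma> = subst (\<lambda>i. X (\<sigma> i))"

definition ring_of_invariants :: "(nat \<Rightarrow> nat) set \<Rightarrow> 'k::field mpoly set \<Rightarrow> 'k mpoly set" where
  "ring_of_invariants G P = {p \<in> P. \<forall>\<sigma> \<in> G. perm_act \<sigma> p = p}"

text \<open>\<open>P = k[y\<^sub>1,\<dots>,y\<^sub>n]\<close> as a polynomial ring: the \<open>y\<^sub>i\<close> are algebraically independent
  and generate \<open>P\<close> as a \<open>k\<close>-algebra.\<close>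

definition is_poly_ring_on :: "nat \<Rightarrow> (nat \<Rightarrow> 'k::field mpoly) \<Rightarrow> 'k mpoly set \<Rightarrow> bool" where
  "is_poly_ring_on n y P \<longleftrightarrow> bij_betw (subst y) (poly_ring n) P"


text \<open>
  Linear endomorphisms of a \<open>k\<close>-subalgebra \<open>R\<close> of the polynomials are represented by functions
  on the whole type that vanish outside \<open>R\<close>. Thus equality of functions is equality of
  endomorphisms, and the pointwise vector space structure on functions
  (from \<^theory>\<open>HOL-Library.Function_Algebras\<close>) is the one on \<open>Hom\<^sub>k(R,R)\<close>.
\<close>

definition restr :: "'a set \<Rightarrow> ('a \<Rightarrow> 'b::zero) \<Rightarrow> 'a \<Rightarrow> 'b" where
  "restr R f = (\<lambda>s. if s \<in> R then f s else 0)"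

definition lin_end :: "'k::field mpoly set \<Rightarrow> ('k mpoly \<Rightarrow> 'k mpoly) set" where
  "lin_end R = {\<delta>. \<delta> ` R \<subseteq> R \<and> (\<forall>s. s \<notin> R \<longrightarrow> \<delta> s = 0) \<and>
     (\<forall>s\<in>R. \<forall>t\<in>R. \<delta> (s + t) = \<delta> s + \<delta> t) \<and>
     (\<forall>c. \<forall>s\<in>R. \<delta> (Const c * s) = Const c * \<delta> s)}"

text \<open>The index is shifted by one: \<open>diff_ops_lt R m\<close> is \<open>D\<^sup>m\<^sup>-\<^sup>1\<close>, the operators of order less than \<open>m\<close>.\<close>

primrec diff_ops_lt :: "'k::field mpoly set \<Rightarrow> nat \<Rightarrow> ('k mpoly \<Rightarrow> 'k mpoly) set" where
  "diff_ops_lt R 0 = {0}"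
| "diff_ops_lt R (Suc m) =
     {\<delta> \<in> lin_end R. \<forall>r\<in>R. restr R (\<lambda>s. \<delta> (r * s) - r * \<delta> s) \<in> diff_ops_lt R m}"

definition diff_ops :: "'k::field mpoly set \<Rightarrow> ('k mpoly \<Rightarrow> 'k mpoly) set" where
  "diff_ops R = (\<Union>m. diff_ops_lt R m)"


text \<open>In the following, \<open>P\<close> is a polynomial ring in \<open>z 1, \<dots>, z n\<close>. Exponents are
  arbitrary functions, of which only the values on \<open>{1..n}\<close> matter.\<close>

definition mon :: "nat \<Rightarrow> (nat \<Rightarrow> 'k::field mpoly) \<Rightarrow> (nat \<Rightarrow> nat) \<Rightarrow> 'k mpoly" where
  "mon n z \<alpha> = (\<Prod>i = 1..n. z i ^ \<alpha> i)"

text \<open>If \<open>\<gamma> i < \<beta> i\<close> for some \<open>i\<close>, then the truncated subtraction below is harmless, as the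
  binomial coefficient vanishes.\<close>

definition divided_deriv ::
    "nat \<Rightarrow> (nat \<Rightarrow> 'k::field mpoly) \<Rightarrow> 'k mpoly set \<Rightarrow> (nat \<Rightarrow> nat) \<Rightarrow> 'k mpoly \<Rightarrow> 'k mpoly" where
  "divided_deriv n z P \<beta> = (THE \<delta>. \<delta> \<in> lin_end P \<and>
     (\<forall>\<gamma>. \<delta> (mon n z \<gamma>) =
        (\<Prod>i = 1..n. of_nat (\<gamma> i choose \<beta> i)) * mon n z (\<lambda>i. \<gamma> i - \<beta> i)))"

definition pbw_basis ::
    "nat \<Rightarrow> (nat \<Rightarrow> 'k::field mpoly) \<Rightarrow> 'k mpoly set \<Rightarrow> ('k mpoly \<Rightarrow> 'k mpoly) set" where
  "pbw_basis n z P = {(\<lambda>s. mon n z \<alpha> * divided_deriv n z P \<beta> s) | \<alpha> \<beta>. True}"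

text \<open>The conjugation action on operators on \<open>P\<close> induced by an action \<open>\<phi>\<close> of \<open>H\<close> on \<open>P\<close>.\<close>

definition conj_act ::
    "('g, 'b) monoid_scheme \<Rightarrow> ('g \<Rightarrow> 'k::field mpoly \<Rightarrow> 'k mpoly) \<Rightarrow> 'k mpoly set \<Rightarrow>
     'g \<Rightarrow> ('k mpoly \<Rightarrow> 'k mpoly) \<Rightarrow> 'k mpoly \<Rightarrow> 'k mpoly" where
  "conj_act H \<phi> P g \<delta> = restr P (\<lambda>s. \<phi> g (\<delta> (\<phi> (inv\<^bsub>H\<^esub> g) s)))"

definition pbw_orbits ::
    "('g, 'b) monoid_scheme \<Rightarrow> ('g \<Rightarrow> 'k::field mpoly \<Rightarrow> 'k mpoly) \<Rightarrow>
     nat \<Rightarrow> (nat \<Rightarrow> 'k mpoly) \<Rightarrow> 'k mpoly set \<Rightarrow> ('k mpoly \<Rightarrow> 'k mpoly) set set" where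
  "pbw_orbits H \<phi> n z P = orbits H (pbw_basis n z P) (conj_act H \<phi> P)"

definition restr_orbit_sum ::
    "'k::field mpoly set \<Rightarrow> ('k mpoly \<Rightarrow> 'k mpoly) set \<Rightarrow> 'k mpoly \<Rightarrow> 'k mpoly" where
  "restr_orbit_sum R A = restr R (\<Sum>\<delta>\<in>A. \<delta>)"

definition op_scale :: "'k::field \<Rightarrow> ('k mpoly \<Rightarrow> 'k mpoly) \<Rightarrow> 'k mpoly \<Rightarrow> 'k mpoly" where
  "op_scale c \<delta> = (\<lambda>s. Const c * \<delta> s)"

global_interpretation op: vector_space op_scale
  by unfold_locales
    (auto simp: op_scale_def Const_def fun_eq_iff algebra_simps single_add mult_single
      simp flip: mult.assoc)

text \<open>The family \<open>(f i)\<close>, \<open>i \<in> I\<close>, is a \<open>k\<close>-basis of \<open>V\<close>; in particular, its members are distinct.\<close>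

definition is_k_basis ::
    "('i \<Rightarrow> 'k::field mpoly \<Rightarrow> 'k mpoly) \<Rightarrow> 'i set \<Rightarrow> ('k mpoly \<Rightarrow> 'k mpoly) set \<Rightarrow> bool" where
  "is_k_basis f I V \<longleftrightarrow> inj_on f I \<and>
     op.independent (f ` I) \<and> op.span (f ` I) = V"


definition transpositions :: "nat \<Rightarrow> (nat \<Rightarrow> nat) set" where
  "transpositions n =
     {Transposition.transpose a b | a b. a \<in> {1..n} \<and> b \<in> {1..n} \<and> a \<noteq> b}"

abbreviation perm_group :: "nat \<Rightarrow> (nat \<Rightarrow> nat) set \<Rightarrow> (nat \<Rightarrow> nat) monoid" where
  "perm_group n G \<equiv> (sym_group n)\<lparr>carrier := G\<rparr>"

text \<open>The action of a coset on the \<open>N\<close>-invariants: all elements of the coset act in the same way.\<close>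

definition coset_act :: "(nat \<Rightarrow> nat) set \<Rightarrow> 'k::field mpoly \<Rightarrow> 'k mpoly" where
  "coset_act C s = the_elem ((\<lambda>\<sigma>. perm_act \<sigma> s) ` C)"

definition elem_sym :: "nat set \<Rightarrow> nat \<Rightarrow> 'k::field mpoly" where
  "elem_sym A j = (\<Sum>B | B \<subseteq> A \<and> card B = j. \<Prod>i\<in>B. X i)"

definition orbit_elem_syms :: "nat \<Rightarrow> (nat \<Rightarrow> nat) set \<Rightarrow> 'k::field mpoly set" where
  "orbit_elem_syms n N =
     (\<Union>A \<in> orbits (perm_group n N) {1..n} (\<lambda>\<sigma> i. \<sigma> i). elem_sym A ` {1..card A})"

end

theory Submission
  imports Defs
begin

text \<open>Let \<open>P = k[x\<^sub>1,\<dots>,x\<^sub>n]\<close>, let \<open>H\<close> be a group of permutations of the variables that contains no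
transposition, and let \<open>R = P\<^sup>H\<close>. The theorem rests on two facts about the operators
\<open>A = \<Sum>a\<^sub>\<beta> \<partial>\<^sup>\<beta>\<close> with finitely many nonzero \<open>a\<^sub>\<beta> \<in> P\<close>: such an operator is determined by its restriction
to \<open>R\<close> (\<open>ddiff_unique\<close>), and every differential operator on \<open>R\<close> is the restriction of one (\<open>extension\<close>).
If \<open>A\<close> extends a differential operator on \<open>R\<close>, so do its conjugates under \<open>H\<close>; hence they all equal \<open>A\<close>,
the PBW-coefficients of \<open>A\<close> are constant on orbits, and the orbit sums span. Uniqueness also gives
their independence (\<open>orbit_sums_independent\<close>, \<open>orbit_sums_span\<close>).

The conceptual reason behind the two facts is that \<open>R \<rightarrow> P\<close> is etale in codimension one. The proof replaces
this by explicit elements of \<open>P \<otimes> P = P[w\<^sub>1,\<dots>,w\<^sub>n]\<close>. A \<open>k\<close>-linear map \<open>A\<close> on \<open>P\<close> is the same as the \<open>P\<close>-linear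
functional \<open>l\<close> on \<open>P[w]\<close> with \<open>l (w\<^sup>m) = A (x\<^sup>m)\<close>. If each \<open>w\<^sub>i - x\<^sub>i\<close> is nilpotent for \<open>l\<close>, then Taylor
expansion of \<open>w\<^sup>m = (x + (w - x))\<^sup>m\<close> exhibits \<open>A\<close> as \<open>\<Sum>a\<^sub>\<beta> \<partial>\<^sup>\<beta>\<close> with \<open>a\<^sub>\<beta> = l ((w - x)\<^sup>\<beta>)\<close> (\<open>taylor_lift\<close>).
Choose for each \<open>\<sigma> \<noteq> id\<close> in \<open>H\<close> a variable \<open>k \<sigma>\<close> moved by \<open>\<sigma>\<close>. The element
\<open>e = \<Prod>\<^bsub>\<sigma> \<noteq> id\<^esub> (x\<^bsub>k \<sigma>\<^esub> - w\<^bsub>\<sigma> (k \<sigma>)\<^esub>)\<close> vanishes on the graph of every \<open>\<sigma> \<noteq> id\<close>, while on the diagonal it is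
\<open>d = \<Prod>\<^bsub>\<sigma> \<noteq> id\<^esub> (x\<^bsub>k \<sigma>\<^esub> - x\<^bsub>\<sigma> (k \<sigma>)\<^esub>) \<noteq> 0\<close>: up to the denominator \<open>d\<close> and up to nilpotents it is the idempotent that
splits off the diagonal. Multiplication by powers of \<open>e\<close> proves uniqueness, and it proves that
\<open>d\<^sup>M \<delta>\<close> extends to \<open>P\<close> for some \<open>M\<close> (\<open>extension_with_denominator\<close>).

The denominator \<open>d\<close> is a product of differences of variables. As \<open>H\<close> contains no transposition, the \<open>k \<sigma>\<close> can be
chosen such that a given prime \<open>x\<^sub>i - x\<^sub>j\<close> does not divide \<open>d\<close>. Comparison of the extensions with denominators
of both kinds therefore cancels the factors \<open>x\<^sub>i - x\<^sub>j\<close> one by one (\<open>extends_cancel\<close>).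

For arbitrary \<open>G\<close>, the transpositions in \<open>G\<close> define blocks, and \<open>N\<close> is the group of all permutations that
preserve every block. A lexicographic leading monomial argument shows that \<open>S\<^sup>N\<close> is the polynomial ring in the
elementary symmetric polynomials of the blocks (\<open>is_poly_ring_on_E\<close>). The group \<open>G\<close> permutes these generators, and
no element of \<open>G\<close> induces a transposition of them: it would have to exchange two blocks \<open>{a}\<close> and \<open>{b}\<close> and
preserve all others, so that \<open>(a b)\<close> would lie in \<open>G\<close> and \<open>a\<close>, \<open>b\<close> would belong to one block
(\<open>no_transposition_of_E\<close>). Thus the case without transpositions applies to \<open>S\<^sup>N\<close> in the coordinates \<open>y\<^sub>i\<close>; the
result is transported along the isomorphism \<open>x\<^sub>i \<mapsto> y\<^sub>i\<close> (\<open>pbw_orbit_sums_basis\<close>).\<close>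

section \<open>Polynomials and their homomorphisms\<close>

abbreviation lookup where "lookup \<equiv> Poly_Mapping.lookup"
abbreviation keys where "keys \<equiv> Poly_Mapping.keys"
abbreviation single where "single \<equiv> Poly_Mapping.single"
type_synonym 'a pol = "(nat \<Rightarrow>\<^sub>0 nat) \<Rightarrow>\<^sub>0 'a"
type_synonym pbw_index = "(nat \<Rightarrow> nat) \<times> (nat \<Rightarrow> nat)"
abbreviation swap where "swap \<equiv> Transposition.transpose"

text \<open>Ring homomorphisms between types; the sources and targets below are polynomial rings over \<open>k\<close> and
polynomial rings over these, for which the coefficient ring is again a type.\<close>

definition ring_hom_fun :: "('a::comm_ring_1 \<Rightarrow> 'b::comm_ring_1) \<Rightarrow> bool" where
  "ring_hom_fun f \<longleftrightarrow> f 1 = 1 \<and> (\<forall>x y. f (x + y) = f x + f y) \<and> (\<forall>x y. f (x * y) = f x * f y)"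

lemma hom_add: "ring_hom_fun f \<Longrightarrow> f (x + y) = f x + f y"
  and hom_mult: "ring_hom_fun f \<Longrightarrow> f (x * y) = f x * f y"
  and hom_one: "ring_hom_fun f \<Longrightarrow> f 1 = 1"
  by (auto simp: ring_hom_fun_def)

lemma hom_zero: "ring_hom_fun f \<Longrightarrow> f 0 = 0"
  using hom_add[of f 0 0] by simp

lemma hom_uminus: "ring_hom_fun f \<Longrightarrow> f (- x) = - f x"
  using hom_add[of f x "- x"] by (simp add: hom_zero eq_neg_iff_add_eq_0 add.commute)

lemma hom_diff: "ring_hom_fun f \<Longrightarrow> f (x - y) = f x - f y"
  using hom_add[of f x "- y"] by (simp add: hom_uminus)

lemma hom_sum: "ring_hom_fun f \<Longrightarrow> f (\<Sum>i\<in>A. g i) = (\<Sum>i\<in>A. f (g i))"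
  by (induction A rule: infinite_finite_induct) (auto simp: hom_zero hom_add)

lemma hom_prod: "ring_hom_fun f \<Longrightarrow> f (\<Prod>i\<in>A. g i) = (\<Prod>i\<in>A. f (g i))"
  by (induction A rule: infinite_finite_induct) (auto simp: hom_one hom_mult)

lemma hom_power: "ring_hom_fun f \<Longrightarrow> f (x ^ k) = f x ^ k"
  by (induction k) (auto simp: hom_one hom_mult)

lemmas hom_simps = hom_add hom_mult hom_one hom_zero hom_uminus hom_diff hom_sum hom_prod hom_power

lemma hom_id: "ring_hom_fun (\<lambda>x. x)"
  by (simp add: ring_hom_fun_def)

lemma hom_comp: "ring_hom_fun f \<Longrightarrow> ring_hom_fun g \<Longrightarrow> ring_hom_fun (\<lambda>x. f (g x))"
  by (simp add: ring_hom_fun_def)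

lemma hom_single: "ring_hom_fun (single 0 :: 'a::comm_ring_1 \<Rightarrow> 'b::comm_monoid_add \<Rightarrow>\<^sub>0 'a)"
  by (auto simp: ring_hom_fun_def single_add mult_single)

lemma poly_mapping_sum_singles:
  fixes p :: "'i \<Rightarrow>\<^sub>0 'a::comm_monoid_add"
  shows "p = (\<Sum>m\<in>keys p. single m (lookup p m))"
proof (rule poly_mapping_eqI)
  fix k
  have "lookup (\<Sum>m\<in>keys p. single m (lookup p m)) k
      = (\<Sum>m\<in>keys p. if m = k then lookup p m else 0)"
    unfolding lookup_sum by (rule sum.cong) (auto simp: lookup_single when_def)
  also have "\<dots> = lookup p k"
    by (auto simp: in_keys_iff)
  finally show "lookup p k =
      lookup (\<Sum>m\<in>keys p. single m (lookup p m)) k"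
    by simp
qed

lemma poly_mapping_single_induct [case_names zero add single]:
  fixes p :: "'i \<Rightarrow>\<^sub>0 'a::comm_monoid_add"
  assumes "Q 0" "\<And>p q. Q p \<Longrightarrow> Q q \<Longrightarrow> Q (p + q)"
    and "\<And>m a. m \<in> keys p \<Longrightarrow> Q (single m a)"
  shows "Q p"
proof -
  have "Q (\<Sum>m\<in>M. single m (lookup p m))"
    if "M \<subseteq> keys p" for M
    using finite_subset[OF that finite_keys] that
    by (induction M rule: finite_induct) (auto intro: assms)
  from this[OF order_refl] show ?thesis
    by (simp flip: poly_mapping_sum_singles)
qed

definition monomial :: "(nat \<Rightarrow> 'b::comm_ring_1) \<Rightarrow> (nat \<Rightarrow>\<^sub>0 nat) \<Rightarrow> 'b" where
  "monomial b m = (\<Prod>i\<in>keys m. b i ^ lookup m i)"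

definition eval_hom ::
    "('a::comm_ring_1 \<Rightarrow> 'b::comm_ring_1) \<Rightarrow> (nat \<Rightarrow> 'b) \<Rightarrow> 'a pol \<Rightarrow> 'b" where
  "eval_hom c b p = (\<Sum>m\<in>keys p. c (lookup p m) * monomial b m)"

definition Var :: "nat \<Rightarrow> 'a::comm_ring_1 pol" where
  "Var i = single (single i 1) 1"

lemma X_eq_Var: "X = Var"
  by (auto simp: X_def Var_def)

lemma monomial_superset:
  assumes "finite A" "keys m \<subseteq> A"
  shows "monomial b m = (\<Prod>i\<in>A. b i ^ lookup m i)"
  unfolding monomial_def
  by (rule prod.mono_neutral_left) (use assms in \<open>auto simp: in_keys_iff\<close>)

lemma monomial_0 [simp]: "monomial b 0 = 1"
  by (simp add: monomial_def)

lemma monomial_add: "monomial b (m + m') = monomial b m * monomial b m'"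
proof -
  let ?A = "keys m \<union> keys m'"
  have "monomial b (m + m') = (\<Prod>i\<in>?A. b i ^ lookup (m + m') i)"
    by (rule monomial_superset) (auto dest: subsetD[OF Poly_Mapping.keys_add])
  moreover have "monomial b m = (\<Prod>i\<in>?A. b i ^ lookup m i)"
    "monomial b m' = (\<Prod>i\<in>?A. b i ^ lookup m' i)"
    by (rule monomial_superset; auto)+
  ultimately show ?thesis
    by (simp add: lookup_add power_add prod.distrib)
qed

lemma monomial_single: "monomial b (single i k) = b i ^ k"
  by (cases "k = 0") (auto simp: monomial_def)

lemma hom_monomial: "ring_hom_fun f \<Longrightarrow> f (monomial b m) = monomial (\<lambda>i. f (b i)) m"
  by (simp add: monomial_def hom_prod hom_power)

lemma monomial_cong:
  "(\<And>i. i \<in> keys m \<Longrightarrow> b i = b' i) \<Longrightarrow> monomial b m = monomial b' m"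
  by (simp add: monomial_def)

lemma monomial_eq_0:
  assumes "i \<in> keys m" "b i = 0"
  shows "monomial b m = 0"
proof -
  have "lookup m i \<noteq> 0" using assms by (simp add: in_keys_iff)
  then have "b i ^ lookup m i = 0" using assms(2) by (simp add: zero_power)
  then show ?thesis unfolding monomial_def using assms(1)
    by (meson finite_keys prod_zero)
qed

text \<open>Builds an exponent vector by raising one exponent at a time, which corresponds to multiplication of a
monomial by a variable.\<close>

lemma exponent_induct [case_names zero single]:
  assumes "Q 0" "\<And>m i. Q m \<Longrightarrow> Q (m + single i (1::nat))"
  shows "Q (m :: nat \<Rightarrow>\<^sub>0 nat)"
proof -
  have *: "Q (m + single i k)" if "Q m" for m i k
  proof (induction k)
    case (Suc k)
    have "m + single i (Suc k) = (m + single i k) + single i 1"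
      by (simp add: add.assoc flip: single_add)
    with Suc assms(2) show ?case by metis
  qed (use that in simp)
  have "Q (\<Sum>i\<in>M. single i (lookup m i))" if "finite M" for M
    using that by (induction M rule: finite_induct) (auto intro: assms * simp: add.commute[of "single _ _"])
  from this[of "keys m"] show ?thesis
    by (simp flip: poly_mapping_sum_singles)
qed

lemma monomial_Var: "monomial Var m = single m 1"
proof (induction m rule: exponent_induct)
  case (single m i)
  then show ?case by (simp add: monomial_add monomial_single Var_def mult_single)
qed simp

lemma single_conv_monomial:
  "single m a = single 0 a * monomial Var m"
  by (simp add: monomial_Var mult_single)

context
  fixes c :: "'a::comm_ring_1 \<Rightarrow> 'b::comm_ring_1"
  assumes c: "ring_hom_fun c"
begin

lemma eval_hom_superset:
  assumes "finite A" "keys p \<subseteq> A"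
  shows "eval_hom c b p = (\<Sum>m\<in>A. c (lookup p m) * monomial b m)"
  unfolding eval_hom_def
  by (rule sum.mono_neutral_left) (use assms in \<open>auto simp: in_keys_iff hom_zero[OF c]\<close>)

lemma eval_hom_add: "eval_hom c b (p + q) = eval_hom c b p + eval_hom c b q"
proof -
  let ?A = "keys p \<union> keys q"
  have *: "eval_hom c b r = (\<Sum>m\<in>?A. c (lookup r m) * monomial b m)"
    if "keys r \<subseteq> ?A" for r
    by (rule eval_hom_superset) (use that in auto)
  show ?thesis
    by (simp add: * Poly_Mapping.keys_add lookup_add hom_add[OF c] distrib_right sum.distrib)
qed

lemma eval_hom_0 [simp]: "eval_hom c b 0 = 0"
  by (simp add: eval_hom_def)

lemma eval_hom_single: "eval_hom c b (single m a) = c a * monomial b m"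
  by (cases "a = 0") (auto simp: eval_hom_def hom_zero[OF c])

lemma eval_hom_Var: "eval_hom c b (Var i) = b i"
  by (simp add: Var_def eval_hom_single monomial_single hom_one[OF c])

lemma eval_hom_mult: "eval_hom c b (p * q) = eval_hom c b p * eval_hom c b q"
proof (induction p rule: poly_mapping_single_induct)
  case (single m a)
  show ?case
  proof (induction q rule: poly_mapping_single_induct)
    case (single m' a')
    show ?case by (simp add: mult_single eval_hom_single monomial_add hom_mult[OF c] mult_ac)
  qed (simp_all add: eval_hom_add distrib_left)
qed (simp_all add: eval_hom_add distrib_right)

lemma hom_eval_hom: "ring_hom_fun (eval_hom c b)"
  unfolding ring_hom_fun_def
  using eval_hom_single[of b 0 1] by (simp add: eval_hom_add eval_hom_mult hom_one[OF c])

end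

lemma hom_determined:
  assumes f: "ring_hom_fun f" and g: "ring_hom_fun g"
    and "\<And>a. f (single 0 a) = g (single 0 a)"
    and "\<And>m i. m \<in> keys p \<Longrightarrow> i \<in> keys m \<Longrightarrow> f (Var i) = g (Var i)"
  shows "f p = g p"
proof (induction p rule: poly_mapping_single_induct)
  case (single m a)
  show ?case unfolding single_conv_monomial[of m a] hom_mult[OF f] hom_mult[OF g]
    hom_monomial[OF f] hom_monomial[OF g] using assms(3) assms(4)[OF single]
    by (metis (no_types, lifting) monomial_cong)
qed (use f g in \<open>simp_all add: hom_simps\<close>)

text \<open>Two evaluations agree modulo an ideal that contains the differences of the values of the
variables. This serves for the diagonal ideal of \<open>P[w]\<close> and for divisibility by \<open>x\<^sub>i - x\<^sub>j\<close>.\<close>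

lemma monomial_diff_in_ideal:
  assumes J: "\<And>x y. x \<in> J \<Longrightarrow> y \<in> J \<Longrightarrow> x + y \<in> J" "\<And>x r. x \<in> J \<Longrightarrow> r * x \<in> J" "0 \<in> J"
    and b: "\<And>i. i \<in> keys m \<Longrightarrow> b i - b' i \<in> J"
  shows "monomial b m - monomial b' m \<in> (J :: 'a::comm_ring_1 set)"
proof -
  have pw: "x ^ k - y ^ k \<in> J" if "x - y \<in> J" for x y and k :: nat
  proof (induction k)
    case (Suc k)
    have "x ^ Suc k - y ^ Suc k = x ^ k * (x - y) + y * (x ^ k - y ^ k)" by (simp add: algebra_simps)
    then show ?case using Suc that by (simp add: J)
  qed (use J in simp)
  have "(\<Prod>i\<in>M. b i ^ lookup m i) - (\<Prod>i\<in>M. b' i ^ lookup m i) \<in> J"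
    if "M \<subseteq> keys m" for M
    using finite_subset[OF that finite_keys] that
  proof (induction M rule: finite_induct)
    case (insert i M)
    let ?P = "\<lambda>b. \<Prod>i\<in>M. b i ^ lookup m i" and ?e = "lookup m i"
    have "(\<Prod>i\<in>insert i M. b i ^ lookup m i) - (\<Prod>i\<in>insert i M. b' i ^ lookup m i)
      = ?P b * (b i ^ ?e - b' i ^ ?e) + b' i ^ ?e * (?P b - ?P b')"
      using insert by (simp add: algebra_simps)
    moreover have "?P b - ?P b' \<in> J" "b i ^ ?e - b' i ^ ?e \<in> J"
      using insert pw[OF b] by auto
    ultimately show ?case by (simp add: J)
  qed (use J in simp)
  then show ?thesis by (simp add: monomial_def)
qed

section \<open>Permutations of the variables\<close>

definition exp_act :: "(nat \<Rightarrow> nat) \<Rightarrow> (nat \<Rightarrow>\<^sub>0 nat) \<Rightarrow> nat \<Rightarrow>\<^sub>0 nat" where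
  "exp_act \<tau> m = Poly_Mapping.map_key (inv' \<tau>) m"

text \<open>The same action as \<^const>\<open>perm_act\<close>, but for arbitrary commutative coefficient rings: it is also applied to
polynomials in \<open>w\<close> with coefficients in \<open>P\<close>, where it moves only the variables \<open>w\<close>.\<close>

definition var_act :: "(nat \<Rightarrow> nat) \<Rightarrow> 'a::comm_ring_1 pol \<Rightarrow> 'a pol" where
  "var_act \<tau> = eval_hom (single 0) (\<lambda>i. Var (\<tau> i))"

lemma lookup_exp_act:
  assumes "bij \<tau>"
  shows "lookup (exp_act \<tau> m) j = lookup m (inv' \<tau> j)"
proof -
  have "inj (inv' \<tau>)" using assms by (simp add: bij_imp_bij_inv bij_is_inj)
  then show ?thesis by (simp add: exp_act_def map_key.rep_eq)
qed

lemma lookup_exp_act':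
  assumes "bij \<tau>"
  shows "lookup (exp_act \<tau> m) (\<tau> j) = lookup m j"
  using assms by (simp add: lookup_exp_act bij_is_inj)

lemma exp_act_id [simp]: "exp_act id m = m"
  by (rule poly_mapping_eqI) (simp add: lookup_exp_act inv_id)

lemma exp_act_comp:
  assumes "bij \<sigma>" "bij \<tau>"
  shows "exp_act (\<sigma> \<circ> \<tau>) m = exp_act \<sigma> (exp_act \<tau> m)"
  by (rule poly_mapping_eqI)
    (use assms in \<open>simp add: lookup_exp_act o_inv_distrib bij_comp del: o_apply\<close>, simp)

lemma exp_act_add: "bij \<tau> \<Longrightarrow> exp_act \<tau> (m + m') = exp_act \<tau> m + exp_act \<tau> m'"
  by (rule poly_mapping_eqI) (simp add: lookup_exp_act lookup_add)

lemma exp_act_0: "bij \<tau> \<Longrightarrow> exp_act \<tau> 0 = 0"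
  by (rule poly_mapping_eqI) (simp add: lookup_exp_act)

lemma exp_act_single: "bij \<tau> \<Longrightarrow> exp_act \<tau> (single i k) = single (\<tau> i) k"
  by (rule poly_mapping_eqI) (auto simp: lookup_exp_act lookup_single when_def bij_inv_eq_iff)

lemma exp_act_inv_exp_act [simp]:
  assumes "bij \<tau>"
  shows "exp_act (inv' \<tau>) (exp_act \<tau> m) = m"
  using exp_act_comp[OF bij_imp_bij_inv[OF assms] assms, of m] assms
  by (simp add: bij_is_inj)

lemma keys_exp_act:
  assumes "bij \<tau>"
  shows "keys (exp_act \<tau> m) = \<tau> ` keys m"
proof (intro equalityI subsetI)
  fix i assume "i \<in> keys (exp_act \<tau> m)"
  then have "inv' \<tau> i \<in> keys m" by (simp add: in_keys_iff lookup_exp_act assms)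
  then show "i \<in> \<tau> ` keys m"
    by (metis assms bij_inv_eq_iff image_eqI)
qed (auto simp: in_keys_iff lookup_exp_act' assms)

lemma hom_var_act: "ring_hom_fun (var_act \<tau>)"
  unfolding var_act_def by (rule hom_eval_hom[OF hom_single])

lemma var_act_const [simp]: "var_act \<tau> (single 0 a) = single 0 a"
  by (simp add: var_act_def eval_hom_single[OF hom_single])

lemma var_act_Var [simp]: "var_act \<tau> (Var i) = Var (\<tau> i)"
  by (simp add: var_act_def eval_hom_Var[OF hom_single])

lemma monomial_Var_perm: "bij \<tau> \<Longrightarrow> monomial (\<lambda>i. Var (\<tau> i)) m = single (exp_act \<tau> m) 1"
proof (induction m rule: exponent_induct)
  case (single m i)
  then show ?case by (simp add: monomial_add monomial_single Var_def exp_act_add exp_act_single mult_single)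
qed (simp add: exp_act_0)

lemma var_act_single:
  "bij \<tau> \<Longrightarrow> var_act \<tau> (single m a) = single (exp_act \<tau> m) a"
  by (simp add: var_act_def eval_hom_single[OF hom_single] monomial_Var_perm mult_single)

lemma lookup_var_act:
  assumes "bij \<tau>"
  shows "lookup (var_act \<tau> p) (exp_act \<tau> m) = lookup p m"
proof (induction p rule: poly_mapping_single_induct)
  case (single m' a)
  have "exp_act \<tau> m' = exp_act \<tau> m \<longleftrightarrow> m' = m" using assms by (metis exp_act_inv_exp_act)
  then show ?case by (simp add: var_act_single assms lookup_single when_def)
qed (simp_all add: hom_simps[OF hom_var_act] lookup_add)

lemma var_act_id [simp]: "var_act id p = p"
  by (rule hom_determined[OF hom_var_act hom_id]) auto

lemma var_act_comp: "var_act (\<sigma> \<circ> \<tau>) p = var_act \<sigma> (var_act \<tau> p)"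
  by (rule hom_determined[OF hom_var_act hom_comp[OF hom_var_act hom_var_act]]) auto

lemma subst_eq_eval_hom: "subst = eval_hom (single 0)"
  by (simp add: fun_eq_iff subst_def eval_hom_def monomial_def Const_def)

lemma perm_act_eq_var_act: "perm_act = var_act"
  by (simp add: fun_eq_iff perm_act_def var_act_def subst_eq_eval_hom X_eq_Var)

text \<open>A group of permutations of \<open>{1..n}\<close>, given by its set of elements.\<close>

locale perm_set =
  fixes n :: nat and H :: "(nat \<Rightarrow> nat) set"
  assumes perms: "\<tau> \<in> H \<Longrightarrow> \<tau> permutes {1..n}"
    and id_in: "id \<in> H"
    and comp_in: "\<sigma> \<in> H \<Longrightarrow> \<tau> \<in> H \<Longrightarrow> \<sigma> \<circ> \<tau> \<in> H"
    and inv_in: "\<sigma> \<in> H \<Longrightarrow> inv' \<sigma> \<in> H"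
begin

lemma bij_H: "\<tau> \<in> H \<Longrightarrow> bij \<tau>"
  using perms permutes_bij by blast

lemma finite_H: "finite H"
  by (rule finite_subset[OF _ finite_permutations[of "{1..n}"]]) (use perms in auto)

lemma translate_H:
  assumes "\<sigma> \<in> H"
  shows "bij_betw ((\<circ>) \<sigma>) H H"
proof (rule bij_betwI[where g = "(\<circ>) (inv' \<sigma>)"])
  have "bij \<sigma>" using assms by (rule bij_H)
  then show "inv' \<sigma> \<circ> (\<sigma> \<circ> \<tau>) = \<tau>" "\<sigma> \<circ> (inv' \<sigma> \<circ> \<tau>) = \<tau>" for \<tau>
    by (simp_all add: bij_is_inj bij_is_surj flip: comp_assoc surj_iff)
      (metis bij_is_surj id_comp surj_iff)
qed (use assms comp_in inv_in in auto)

definition orb :: "(nat \<Rightarrow>\<^sub>0 nat) \<Rightarrow> (nat \<Rightarrow>\<^sub>0 nat) set" where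
  "orb m = (\<lambda>\<tau>. exp_act \<tau> m) ` H"

definition orbit_poly :: "(nat \<Rightarrow>\<^sub>0 nat) \<Rightarrow> 'a::comm_ring_1 pol" where
  "orbit_poly m = (\<Sum>m'\<in>orb m. single m' 1)"

definition invar :: "'a::comm_ring_1 pol \<Rightarrow> bool" where
  "invar p \<longleftrightarrow> (\<forall>\<tau>\<in>H. var_act \<tau> p = p)"

text \<open>The trace from \<open>P[w]\<close> to the polynomials that are \<open>H\<close>-invariant in \<open>w\<close>.\<close>

definition Tr :: "'a::comm_ring_1 pol \<Rightarrow> 'a pol" where
  "Tr p = (\<Sum>\<tau>\<in>H. var_act \<tau> p)"

lemma finite_orb [simp]: "finite (orb m)"
  by (simp add: orb_def finite_H)

lemma in_orb_self: "m \<in> orb m"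
  unfolding orb_def using id_in by (force intro: image_eqI[where x = id])

lemma orb_eq:
  assumes "m' \<in> orb m"
  shows "orb m' = orb m"
proof -
  obtain \<tau> where t: "\<tau> \<in> H" "m' = exp_act \<tau> m" using assms by (auto simp: orb_def)
  have 1: "orb (exp_act \<sigma> k) \<subseteq> orb k" if "\<sigma> \<in> H" for \<sigma> k
    using that comp_in by (auto simp: orb_def bij_H simp flip: exp_act_comp)
  have "m = exp_act (inv' \<tau>) m'" using t by (simp add: bij_H)
  then have "orb m \<subseteq> orb m'" using 1[OF inv_in[OF t(1)], of m'] by simp
  moreover have "orb m' \<subseteq> orb m" unfolding t(2) by (rule 1[OF t(1)])
  ultimately show ?thesis by blast
qed

lemma invar_closed:
  "invar 0" "invar 1" "invar (single 0 a)"
  "invar p \<Longrightarrow> invar q \<Longrightarrow> invar (p + q)" "invar p \<Longrightarrow> invar q \<Longrightarrow> invar (p * q)"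
  "invar p \<Longrightarrow> invar q \<Longrightarrow> invar (p - q)" "invar p \<Longrightarrow> invar (- p)" "invar p \<Longrightarrow> invar (p ^ k)"
  "(\<And>i. i \<in> A \<Longrightarrow> invar (f i)) \<Longrightarrow> invar (\<Sum>i\<in>A. f i)"
  by (auto simp: invar_def hom_simps[OF hom_var_act] intro!: sum.cong)

lemma invar_orbit_poly: "invar (orbit_poly m)"
  unfolding invar_def
proof
  fix \<tau> assume t: "\<tau> \<in> H"
  have inj: "inj_on (exp_act \<tau>) (orb m)" using t by (metis bij_H exp_act_inv_exp_act inj_on_inverseI)
  have "exp_act \<tau> ` orb m \<subseteq> orb m"
    using t by (auto simp: orb_def bij_H comp_in simp flip: exp_act_comp)
  then have im: "exp_act \<tau> ` orb m = orb m"
    using inj by (simp add: card_image card_subset_eq)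
  have "var_act \<tau> (orbit_poly m) = (\<Sum>m'\<in>orb m. single (exp_act \<tau> m') 1)"
    by (simp add: orbit_poly_def hom_simps[OF hom_var_act] var_act_single bij_H t)
  also have "\<dots> = (\<Sum>m'\<in>exp_act \<tau> ` orb m. single m' 1)"
    by (simp add: sum.reindex[OF inj])
  finally show "var_act \<tau> (orbit_poly m) = orbit_poly m" by (simp add: im orbit_poly_def)
qed

lemma lookup_orbit_poly: "lookup (orbit_poly m) m' = (if m' \<in> orb m then 1 else 0)"
  by (simp add: orbit_poly_def lookup_sum lookup_single when_def)

lemma invar_lookup:
  assumes "invar p" "m' \<in> orb m"
  shows "lookup p m' = lookup p m"
  using assms by (auto simp: orb_def invar_def) (metis bij_H lookup_var_act)

text \<open>Invariant polynomials are linear combinations of orbit sums of monomials, over any coefficient ring. In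
particular, the invariants of \<open>P[w]\<close> are generated over \<open>P\<close> by the elements \<open>r(w)\<close> with \<open>r \<in> R\<close>.\<close>

lemma invar_induct [consumes 1, case_names zero add orbit]:
  assumes "invar p" "Q 0" "\<And>p q. Q p \<Longrightarrow> Q q \<Longrightarrow> Q (p + q)"
    and orbit: "\<And>m a. m \<in> keys p \<Longrightarrow> Q (single 0 a * orbit_poly m)"
  shows "Q p"
proof -
  have "p = (\<Sum>m\<in>keys p. single m (lookup p m))"
    by (rule poly_mapping_sum_singles)
  also have "\<dots> = (\<Sum>B\<in>orb ` keys p.
      \<Sum>m\<in>{m \<in> keys p. orb m = B}. single m (lookup p m))"
    by (rule sum.image_gen) simp
  finally have p: "p = \<dots>" .
  have cls: "Q (\<Sum>m\<in>{m \<in> keys p. orb m = B}. single m (lookup p m))"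
    if B: "B \<in> orb ` keys p" for B
  proof -
    obtain k where k: "k \<in> keys p" "B = orb k" using B by blast
    have eq: "{m \<in> keys p. orb m = B} = orb k"
    proof (intro equalityI subsetI)
      fix m assume m: "m \<in> orb k"
      with k(1) invar_lookup[OF assms(1) m] show "m \<in> {m \<in> keys p. orb m = B}"
        by (simp add: in_keys_iff orb_eq[OF m] k(2))
    qed (use in_orb_self k in auto)
    have "(\<Sum>m\<in>orb k. single m (lookup p m))
        = (\<Sum>m\<in>orb k. single m (lookup p k))"
      by (rule sum.cong) (auto simp: invar_lookup[OF assms(1)])
    also have "\<dots> = single 0 (lookup p k) * orbit_poly k"
      by (simp add: orbit_poly_def sum_distrib_left mult_single)
    finally show ?thesis unfolding eq using orbit[OF k(1)] by simp
  qed
  have "Q (\<Sum>B\<in>M. \<Sum>m\<in>{m \<in> keys p. orb m = B}. single m (lookup p m))"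
    if "finite M" "M \<subseteq> orb ` keys p" for M
    using that by (induction M rule: finite_induct) (simp_all add: assms(2,3) cls)
  then show ?thesis by (subst p) simp
qed

lemma Tr_add: "Tr (p + q) = Tr p + Tr q"
  by (simp add: Tr_def hom_simps[OF hom_var_act] sum.distrib)

lemma invar_sum_H:
  assumes "\<And>\<tau> \<sigma>. \<sigma> \<in> H \<Longrightarrow> \<tau> \<in> H \<Longrightarrow> var_act \<sigma> (f \<tau>) = f (\<sigma> \<circ> \<tau>)"
  shows "invar (\<Sum>\<tau>\<in>H. f \<tau>)"
  unfolding invar_def
proof
  fix \<sigma> assume "\<sigma> \<in> H"
  then have "var_act \<sigma> (\<Sum>\<tau>\<in>H. f \<tau>) = (\<Sum>\<tau>\<in>H. f (\<sigma> \<circ> \<tau>))"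
    by (simp add: hom_simps[OF hom_var_act] assms)
  then show "var_act \<sigma> (\<Sum>\<tau>\<in>H. f \<tau>) = (\<Sum>\<tau>\<in>H. f \<tau>)"
    by (simp add: sum.reindex_bij_betw[OF translate_H[OF \<open>\<sigma> \<in> H\<close>], of f])
qed

lemma invar_Tr: "invar (Tr p)"
  unfolding Tr_def by (rule invar_sum_H) (simp add: var_act_comp)

lemma Tr_mult_invar: "invar y \<Longrightarrow> Tr (y * p) = y * Tr p"
  by (auto simp: Tr_def invar_def hom_simps[OF hom_var_act] sum_distrib_left)

end

section \<open>Functionals on \<open>P[w]\<close> and Taylor expansion\<close>

text \<open>The \<open>c\<close>-semilinear extension of a map given on monomials.\<close>

definition lin_ext :: "('a::comm_ring_1 \<Rightarrow> 'b::comm_ring_1) \<Rightarrow> ('i \<Rightarrow> 'b) \<Rightarrow> ('i \<Rightarrow>\<^sub>0 'a) \<Rightarrow> 'b" where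
  "lin_ext c d p = (\<Sum>m\<in>keys p. c (lookup p m) * d m)"

lemma lin_ext_0 [simp]: "lin_ext c d 0 = 0"
  by (simp add: lin_ext_def)

lemma lin_ext_single: "ring_hom_fun c \<Longrightarrow> lin_ext c d (single m a) = c a * d m"
  by (cases "a = 0") (auto simp: lin_ext_def hom_zero)

lemma lin_ext_superset:
  assumes "ring_hom_fun c" "finite A" "keys p \<subseteq> A"
  shows "lin_ext c d p = (\<Sum>m\<in>A. c (lookup p m) * d m)"
  unfolding lin_ext_def
  by (rule sum.mono_neutral_left) (use assms in \<open>auto simp: in_keys_iff hom_zero\<close>)

lemma lin_ext_add:
  assumes c: "ring_hom_fun c"
  shows "lin_ext c d (p + q) = lin_ext c d p + lin_ext c d q"
proof -
  let ?A = "keys p \<union> keys q"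
  have *: "lin_ext c d r = (\<Sum>m\<in>?A. c (lookup r m) * d m)"
    if "keys r \<subseteq> ?A" for r
    by (rule lin_ext_superset[OF c]) (use that in auto)
  show ?thesis
    by (simp add: * Poly_Mapping.keys_add lookup_add hom_add[OF c] distrib_right sum.distrib)
qed

definition coef_linear :: "('a::comm_ring_1 pol \<Rightarrow> 'a) \<Rightarrow> bool" where
  "coef_linear l \<longleftrightarrow> (\<forall>x y. l (x + y) = l x + l y) \<and>
     (\<forall>a x. l (single 0 a * x) = a * l x)"

lemma coef_linear_add: "coef_linear l \<Longrightarrow> l (x + y) = l x + l y"
  and coef_linear_scale: "coef_linear l \<Longrightarrow> l (single 0 a * x) = a * l x"
  by (auto simp: coef_linear_def)

lemma coef_linear_0: "coef_linear l \<Longrightarrow> l 0 = 0"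
  using coef_linear_add[of l 0 0] by simp

lemma coef_linear_uminus: "coef_linear l \<Longrightarrow> l (- x) = - l x"
  using coef_linear_add[of l x "- x"] by (simp add: coef_linear_0 eq_neg_iff_add_eq_0 add.commute)

lemma coef_linear_diff: "coef_linear l \<Longrightarrow> l (x - y) = l x - l y"
  using coef_linear_add[of l x "- y"] by (simp add: coef_linear_uminus)

lemma coef_linear_sum: "coef_linear l \<Longrightarrow> l (\<Sum>i\<in>A. g i) = (\<Sum>i\<in>A. l (g i))"
  by (induction A rule: infinite_finite_induct) (auto simp: coef_linear_0 coef_linear_add)

lemmas coef_linear_simps = coef_linear_add coef_linear_scale coef_linear_0 coef_linear_uminus
  coef_linear_diff coef_linear_sum

lemma coef_linear_single:
  assumes "coef_linear l"
  shows "l (single m a) = a * l (single m 1)"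
  using coef_linear_scale[OF assms, of a "single m 1"] by (simp add: mult_single)

lemma coef_linear_lin_ext: "coef_linear (lin_ext (\<lambda>x. x) d)"
proof -
  have "lin_ext (\<lambda>x. x) d (single 0 a * x) = a * lin_ext (\<lambda>x. x) d x" for a x
    by (induction x rule: poly_mapping_single_induct)
      (simp_all add: lin_ext_add[OF hom_id] lin_ext_single[OF hom_id] distrib_left mult_single mult.assoc)
  then show ?thesis by (simp add: coef_linear_def lin_ext_add[OF hom_id])
qed

lemma coef_linear_mult: "coef_linear l \<Longrightarrow> coef_linear (\<lambda>x. l (y * x))"
  by (simp add: coef_linear_def distrib_left mult.left_commute[of y])

lemma coef_linear_eqI:
  assumes l: "coef_linear l" "coef_linear l'"
    and "\<And>m. m \<in> keys x \<Longrightarrow> l (single m 1) = l' (single m 1)"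
  shows "l x = l' x"
proof (induction x rule: poly_mapping_single_induct)
  case (single m a)
  then show ?case
    using assms(3)[OF single] coef_linear_single[OF l(1), of m a] coef_linear_single[OF l(2), of m a] by simp
qed (use l in \<open>simp_all add: coef_linear_simps\<close>)

definition subring_set :: "'a::comm_ring_1 set \<Rightarrow> bool" where
  "subring_set V \<longleftrightarrow> 0 \<in> V \<and> 1 \<in> V \<and> (\<forall>x\<in>V. - x \<in> V) \<and> (\<forall>x\<in>V. \<forall>y\<in>V. x + y \<in> V \<and> x * y \<in> V)"

lemma subring_setD:
  assumes "subring_set V"
  shows "0 \<in> V" "1 \<in> V" "x \<in> V \<Longrightarrow> - x \<in> V" "x \<in> V \<Longrightarrow> y \<in> V \<Longrightarrow> x + y \<in> V"
    "x \<in> V \<Longrightarrow> y \<in> V \<Longrightarrow> x * y \<in> V"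
  using assms by (auto simp: subring_set_def)

lemma subring_set_power: "subring_set V \<Longrightarrow> x \<in> V \<Longrightarrow> x ^ k \<in> V"
  by (induction k) (auto simp: subring_setD)

lemma subring_set_sum: "subring_set V \<Longrightarrow> (\<And>i. i \<in> A \<Longrightarrow> f i \<in> V) \<Longrightarrow> (\<Sum>i\<in>A. f i) \<in> V"
  by (induction A rule: infinite_finite_induct) (auto simp: subring_setD)

lemma subring_set_of_nat: "subring_set V \<Longrightarrow> of_nat k \<in> V"
  by (induction k) (auto simp: subring_setD)

lemma subring_set_UNIV: "subring_set UNIV"
  by (simp add: subring_set_def)

text \<open>The elements of \<open>V\<close> with a power \<open>y\<^sup>k\<close> such that \<open>l\<close> vanishes on \<open>y\<^sup>k V\<close>, that is, the radical of the largest
ideal of \<open>V\<close> on which \<open>l\<close> vanishes. For the functional of an operator, membership of the \<open>w\<^sub>i - x\<^sub>i\<close> expresses that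
iterated commutators with \<open>x\<^sub>i\<close> vanish. The subring \<open>V\<close> is either everything or the ring of invariants.\<close>

definition nilrad :: "'a::comm_ring_1 set \<Rightarrow> ('a \<Rightarrow> 'b::comm_ring_1) \<Rightarrow> 'a set" where
  "nilrad V l = {y \<in> V. \<exists>k. \<forall>x\<in>V. l (y ^ k * x) = 0}"

lemma nilrad_larger_power:
  assumes "subring_set V" "y \<in> V" "\<forall>x\<in>V. l (y ^ k * x) = 0" "k \<le> k'" "x \<in> V"
  shows "l (y ^ k' * x) = 0"
proof -
  have "y ^ k' * x = y ^ k * (y ^ (k' - k) * x)"
    using assms(4) by (simp add: mult.assoc[symmetric] power_add[symmetric])
  moreover have "y ^ (k' - k) * x \<in> V" using assms by (simp add: subring_set_power subring_setD)
  ultimately show ?thesis using assms(3) by simp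
qed

lemma nilrad_common_power:
  assumes V: "subring_set V" and "finite I" "\<And>i. i \<in> I \<Longrightarrow> y i \<in> nilrad V l"
  shows "\<exists>K. \<forall>k\<ge>K. \<forall>i\<in>I. \<forall>x\<in>V. l (y i ^ k * x) = 0"
proof -
  have "\<forall>i\<in>I. \<exists>k. \<forall>x\<in>V. l (y i ^ k * x) = 0" using assms(3) by (auto simp: nilrad_def)
  then obtain k where k: "\<forall>i\<in>I. \<forall>x\<in>V. l (y i ^ k i * x) = 0" by metis
  have "\<forall>k'\<ge>(\<Sum>i\<in>I. k i). \<forall>i\<in>I. \<forall>x\<in>V. l (y i ^ k' * x) = 0"
  proof (intro allI impI ballI)
    fix k' i x assume *: "(\<Sum>i\<in>I. k i) \<le> k'" "i \<in> I" "x \<in> V"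
    have "k i \<le> (\<Sum>i\<in>I. k i)" using * assms(2) by (simp add: member_le_sum)
    then show "l (y i ^ k' * x) = 0"
      using nilrad_larger_power[OF V, of "y i" l "k i" k' x] k * assms(3) by (auto simp: nilrad_def)
  qed
  then show ?thesis by blast
qed

context
  fixes V :: "'a::comm_ring_1 set" and l :: "'a \<Rightarrow> 'b::comm_ring_1"
  assumes V: "subring_set V" and l: "\<And>x y. l (x + y) = l x + l y"
begin

lemma nilrad_0: "0 \<in> nilrad V l"
proof -
  have "l 0 = 0" using l[of 0 0] by simp
  then show ?thesis using V by (auto simp: nilrad_def subring_setD intro!: exI[of _ 1])
qed

text \<open>By the binomial theorem, as for the radical of an ideal.\<close>

lemma nilrad_add:
  assumes "x \<in> nilrad V l" "y \<in> nilrad V l"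
  shows "x + y \<in> nilrad V l"
proof -
  have l_sum: "l (\<Sum>i\<in>A. g i) = (\<Sum>i\<in>A. l (g i))" for g :: "nat \<Rightarrow> 'a" and A
    by (induction A rule: infinite_finite_induct) (use l[of 0 0] in \<open>auto simp: l\<close>)
  obtain j k where j: "\<forall>z\<in>V. l (x ^ j * z) = 0" and k: "\<forall>z\<in>V. l (y ^ k * z) = 0"
    using assms by (auto simp: nilrad_def)
  have xy: "x \<in> V" "y \<in> V" using assms by (auto simp: nilrad_def)
  have "l ((x + y) ^ (j + k) * z) = 0" if z: "z \<in> V" for z
  proof -
    have "l (of_nat ((j + k) choose i) * x ^ i * y ^ (j + k - i) * z) = 0" if "i \<le> j + k" for i
    proof (cases "i \<ge> j")
      case True
      have eq: "of_nat ((j + k) choose i) * x ^ i * y ^ (j + k - i) * z =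
        x ^ i * (of_nat ((j + k) choose i) * y ^ (j + k - i) * z)" by (simp add: mult_ac)
      have "of_nat ((j + k) choose i) * y ^ (j + k - i) * z \<in> V"
        by (intro subring_setD(5)[OF V] subring_set_power[OF V] subring_set_of_nat[OF V] xy z)
      then show ?thesis unfolding eq by (rule nilrad_larger_power[OF V xy(1) j True])
    next
      case False
      then have ge: "k \<le> j + k - i" by simp
      have eq: "of_nat ((j + k) choose i) * x ^ i * y ^ (j + k - i) * z =
        y ^ (j + k - i) * (of_nat ((j + k) choose i) * x ^ i * z)" by (simp add: mult_ac)
      have "of_nat ((j + k) choose i) * x ^ i * z \<in> V"
        by (intro subring_setD(5)[OF V] subring_set_power[OF V] subring_set_of_nat[OF V] xy z)
      then show ?thesis unfolding eq by (rule nilrad_larger_power[OF V xy(2) k ge])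
    qed
    then show ?thesis by (simp add: binomial_ring sum_distrib_right l_sum)
  qed
  then show ?thesis using xy V by (auto simp: nilrad_def subring_setD intro!: exI[of _ "j + k"])
qed

lemma nilrad_mult:
  assumes "x \<in> nilrad V l" "r \<in> V"
  shows "r * x \<in> nilrad V l"
proof -
  obtain k where k: "\<forall>z\<in>V. l (x ^ k * z) = 0" using assms by (auto simp: nilrad_def)
  have "l ((r * x) ^ k * z) = 0" if z: "z \<in> V" for z
  proof -
    have "(r * x) ^ k * z = x ^ k * (r ^ k * z)" by (simp add: power_mult_distrib mult_ac)
    then show ?thesis using k z assms V by (simp add: subring_set_power subring_setD)
  qed
  then show ?thesis using assms V by (auto simp: nilrad_def subring_setD)
qed

lemma nilrad_uminus: "x \<in> nilrad V l \<Longrightarrow> - x \<in> nilrad V l"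
  using nilrad_mult[of x "- 1"] V by (simp add: subring_setD)

lemma nilrad_diff: "x \<in> nilrad V l \<Longrightarrow> y \<in> nilrad V l \<Longrightarrow> x - y \<in> nilrad V l"
  using nilrad_add[of x "- y"] nilrad_uminus[of y] by simp

lemma nilrad_sum: "(\<And>i. i \<in> A \<Longrightarrow> f i \<in> nilrad V l) \<Longrightarrow> (\<Sum>i\<in>A. f i) \<in> nilrad V l"
  by (induction A rule: infinite_finite_induct) (auto simp: nilrad_0 nilrad_add)

lemma nilrad_power: "y \<in> V \<Longrightarrow> y ^ k \<in> nilrad V l \<Longrightarrow> y \<in> nilrad V l"
  by (auto simp: nilrad_def simp flip: power_mult)

end

abbreviation inside :: "nat \<Rightarrow> (nat \<Rightarrow>\<^sub>0 nat) \<Rightarrow> bool" where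
  "inside n m \<equiv> keys m \<subseteq> {1..n}"

abbreviation C :: "'a::comm_ring_1 \<Rightarrow> 'a pol" where
  "C \<equiv> single 0"

text \<open>The diagonal \<open>w\<^sub>i \<mapsto> x\<^sub>i\<close>. Exponents outside \<open>{1..n}\<close> do not belong to the polynomial ring under consideration; the
functionals below vanish on the corresponding monomials, and the diagonal sends these variables to zero
accordingly. This allows one to work with all of the type instead of a subring.\<close>

definition diag :: "nat \<Rightarrow> 'k::field mpoly pol \<Rightarrow> 'k mpoly" where
  "diag n = eval_hom (\<lambda>x. x) (\<lambda>i. if i \<in> {1..n} then Var i else 0)"

text \<open>The embedding \<open>p \<mapsto> p(w)\<close>, i.e. \<open>p \<mapsto> 1 \<otimes> p\<close>.\<close>

definition lift :: "'k::field mpoly \<Rightarrow> 'k mpoly pol" where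
  "lift = eval_hom (\<lambda>a. C (C a)) Var"

lemma hom_CC: "ring_hom_fun (\<lambda>a. C (C a))"
  by (rule hom_comp[OF hom_single hom_single])

lemma hom_diag: "ring_hom_fun (diag n)"
  unfolding diag_def by (rule hom_eval_hom[OF hom_id])

lemma hom_lift: "ring_hom_fun lift"
  unfolding lift_def by (rule hom_eval_hom[OF hom_CC])

lemma diag_C [simp]: "diag n (C a) = a"
  by (simp add: diag_def eval_hom_single[OF hom_id])

lemma diag_Var [simp]: "diag n (Var i) = (if i \<in> {1..n} then Var i else 0)"
  by (simp add: diag_def eval_hom_Var[OF hom_id])

lemma lift_single: "lift (single m a) = single m (C a)"
  by (simp add: lift_def eval_hom_single[OF hom_CC] monomial_Var mult_single)

lemma lift_Var [simp]: "lift (Var i) = Var i"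
  by (simp add: Var_def lift_single)

lemma diag_lift: "p \<in> poly_ring n \<Longrightarrow> diag n (lift p) = p"
  by (rule hom_determined[OF hom_comp[OF hom_diag hom_lift] hom_id])
    (simp add: lift_single, auto simp: poly_ring_def dest!: bspec subsetD)

lemma coef_linear_lift:
  assumes "coef_linear l"
  shows "l (lift p) = lin_ext C (\<lambda>m. l (single m 1)) p"
proof (induction p rule: poly_mapping_single_induct)
  case (single m a)
  show ?case
    using coef_linear_single[OF assms, of m "C a"] by (simp add: lift_single lin_ext_single[OF hom_single])
qed (simp_all add: hom_simps[OF hom_lift] coef_linear_simps[OF assms] lin_ext_add[OF hom_single])

text \<open>The diagonal ideal is generated by the \<open>w\<^sub>i - x\<^sub>i\<close>, so it consists of nilpotent elements as soon as these
generators are nilpotent.\<close>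

lemma nilrad_diag:
  assumes l: "coef_linear l"
    and ins: "\<And>i. i \<in> {1..n} \<Longrightarrow> Var i - C (Var i) \<in> nilrad UNIV l"
    and out: "\<And>i. i \<notin> {1..n} \<Longrightarrow> Var i \<in> nilrad UNIV l"
  shows "y - C (diag n y) \<in> nilrad UNIV l"
proof (induction y rule: poly_mapping_single_induct)
  case zero
  then show ?case by (simp add: hom_simps[OF hom_diag] nilrad_0 subring_set_UNIV coef_linear_add[OF l])
next
  case (add p q)
  have "p + q - C (diag n (p + q)) = (p - C (diag n p)) + (q - C (diag n q))"
    by (simp add: hom_simps[OF hom_diag] single_add)
  then show ?case using add by (metis nilrad_add subring_set_UNIV coef_linear_add[OF l])
next
  case (single m a)
  let ?b = "\<lambda>i. C (if i \<in> {1..n} then Var i else 0)"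
  have "monomial Var m - monomial ?b m \<in> nilrad UNIV l"
    by (rule monomial_diff_in_ideal)
      (use ins out in \<open>auto intro: nilrad_add nilrad_mult nilrad_0 simp: subring_set_UNIV coef_linear_add[OF l]\<close>)
  then have "C a * (monomial Var m - monomial ?b m) \<in> nilrad UNIV l"
    by (intro nilrad_mult) (auto simp: subring_set_UNIV coef_linear_add[OF l])
  moreover have "C (diag n (single m a)) = C a * monomial ?b m"
    by (simp add: diag_def eval_hom_single[OF hom_id] hom_mult[OF hom_single] hom_monomial[OF hom_single])
  ultimately show ?case
    unfolding single_conv_monomial[of m a] by (simp add: right_diff_distrib flip: single_conv_monomial)
qed


text \<open>The value of \<open>\<partial>\<^sup>\<beta>\<close> at the monomial with exponent \<open>m\<close>.\<close>

definition dmon :: "nat \<Rightarrow> (nat \<Rightarrow> nat) \<Rightarrow> (nat \<Rightarrow>\<^sub>0 nat) \<Rightarrow> 'k::field mpoly" where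
  "dmon n \<beta> m = (\<Prod>i=1..n. of_nat (lookup m i choose \<beta> i) * Var i ^ (lookup m i - \<beta> i))"

definition ddiff :: "nat \<Rightarrow> (nat \<Rightarrow> nat) \<Rightarrow> 'k::field mpoly \<Rightarrow> 'k mpoly" where
  "ddiff n \<beta> = lin_ext C (dmon n \<beta>)"

text \<open>Extensional functions give each exponent \<open>\<beta>\<close> exactly one representative.\<close>

definition box :: "nat \<Rightarrow> nat \<Rightarrow> (nat \<Rightarrow> nat) set" where
  "box n K = PiE {1..n} (\<lambda>_. {..<K})"

lemma finite_box [simp]: "finite (box n K)"
  by (simp add: box_def finite_PiE)

lemma box_mono: "K \<le> L \<Longrightarrow> box n K \<subseteq> box n L"
  unfolding box_def by (rule PiE_mono) auto

text \<open>Expand \<open>w\<^sup>m = \<Prod>(x\<^sub>i + (w\<^sub>i - x\<^sub>i))\<^bsup>m\<^sub>i\<^esup>\<close>: the coefficient of \<open>(w - x)\<^sup>\<beta>\<close> is \<open>\<partial>\<^sup>\<beta> x\<^sup>m\<close>, and by nilpotency only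
finitely many \<open>\<beta>\<close>, independent of \<open>m\<close>, contribute.\<close>

lemma taylor:
  fixes l :: "'k::field mpoly pol \<Rightarrow> 'k mpoly"
  assumes l: "coef_linear l"
    and K: "\<And>i x k. i \<in> {1..n} \<Longrightarrow> k \<ge> K \<Longrightarrow> l ((Var i - C (Var i)) ^ k * x) = 0"
    and m: "inside n m"
  shows "l (single m 1) =
    (\<Sum>\<beta>\<in>box n K. l (\<Prod>i=1..n. (Var i - C (Var i)) ^ \<beta> i) * dmon n \<beta> m)"
proof -
  let ?u = "\<lambda>i. Var i - C (Var i) :: 'k mpoly pol"
  \<comment> \<open>Any common bound for the binomial expansions of all variables will do; the terms outside \<open>box n K\<close> vanish.\<close>
  define L where "L = K + (\<Sum>i\<in>keys m. lookup m i) + 1"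
  have L: "lookup m i < L" for i
  proof (cases "i \<in> keys m")
    case True
    then have "lookup m i \<le> (\<Sum>i\<in>keys m. lookup m i)"
      by (simp add: member_le_sum)
    then show ?thesis by (simp add: L_def)
  qed (simp add: L_def in_keys_iff)
  define t where "t i j = of_nat (lookup m i choose j) * ?u i ^ j * C (Var i) ^ (lookup m i - j)" for i j
  have pow: "Var i ^ lookup m i = (\<Sum>j<L. t i j)" for i
  proof -
    have "Var i ^ lookup m i = (?u i + C (Var i)) ^ lookup m i" by simp
    also have "\<dots> = (\<Sum>j\<le>lookup m i. t i j)" by (simp only: binomial_ring t_def)
    also have "\<dots> = (\<Sum>j<L. t i j)"
      by (rule sum.mono_neutral_left) (use L[of i] in \<open>auto simp: t_def binomial_eq_0\<close>)
    finally show ?thesis .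
  qed
  have "single m 1 = monomial Var m" by (simp add: monomial_Var)
  also have "\<dots> = (\<Prod>i=1..n. Var i ^ lookup m i)"
    by (rule monomial_superset) (use m in auto)
  also have "\<dots> = (\<Prod>i=1..n. \<Sum>j<L. t i j)" by (simp only: pow)
  also have "\<dots> = (\<Sum>\<beta>\<in>box n L. \<Prod>i=1..n. t i (\<beta> i))"
    unfolding box_def by (rule prod_sum_PiE) auto
  also have "l \<dots> = (\<Sum>\<beta>\<in>box n L. l (\<Prod>i=1..n. ?u i ^ \<beta> i) * dmon n \<beta> m)"
  proof -
    have "(\<Prod>i=1..n. t i (\<beta> i)) = C (dmon n \<beta> m) * (\<Prod>i=1..n. ?u i ^ \<beta> i)" for \<beta>
      by (simp add: t_def dmon_def hom_simps[OF hom_single] prod.distrib mult_ac flip: single_of_nat)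
    then show ?thesis by (simp add: coef_linear_simps[OF l] mult.commute)
  qed
  also have "\<dots> = (\<Sum>\<beta>\<in>box n K. l (\<Prod>i=1..n. ?u i ^ \<beta> i) * dmon n \<beta> m)"
  proof (rule sum.mono_neutral_right)
    show "box n K \<subseteq> box n L" by (rule box_mono) (simp add: L_def)
    show "\<forall>\<beta>\<in>box n L - box n K. l (\<Prod>i=1..n. ?u i ^ \<beta> i) * dmon n \<beta> m = 0"
    proof
      fix \<beta> assume "\<beta> \<in> box n L - box n K"
      then obtain i where i: "i \<in> {1..n}" "\<beta> i \<ge> K" by (force simp: box_def PiE_iff)
      have "(\<Prod>i=1..n. ?u i ^ \<beta> i) = ?u i ^ \<beta> i * (\<Prod>j\<in>{1..n}-{i}. ?u j ^ \<beta> j)"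
        by (rule prod.remove) (use i in auto)
      then show "l (\<Prod>i=1..n. ?u i ^ \<beta> i) * dmon n \<beta> m = 0" using K[OF i] by simp
    qed
  qed simp
  finally show ?thesis .
qed

lemma taylor_lift:
  fixes l :: "'k::field mpoly pol \<Rightarrow> 'k mpoly"
  assumes l: "coef_linear l"
    and K: "\<And>i x k. i \<in> {1..n} \<Longrightarrow> k \<ge> K \<Longrightarrow> l ((Var i - C (Var i)) ^ k * x) = 0"
    and p: "p \<in> poly_ring n"
  shows "l (lift p) = (\<Sum>\<beta>\<in>box n K. l (\<Prod>i=1..n. (Var i - C (Var i)) ^ \<beta> i) * ddiff n \<beta> p)"
proof -
  have "l (lift p) = (\<Sum>m\<in>keys p. C (lookup p m) * l (single m 1))"
    by (simp add: coef_linear_lift[OF l] lin_ext_def)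
  also have "\<dots> = (\<Sum>m\<in>keys p. C (lookup p m) *
      (\<Sum>\<beta>\<in>box n K. l (\<Prod>i=1..n. (Var i - C (Var i)) ^ \<beta> i) * dmon n \<beta> m))"
    by (rule sum.cong) (use p taylor[OF l K] in \<open>auto simp: poly_ring_def\<close>)
  also have "\<dots> = (\<Sum>\<beta>\<in>box n K. l (\<Prod>i=1..n. (Var i - C (Var i)) ^ \<beta> i) * ddiff n \<beta> p)"
    unfolding sum_distrib_left ddiff_def lin_ext_def
    by (subst sum.swap) (simp add: mult_ac)
  finally show ?thesis .
qed

section \<open>Uniqueness of extensions\<close>

context perm_set
begin

text \<open>A choice of a moved variable for every nontrivial group element.\<close>

definition separates :: "((nat \<Rightarrow> nat) \<Rightarrow> nat) \<Rightarrow> bool" where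
  "separates k \<longleftrightarrow> (\<forall>\<sigma>\<in>H - {id}. k \<sigma> \<in> {1..n} \<and> \<sigma> (k \<sigma>) \<noteq> k \<sigma>)"

text \<open>Vanishes on the graphs \<open>w = \<sigma> x\<close> of all \<open>\<sigma> \<noteq> id\<close>, but not on the diagonal, where its value is \<open>disc k\<close>.\<close>

definition sep :: "((nat \<Rightarrow> nat) \<Rightarrow> nat) \<Rightarrow> 'k::field mpoly pol" where
  "sep k = (\<Prod>\<sigma>\<in>H - {id}. C (Var (k \<sigma>)) - Var (\<sigma> (k \<sigma>)))"

definition disc :: "((nat \<Rightarrow> nat) \<Rightarrow> nat) \<Rightarrow> 'k::field mpoly" where
  "disc k = (\<Prod>\<sigma>\<in>H - {id}. Var (k \<sigma>) - Var (\<sigma> (k \<sigma>)))"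

lemma exists_separates: "\<exists>k. separates k"
proof -
  have "\<exists>i. i \<in> {1..n} \<and> \<sigma> i \<noteq> i" if s: "\<sigma> \<in> H - {id}" for \<sigma>
  proof -
    obtain i where i: "\<sigma> i \<noteq> i" using s by (auto simp: fun_eq_iff)
    then have "i \<in> {1..n}" using perms[of \<sigma>] s by (metis DiffD1 permutes_not_in)
    with i show ?thesis by blast
  qed
  then show ?thesis unfolding separates_def by metis
qed

lemma image_in: "\<sigma> \<in> H \<Longrightarrow> i \<in> {1..n} \<Longrightarrow> \<sigma> i \<in> {1..n}"
  using perms permutes_in_image by metis

lemma Var_inj: "Var i = (Var j :: 'a::comm_ring_1 pol) \<longleftrightarrow> i = j"
proof
  assume "Var i = (Var j :: 'a pol)"
  then have "single i (1::nat) = single j 1"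
    unfolding Var_def by (metis lookup_single_eq lookup_single_not_eq zero_neq_one)
  then show "i = j" by (metis lookup_single_eq lookup_single_not_eq zero_neq_one)
qed simp

lemma disc_nonzero:
  assumes "separates k"
  shows "(disc k :: 'k::field mpoly) \<noteq> 0"
proof -
  have "Var (k \<sigma>) - Var (\<sigma> (k \<sigma>)) \<noteq> (0 :: 'k mpoly)" if "\<sigma> \<in> H - {id}" for \<sigma>
    using bspec[OF assms[unfolded separates_def] that] Var_inj[of "k \<sigma>" "\<sigma> (k \<sigma>)"] by auto
  then show ?thesis unfolding disc_def using finite_H by (simp add: prod_zero_iff)
qed

lemma diag_sep:
  assumes "separates k"
  shows "diag n (sep k :: 'k::field mpoly pol) = disc k"
  unfolding sep_def disc_def hom_prod[OF hom_diag]
proof (rule prod.cong[OF refl])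
  fix \<sigma> assume s: "\<sigma> \<in> H - {id}"
  then have "k \<sigma> \<in> {1..n}" using assms by (simp add: separates_def)
  moreover have "\<sigma> (k \<sigma>) \<in> {1..n}" using image_in[OF _ calculation] s by simp
  ultimately show "diag n (C (Var (k \<sigma>)) - Var (\<sigma> (k \<sigma>))) = (Var (k \<sigma>) - Var (\<sigma> (k \<sigma>)) :: 'k mpoly)"
    by (simp add: hom_diff[OF hom_diag])
qed

text \<open>The factor for \<open>\<sigma> = \<tau>\<inverse>\<close> becomes \<open>x\<^bsub>k \<sigma>\<^esub> - w\<^bsub>\<tau> (\<sigma> (k \<sigma>))\<^esub> = x\<^bsub>k \<sigma>\<^esub> - w\<^bsub>k \<sigma>\<^esub>\<close>, which vanishes on the diagonal.\<close>

lemma diag_var_act_sep: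
  assumes k: "separates k" and t: "\<tau> \<in> H" "\<tau> \<noteq> id"
  shows "diag n (var_act \<tau> (sep k :: 'k::field mpoly pol)) = 0"
proof -
  define \<sigma> where "\<sigma> = inv' \<tau>"
  have "bij \<tau>" using t by (rule_tac bij_H)
  then have inv: "\<tau> (\<sigma> i) = i" for i by (simp add: \<sigma>_def bij_is_surj surj_f_inv_f)
  have "\<sigma> \<noteq> id"
  proof
    assume "\<sigma> = id"
    then have "\<tau> i = i" for i using inv[of i] by simp
    then show False using t(2) by (auto simp: fun_eq_iff)
  qed
  then have s: "\<sigma> \<in> H - {id}" using inv_in[OF t(1)] by (simp add: \<sigma>_def)
  have "diag n (var_act \<tau> (C (Var (k \<sigma>)) - Var (\<sigma> (k \<sigma>)) :: 'k mpoly pol)) = 0"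
    using s k by (auto simp: separates_def inv hom_simps[OF hom_diag] hom_simps[OF hom_var_act])
  then show ?thesis
    unfolding sep_def hom_simps[OF hom_var_act] hom_simps[OF hom_diag]
    using s finite_H by (intro prod_zero bexI[of _ \<sigma>]) (simp_all add: hom_simps[OF hom_diag] hom_simps[OF hom_var_act])
qed

text \<open>Let \<open>l\<close> vanish on the invariants, and let \<open>e\<close> be the separating element. The translates of \<open>e\<close> under \<open>\<tau> \<noteq> id\<close> lie
in the diagonal ideal, so a high power of them is annihilated by \<open>l\<close>; hence \<open>l (e\<^sup>K x) = l (Tr (e\<^sup>K x)) = 0\<close> for all \<open>x\<close>.
Thus \<open>e\<close> is nilpotent for \<open>l\<close>, and so is \<open>d = e - (e - d)\<close>. As \<open>d\<close> is a nonzero scalar, \<open>l = 0\<close>.\<close>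

lemma functional_vanishes:
  fixes l :: "'k::field mpoly pol \<Rightarrow> 'k mpoly"
  assumes l: "coef_linear l"
    and ins: "\<And>i. i \<in> {1..n} \<Longrightarrow> Var i - C (Var i) \<in> nilrad UNIV l"
    and out: "\<And>i. i \<notin> {1..n} \<Longrightarrow> Var i \<in> nilrad UNIV l"
    and inv: "\<And>y. invar y \<Longrightarrow> l y = 0"
  shows "l x = 0"
proof -
  obtain k where k: "separates k" using exists_separates by blast
  let ?e = "sep k :: 'k mpoly pol"
  have diagl: "y - C (diag n y) \<in> nilrad UNIV l" for y
    using l ins out by (rule nilrad_diag)
  have nil: "var_act \<tau> ?e \<in> nilrad UNIV l" if "\<tau> \<in> H - {id}" for \<tau>
    using diagl[of "var_act \<tau> ?e"] diag_var_act_sep[OF k, where 'k = 'k] that by simp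
  obtain K :: nat where K: "\<forall>j\<ge>K. \<forall>\<tau>\<in>H - {id}. \<forall>x\<in>UNIV. l (var_act \<tau> ?e ^ j * x) = 0"
    using nilrad_common_power[OF subring_set_UNIV, where I = "H - {id}" and y = "\<lambda>\<tau>. var_act \<tau> ?e" and l = l]
      nil finite_H by auto
  have "l (?e ^ K * x) = 0" for x
  proof -
    have "0 = l (Tr (?e ^ K * x))" by (simp add: inv invar_Tr)
    also have "\<dots> = (\<Sum>\<tau>\<in>H. l (var_act \<tau> ?e ^ K * var_act \<tau> x))"
      by (simp add: Tr_def coef_linear_simps[OF l] hom_simps[OF hom_var_act])
    also have "\<dots> = l (?e ^ K * x) + (\<Sum>\<tau>\<in>H - {id}. l (var_act \<tau> ?e ^ K * var_act \<tau> x))"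
      by (subst sum.remove[OF finite_H id_in]) simp
    also have "(\<Sum>\<tau>\<in>H - {id}. l (var_act \<tau> ?e ^ K * var_act \<tau> x)) = 0"
      using K by (intro sum.neutral) auto
    finally show ?thesis by simp
  qed
  then have "?e \<in> nilrad UNIV l" by (auto simp: nilrad_def)
  then have "?e - (?e - C (diag n ?e)) \<in> nilrad UNIV l"
    using diagl[of ?e] coef_linear_add[OF l] subring_set_UNIV by (metis nilrad_diff)
  then have "C (disc k) \<in> nilrad UNIV l" by (simp add: diag_sep[OF k])
  then obtain j where "l (C (disc k) ^ j * x) = 0" by (auto simp: nilrad_def)
  then have "disc k ^ j * l x = 0" by (simp add: coef_linear_scale[OF l] flip: hom_power[OF hom_single])
  then show ?thesis using disc_nonzero[OF k, where 'k = 'k] by simp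
qed

end

text \<open>The functional of the operator \<open>\<partial>\<^sup>\<beta>\<close>.\<close>

definition dfun :: "nat \<Rightarrow> (nat \<Rightarrow> nat) \<Rightarrow> 'k::field mpoly pol \<Rightarrow> 'k mpoly" where
  "dfun n \<beta> = lin_ext (\<lambda>x. x) (\<lambda>m. if inside n m then dmon n \<beta> m else 0)"

lemma coef_linear_dfun: "coef_linear (dfun n \<beta>)"
  unfolding dfun_def by (rule coef_linear_lin_ext)

lemma dfun_single: "dfun n \<beta> (single m a) = (if inside n m then a * dmon n \<beta> m else 0)"
  by (simp add: dfun_def lin_ext_single[OF hom_id])

lemma keys_plus_nat: "keys (m + m') = keys m \<union> keys (m' :: 'i \<Rightarrow>\<^sub>0 nat)"
  by (auto simp: in_keys_iff lookup_add)

lemma pascal_step: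
  fixes z :: "'a::comm_ring_1"
  shows "of_nat (Suc a choose b) * z ^ (Suc a - b) - z * (of_nat (a choose b) * z ^ (a - b)) =
    (if b = 0 then 0 else of_nat (a choose (b - 1)) * z ^ (a - (b - 1)))"
proof (cases b)
  case (Suc c)
  have "of_nat (a choose Suc c) * z ^ (a - c) = z * (of_nat (a choose Suc c) * z ^ (a - Suc c))"
  proof (cases "Suc c \<le> a")
    case True
    then have "a - c = Suc (a - Suc c)" by simp
    then show ?thesis by (simp add: mult_ac)
  qed (simp add: binomial_eq_0)
  then show ?thesis by (simp add: Suc distrib_right)
qed simp

lemma dmon_shift:
  assumes i: "i \<in> {1..n}"
  shows "dmon n \<beta> (m + single i 1) - Var i * dmon n \<beta> m =
    (if \<beta> i = 0 then 0 else dmon n (\<beta>(i := \<beta> i - 1)) m)"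
proof -
  let ?f = "\<lambda>\<beta> m i. of_nat (lookup m i choose \<beta> i) * Var i ^ (lookup m i - \<beta> i) :: 'a mpoly"
  define Q where "Q = (\<Prod>j\<in>{1..n} - {i}. ?f \<beta> m j)"
  have r: "dmon n b m' = ?f b m' i * (\<Prod>j\<in>{1..n} - {i}. ?f b m' j)" for b m'
    unfolding dmon_def by (rule prod.remove) (use i in auto)
  have "(\<Prod>j\<in>{1..n} - {i}. ?f \<beta> (m + single i 1) j) = Q"
    "(\<Prod>j\<in>{1..n} - {i}. ?f (\<beta>(i := \<beta> i - 1)) m j) = Q"
    unfolding Q_def by (rule prod.cong; simp add: lookup_add lookup_single_not_eq)+
  then have "dmon n \<beta> (m + single i 1) = ?f \<beta> (m + single i 1) i * Q"
    "dmon n \<beta> m = ?f \<beta> m i * Q" and d: "dmon n (\<beta>(i := \<beta> i - 1)) m = ?f (\<beta>(i := \<beta> i - 1)) m i * Q"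
    unfolding r by (simp_all add: Q_def)
  then have "dmon n \<beta> (m + single i 1) - Var i * dmon n \<beta> m =
      (?f \<beta> (m + single i 1) i - Var i * ?f \<beta> m i) * Q"
    by (simp only: left_diff_distrib mult.assoc)
  also have "?f \<beta> (m + single i 1) i - Var i * ?f \<beta> m i = (if \<beta> i = 0 then 0 else ?f (\<beta>(i := \<beta> i - 1)) m i)"
    using pascal_step[of "lookup m i" "\<beta> i" "Var i :: 'a mpoly"]
    by (simp add: lookup_add)
  finally show ?thesis unfolding d by simp
qed

text \<open>The commutator of \<open>\<partial>\<^sup>\<beta>\<close> with \<open>x\<^sub>i\<close> lowers \<open>\<beta>\<^sub>i\<close> by one.\<close>

lemma dfun_shift:
  fixes x :: "'k::field mpoly pol"
  assumes i: "i \<in> {1..n}"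
  shows "dfun n \<beta> ((Var i - C (Var i)) * x) = (if \<beta> i = 0 then 0 else dfun n (\<beta>(i := \<beta> i - 1)) x)"
proof (rule coef_linear_eqI)
  show "coef_linear (\<lambda>x. dfun n \<beta> ((Var i - C (Var i)) * x))"
    by (rule coef_linear_mult[OF coef_linear_dfun])
  show "coef_linear (\<lambda>x. if \<beta> i = 0 then 0 else dfun n (\<beta>(i := \<beta> i - 1)) x)"
    using coef_linear_dfun[of n "\<beta>(i := \<beta> i - 1)"] by (auto simp: coef_linear_def)
  fix m
  have "(Var i - C (Var i)) * single m (1 :: 'k mpoly) =
    single (m + single i 1) 1 - C (Var i) * single m 1"
    by (simp add: left_diff_distrib Var_def mult_single add.commute)
  then have eq: "dfun n \<beta> ((Var i - C (Var i)) * single m (1 :: 'k mpoly)) =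
      dfun n \<beta> (single (m + single i 1) 1 - C (Var i) * single m 1)"
    by (rule arg_cong)
  have "dfun n \<beta> ((Var i - C (Var i)) * single m (1 :: 'k mpoly)) =
      (if inside n m then dmon n \<beta> (m + single i 1) - Var i * dmon n \<beta> m else 0)"
    unfolding eq using i by (simp add: coef_linear_diff[OF coef_linear_dfun] coef_linear_scale[OF coef_linear_dfun]
        dfun_single keys_plus_nat)
  then show "dfun n \<beta> ((Var i - C (Var i)) * single m (1 :: 'k mpoly)) =
      (if \<beta> i = 0 then 0 else dfun n (\<beta>(i := \<beta> i - 1)) (single m 1))"
    unfolding dmon_shift[OF i] by (simp add: dfun_single)
qed

lemma dfun_nilpotent:
  assumes i: "i \<in> {1..n}"
  shows "\<beta> i < k \<Longrightarrow> dfun n \<beta> ((Var i - C (Var i)) ^ k * x) = 0"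
proof (induction k arbitrary: \<beta>)
  case (Suc k)
  then show ?case by (auto simp: mult.assoc dfun_shift[OF i])
qed simp

lemma dfun_outside: "i \<notin> {1..n} \<Longrightarrow> dfun n \<beta> (Var i * x) = 0"
  by (rule coef_linear_eqI[OF coef_linear_mult[OF coef_linear_dfun], where l' = "\<lambda>_. 0"])
    (auto simp: coef_linear_def Var_def mult_single dfun_single keys_plus_nat)

lemma dfun_lift: "p \<in> poly_ring n \<Longrightarrow> dfun n \<beta> (lift p) = ddiff n \<beta> p"
  unfolding coef_linear_lift[OF coef_linear_dfun] ddiff_def lin_ext_def
  by (rule sum.cong) (auto simp: dfun_single poly_ring_def)

lemma dmon_self:
  assumes "inside n m"
  shows "dmon n (lookup m) m = 1"
  by (simp add: dmon_def)

lemma dmon_eq_0: "i \<in> {1..n} \<Longrightarrow> lookup m i < \<beta> i \<Longrightarrow> dmon n \<beta> m = 0"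
  unfolding dmon_def by (rule prod_zero) (auto simp: binomial_eq_0 intro!: bexI[of _ i])

lemma exponent_of_fun:
  obtains m where "inside n m" "\<And>i. i \<in> {1..n} \<Longrightarrow> lookup m i = \<beta> i"
proof -
  have fin: "finite {i. (if i \<in> {1..n} then \<beta> i else (0::nat)) \<noteq> 0}"
    by (rule finite_subset[of _ "{1..n}"]) auto
  define m where "m = Abs_poly_mapping (\<lambda>i. if i \<in> {1..n} then \<beta> i else (0::nat))"
  have "lookup m = (\<lambda>i. if i \<in> {1..n} then \<beta> i else 0)"
    unfolding m_def by (rule lookup_Abs_poly_mapping[OF fin])
  note l = this
  show ?thesis
  proof (rule that)
    show "inside n m" by (auto simp: in_keys_iff l split: if_splits)
  qed (simp add: l)
qed

lemma dmon_cong: "(\<And>i. i \<in> {1..n} \<Longrightarrow> \<beta> i = \<beta>' i) \<Longrightarrow> dmon n \<beta> m = dmon n \<beta>' m"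
  by (simp add: dmon_def)

text \<open>Triangularity: \<open>\<partial>\<^bsup>\<beta>'\<^esup> x\<^sup>\<beta>\<close> vanishes unless \<open>\<beta>' \<le> \<beta>\<close>, and it is 1 for \<open>\<beta>' = \<beta>\<close>.\<close>

lemma dmon_independent:
  fixes a :: "(nat \<Rightarrow> nat) \<Rightarrow> 'k::field mpoly"
  assumes 0: "\<And>m. inside n m \<Longrightarrow> (\<Sum>\<beta>\<in>box n K. a \<beta> * dmon n \<beta> m) = 0"
  shows "\<beta> \<in> box n K \<Longrightarrow> a \<beta> = 0"
proof (induction "\<Sum>i=1..n. \<beta> i" arbitrary: \<beta> rule: less_induct)
  case less
  obtain m where m: "inside n m" "\<And>i. i \<in> {1..n} \<Longrightarrow> lookup m i = \<beta> i"
    using exponent_of_fun by blast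
  have z: "a \<beta>' * dmon n \<beta>' m = 0" if b': "\<beta>' \<in> box n K - {\<beta>}" for \<beta>'
  proof (cases "\<exists>i\<in>{1..n}. \<beta>' i > \<beta> i")
    case True
    then obtain i where "i \<in> {1..n}" "lookup m i < \<beta>' i" using m by metis
    then show ?thesis by (simp add: dmon_eq_0)
  next
    case False
    then have le: "\<beta>' i \<le> \<beta> i" if "i \<in> {1..n}" for i using that by (meson not_less)
    have "\<exists>i\<in>{1..n}. \<beta>' i \<noteq> \<beta> i"
    proof (rule ccontr)
      assume "\<not> ?thesis"
      then have "\<beta>' = \<beta>" using b' less.prems unfolding box_def by (intro PiE_ext[of _ "{1..n}"]) auto
      then show False using b' by simp
    qed
    then obtain i where "i \<in> {1..n}" "\<beta>' i < \<beta> i" using le by force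
    then have "(\<Sum>i=1..n. \<beta>' i) < (\<Sum>i=1..n. \<beta> i)" by (intro sum_strict_mono_ex1) (auto intro: le)
    then show ?thesis using less.hyps b' by simp
  qed
  have "0 = (\<Sum>\<beta>\<in>box n K. a \<beta> * dmon n \<beta> m)" using 0[OF m(1)] by simp
  also have "\<dots> = a \<beta> * dmon n \<beta> m"
    by (subst sum.remove[OF finite_box less.prems]) (use z in \<open>simp add: sum.neutral\<close>)
  also have "dmon n \<beta> m = dmon n (lookup m) m" by (rule dmon_cong) (simp add: m)
  finally show ?case by (simp add: dmon_self[OF m(1)])
qed

context perm_set
begin

abbreviation R :: "'k::field mpoly set" where
  "R \<equiv> ring_of_invariants H (poly_ring n)"

lemma R_iff: "p \<in> R \<longleftrightarrow> p \<in> poly_ring n \<and> invar p"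
  by (auto simp: ring_of_invariants_def invar_def perm_act_eq_var_act)

lemma inside_orb: "m' \<in> orb m \<Longrightarrow> inside n m' \<longleftrightarrow> inside n m"
proof -
  have "inside n (exp_act \<tau> m) \<longleftrightarrow> inside n m" if "\<tau> \<in> H" for \<tau> m
  proof -
    have "\<tau> i \<in> {1..n} \<longleftrightarrow> i \<in> {1..n}" for i using perms[OF that] by (rule permutes_in_image)
    then show ?thesis using that by (auto simp: keys_exp_act bij_H subset_iff)
  qed
  then show "m' \<in> orb m \<Longrightarrow> inside n m' \<longleftrightarrow> inside n m" by (auto simp: orb_def)
qed

lemma orbit_poly_in_R: "inside n m \<Longrightarrow> orbit_poly m \<in> (R :: 'k::field mpoly set)"
proof -
  assume m: "inside n m"
  have "keys (orbit_poly m :: 'k mpoly) = orb m"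
    by (auto simp: in_keys_iff lookup_orbit_poly split: if_splits)
  moreover have "inside n m'" if "m' \<in> orb m" for m'
    using inside_orb[OF that] m by simp
  ultimately show ?thesis unfolding R_iff by (simp add: invar_orbit_poly poly_ring_def)
qed

lemma lift_orbit_poly: "lift (orbit_poly m) = orbit_poly m"
  by (simp add: orbit_poly_def hom_simps[OF hom_lift] lift_single)

text \<open>The functional of \<open>\<Sum>a\<^sub>\<beta> \<partial>\<^sup>\<beta>\<close> vanishes on the orbit sums \<open>r(w)\<close>, hence on all invariants of \<open>P[w]\<close>, and
the \<open>w\<^sub>i - x\<^sub>i\<close> are nilpotent for it.\<close>

lemma ddiff_unique:
  fixes a :: "(nat \<Rightarrow> nat) \<Rightarrow> 'k::field mpoly"
  assumes 0: "\<And>r. r \<in> R \<Longrightarrow> (\<Sum>\<beta>\<in>box n K. a \<beta> * ddiff n \<beta> r) = 0"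
  shows "\<beta> \<in> box n K \<Longrightarrow> a \<beta> = 0"
proof -
  assume \<beta>: "\<beta> \<in> box n K"
  define l where "l x = (\<Sum>\<beta>\<in>box n K. a \<beta> * dfun n \<beta> x)" for x
  have l: "coef_linear l"
    by (simp add: coef_linear_def l_def coef_linear_add[OF coef_linear_dfun] coef_linear_scale[OF coef_linear_dfun]
        distrib_left sum.distrib sum_distrib_left mult.left_commute)
  have l_out: "l (Var i * x) = 0" if "i \<notin> {1..n}" for i x
    using that by (simp add: l_def dfun_outside)
  have vanish: "l x = 0" for x
  proof (rule functional_vanishes[OF l])
    fix i assume i: "i \<in> {1..n}"
    have "l ((Var i - C (Var i)) ^ K * x) = 0" for x
      unfolding l_def using i by (intro sum.neutral) (auto simp: box_def dfun_nilpotent PiE_iff)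
    then show "Var i - C (Var i) \<in> nilrad UNIV l" by (auto simp: nilrad_def)
  next
    fix i assume "i \<notin> {1..n}"
    then show "Var i \<in> nilrad UNIV l" using l_out by (auto simp: nilrad_def intro!: exI[of _ 1])
  next
    fix y :: "'k mpoly pol" assume "invar y"
    then show "l y = 0"
    proof (induction y rule: invar_induct)
      case (orbit m c)
      show ?case
      proof (cases "inside n m")
        case True
        have "l (orbit_poly m) = (\<Sum>\<beta>\<in>box n K. a \<beta> * ddiff n \<beta> (orbit_poly m))"
          using orbit_poly_in_R[OF True, where 'k = 'k]
          by (simp add: l_def dfun_lift R_iff flip: lift_orbit_poly)
        then show ?thesis using 0[OF orbit_poly_in_R[OF True]] by (simp add: coef_linear_scale[OF l])
      next
        case False
        then have "l (orbit_poly m) = 0"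
          using inside_orb by (simp add: orbit_poly_def coef_linear_sum[OF l])
            (simp add: l_def dfun_single)
        then show ?thesis by (simp add: coef_linear_scale[OF l])
      qed
    qed (simp_all add: coef_linear_simps[OF l])
  qed
  have "(\<Sum>\<beta>\<in>box n K. a \<beta> * dmon n \<beta> m) = 0" if "inside n m" for m
    using vanish[of "single m 1"] that by (simp add: l_def dfun_single)
  then show "a \<beta> = 0" using dmon_independent \<beta> by blast
qed

end

section \<open>Extension up to a denominator\<close>

lemma subring_power_diff:
  assumes V: "subring_set V" and "x \<in> V" "y \<in> V"
  shows "\<exists>s\<in>V. x ^ j - y ^ j = (x - y) * s"
proof (induction j)
  case 0
  then show ?case using subring_setD(1)[OF V] by (intro bexI[of _ 0]) auto
next
  case (Suc j)
  then obtain s where s: "s \<in> V" "x ^ j - y ^ j = (x - y) * s" by blast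
  have "x ^ Suc j - y ^ Suc j = x * (x ^ j - y ^ j) + (x - y) * y ^ j" by (simp add: algebra_simps)
  also have "\<dots> = (x - y) * (x * s + y ^ j)" unfolding s(2) by (simp add: algebra_simps)
  finally show ?case using s(1) assms by (intro bexI[of _ "x * s + y ^ j"]) (auto simp: subring_setD subring_set_power)
qed

lemma Const_eq_C: "Const = C"
  by (simp add: Const_def fun_eq_iff)

lemma keys_uminus [simp]: "keys (- p :: 'i \<Rightarrow>\<^sub>0 'a::ab_group_add) = keys p"
  by (auto simp: in_keys_iff)

lemma poly_ring_closed:
  "(0 :: 'k::field mpoly) \<in> poly_ring n" "(1 :: 'k mpoly) \<in> poly_ring n" "C c \<in> poly_ring n"
  "p \<in> poly_ring n \<Longrightarrow> q \<in> poly_ring n \<Longrightarrow> p + q \<in> (poly_ring n :: 'k mpoly set)"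
  "p \<in> poly_ring n \<Longrightarrow> - p \<in> (poly_ring n :: 'k mpoly set)"
  "p \<in> poly_ring n \<Longrightarrow> q \<in> poly_ring n \<Longrightarrow> p * q \<in> (poly_ring n :: 'k mpoly set)"
proof -
  show "p + q \<in> (poly_ring n :: 'k mpoly set)" if "p \<in> poly_ring n" "q \<in> poly_ring n"
    using that Poly_Mapping.keys_add[of p q] by (auto simp: poly_ring_def dest!: subsetD)
  show "p * q \<in> (poly_ring n :: 'k mpoly set)" if "p \<in> poly_ring n" "q \<in> poly_ring n"
    unfolding poly_ring_def
  proof (intro CollectI ballI)
    fix m assume "m \<in> keys (p * q)"
    then obtain a b where "m = a + b" "a \<in> keys p" "b \<in> keys q"
      using keys_mult[of p q] by blast
    then show "inside n m" using that by (simp add: poly_ring_def keys_plus_nat)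
  qed
qed (auto simp: poly_ring_def)

lemma subring_poly_ring: "subring_set (poly_ring n :: 'k::field mpoly set)"
  by (simp add: subring_set_def poly_ring_closed)

lemma Var_in_poly_ring: "i \<in> {1..n} \<Longrightarrow> Var i \<in> (poly_ring n :: 'k::field mpoly set)"
  by (auto simp: poly_ring_def Var_def)

context perm_set
begin

lemma subring_invar: "subring_set {y. invar y}"
  by (simp add: subring_set_def invar_closed)

lemma subring_R: "subring_set (R :: 'k::field mpoly set)"
  using poly_ring_closed invar_closed by (auto simp: subring_set_def R_iff)

lemma C_in_R: "C c \<in> (R :: 'k::field mpoly set)"
  by (simp add: R_iff poly_ring_closed invar_closed)

text \<open>A representative of each orbit of exponents, used to extend linear maps from \<open>R\<close> to \<open>P\<close>.\<close>

definition rep :: "(nat \<Rightarrow>\<^sub>0 nat) \<Rightarrow> nat \<Rightarrow>\<^sub>0 nat" where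
  "rep m = (SOME m'. m' \<in> orb m)"

lemma rep_in_orb: "rep m \<in> orb m"
  unfolding rep_def using in_orb_self by (rule someI)

lemma rep_eq: "m' \<in> orb m \<Longrightarrow> rep m' = rep m"
  by (simp add: rep_def orb_eq)

lemma orbit_poly_eq: "m' \<in> orb m \<Longrightarrow> orbit_poly m' = orbit_poly m"
  by (simp add: orbit_poly_def orb_eq)

text \<open>A functional that agrees with \<open>\<delta>\<close> on \<open>r(w)\<close> for \<open>r \<in> R\<close>. It is the functional of the linear extension of \<open>\<delta>\<close> to \<open>P\<close> that
sends one monomial of each orbit to the value of the orbit sum and the others to zero; only its values on the
invariants of \<open>P[w]\<close> have a meaning.\<close>

definition opfun :: "('k::field mpoly \<Rightarrow> 'k mpoly) \<Rightarrow> 'k mpoly pol \<Rightarrow> 'k mpoly" where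
  "opfun \<delta> = lin_ext (\<lambda>x. x) (\<lambda>m. if inside n m \<and> rep m = m then \<delta> (orbit_poly m) else 0)"

lemma coef_linear_opfun: "coef_linear (opfun \<delta>)"
  unfolding opfun_def by (rule coef_linear_lin_ext)

lemma opfun_single:
  "opfun \<delta> (single m a) = (if inside n m \<and> rep m = m then a * \<delta> (orbit_poly m) else 0)"
  by (simp add: opfun_def lin_ext_single[OF hom_id])

lemma opfun_outside:
  assumes "\<not> inside n m"
  shows "opfun \<delta> (single m a * x) = 0"
  by (rule coef_linear_eqI[OF coef_linear_mult[OF coef_linear_opfun], where l' = "\<lambda>_. 0"])
    (use assms in \<open>auto simp: coef_linear_def mult_single opfun_single keys_plus_nat\<close>)

lemma opfun_orbit_outside:
  assumes "\<not> inside n m"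
  shows "opfun \<delta> (orbit_poly m * x) = 0"
  unfolding orbit_poly_def sum_distrib_right coef_linear_sum[OF coef_linear_opfun]
  by (rule sum.neutral) (use assms inside_orb opfun_outside in blast)

lemma opfun_orbit:
  assumes "inside n m"
  shows "opfun \<delta> (orbit_poly m) = \<delta> (orbit_poly m)"
proof -
  have "opfun \<delta> (orbit_poly m) = (\<Sum>m'\<in>orb m. opfun \<delta> (single m' 1))"
    by (simp add: orbit_poly_def coef_linear_sum[OF coef_linear_opfun])
  also have "\<dots> = (\<Sum>m'\<in>orb m. if m' = rep m then \<delta> (orbit_poly m) else 0)"
  proof (rule sum.cong[OF refl])
    fix m' assume m': "m' \<in> orb m"
    then have "inside n m'" using inside_orb assms by simp
    then show "opfun \<delta> (single m' 1) = (if m' = rep m then \<delta> (orbit_poly m) else 0)"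
      using m' by (auto simp: opfun_single rep_eq orbit_poly_eq)
  qed
  finally show ?thesis by (simp add: rep_in_orb)
qed

lemma opfun_lift:
  assumes d: "\<delta> \<in> lin_end (R :: 'k::field mpoly set)" and r: "r \<in> R"
  shows "opfun \<delta> (lift r) = \<delta> r"
proof -
  have "invar r" using r by (simp add: R_iff)
  then have "r \<in> R \<and> opfun \<delta> (lift r) = \<delta> r"
  proof (induction r rule: invar_induct)
    case zero
    have "\<delta> (Const 0 * 0) = Const 0 * \<delta> 0"
      using d subring_setD(1)[OF subring_R[where 'k = 'k]] unfolding lin_end_def by blast
    then show ?case using subring_setD(1)[OF subring_R[where 'k = 'k]]
      by (simp add: hom_zero[OF hom_lift] coef_linear_0[OF coef_linear_opfun] Const_eq_C)
  next
    case (add p q)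
    then show ?case using d subring_setD(4)[OF subring_R[where 'k = 'k]]
      by (simp add: hom_add[OF hom_lift] coef_linear_add[OF coef_linear_opfun] lin_end_def)
  next
    case (orbit m a)
    then have m: "inside n m" using r unfolding R_iff by (simp add: poly_ring_def)
    have o: "orbit_poly m \<in> (R :: 'k mpoly set)" by (rule orbit_poly_in_R[OF m])
    have "opfun \<delta> (lift (C a * orbit_poly m)) = C a * \<delta> (orbit_poly m)"
      by (simp add: hom_mult[OF hom_lift] lift_single lift_orbit_poly coef_linear_scale[OF coef_linear_opfun]
          opfun_orbit[OF m])
    also have "\<dots> = \<delta> (C a * orbit_poly m)" using d o by (simp add: lin_end_def Const_eq_C)
    finally show ?case using subring_setD(5)[OF subring_R C_in_R o] by simp
  qed
  then show ?thesis by simp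
qed

text \<open>On invariants, multiplication by \<open>r(w) - r(x)\<close> corresponds to the commutator with \<open>r\<close>.\<close>

lemma opfun_commutator:
  assumes d: "\<delta> \<in> lin_end (R :: 'k::field mpoly set)" and r: "r \<in> R" and y: "invar y"
  shows "opfun \<delta> ((lift r - C r) * y) = opfun (restr R (\<lambda>s. \<delta> (r * s) - r * \<delta> s)) y"
    (is "_ = opfun ?c y")
  using y
proof (induction y rule: invar_induct)
  case (orbit m a)
  show ?case
  proof (cases "inside n m")
    case True
    have o: "orbit_poly m \<in> (R :: 'k mpoly set)" by (rule orbit_poly_in_R[OF True])
    have ro: "r * orbit_poly m \<in> R" using subring_setD(5)[OF subring_R r o] .
    have eq: "(lift r - C r) * (C a * orbit_poly m) = C a * (lift (r * orbit_poly m) - C r * lift (orbit_poly m))"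
      by (simp only: hom_mult[OF hom_lift] lift_orbit_poly left_diff_distrib right_diff_distrib mult.left_commute)
    have "opfun \<delta> ((lift r - C r) * (C a * orbit_poly m)) = a * (\<delta> (r * orbit_poly m) - r * \<delta> (orbit_poly m))"
      unfolding eq by (simp add: coef_linear_simps[OF coef_linear_opfun] opfun_lift[OF d ro] opfun_lift[OF d o])
    moreover have "opfun ?c (C a * orbit_poly m) = a * ?c (orbit_poly m)"
      by (simp add: coef_linear_scale[OF coef_linear_opfun] opfun_orbit[OF True])
    ultimately show ?thesis using o by (simp add: restr_def)
  next
    case False
    have eq: "(lift r - C r) * (C a * orbit_poly m) = orbit_poly m * ((lift r - C r) * C a)"
      by (simp only: mult_ac)
    have "opfun \<delta> ((lift r - C r) * (C a * orbit_poly m)) = 0"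
      unfolding eq by (rule opfun_orbit_outside[OF False])
    moreover have "opfun ?c (C a * orbit_poly m) = 0"
      unfolding mult.commute[of "C a"] by (rule opfun_orbit_outside[OF False])
    ultimately show ?thesis by simp
  qed
qed (simp_all add: coef_linear_simps[OF coef_linear_opfun] distrib_left)

lemma opfun_zero: "opfun 0 y = 0"
  by (simp add: opfun_def lin_ext_def zero_fun_def)

lemma invar_lift:
  fixes r :: "'k::field mpoly"
  shows "invar r \<Longrightarrow> invar (lift r)"
proof -
  have "var_act \<tau> (lift p) = lift (var_act \<tau> p)" for \<tau> and p :: "'k mpoly"
    by (rule hom_determined[OF hom_comp[OF hom_var_act hom_lift] hom_comp[OF hom_lift hom_var_act]])
      (simp_all add: lift_single)
  then show "invar r \<Longrightarrow> invar (lift r)" by (simp add: invar_def)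
qed

lemma opfun_nilpotent:
  assumes "\<delta> \<in> diff_ops_lt (R :: 'k::field mpoly set) q" and r: "r \<in> R" and y: "invar y"
  shows "opfun \<delta> ((lift r - C r) ^ q * y) = 0"
  using assms(1)
proof (induction q arbitrary: \<delta>)
  case (Suc q)
  have "invar ((lift r - C r) ^ q * y)" using r y by (simp add: invar_closed invar_lift R_iff)
  from opfun_commutator[OF _ r this, of \<delta>] Suc show ?case by (simp add: mult.assoc r)
qed (simp add: opfun_zero)

lemma orbit_poly_outside_diag:
  assumes "\<not> inside n m"
  shows "diag n (orbit_poly m :: 'k::field mpoly pol) = 0"
proof -
  have "monomial (\<lambda>i. if i \<in> {1..n} then Var i else 0 :: 'k mpoly) m' = 0" if m': "m' \<in> orb m" for m'
  proof -
    obtain i where "i \<in> keys m'" "i \<notin> {1..n}" using inside_orb[OF m'] assms by blast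
    then show ?thesis by (intro monomial_eq_0[of i]) auto
  qed
  then show ?thesis
    unfolding orbit_poly_def hom_sum[OF hom_diag] by (simp add: diag_def eval_hom_single[OF hom_id])
qed

text \<open>An invariant \<open>y\<close> that vanishes on the diagonal is a combination of elements \<open>r(w) - r(x)\<close> with \<open>r \<in> R\<close>, and these are
nilpotent because \<open>\<delta>\<close> is a differential operator.\<close>

lemma invar_diag_nilrad:
  assumes d: "\<delta> \<in> diff_ops_lt (R :: 'k::field mpoly set) q" and y: "invar y" "diag n y = 0"
  shows "y \<in> nilrad {y. invar y} (opfun \<delta>)"
proof -
  note l_add = coef_linear_add[OF coef_linear_opfun[of \<delta>]] and V = subring_invar
  have "y - C (diag n y) \<in> nilrad {y. invar y} (opfun \<delta>)" using y(1)
  proof (induction y rule: invar_induct)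
    case zero
    then show ?case by (simp add: hom_zero[OF hom_diag] nilrad_0[OF V l_add])
  next
    case (add p q)
    have "p + q - C (diag n (p + q)) = (p - C (diag n p)) + (q - C (diag n q))"
      by (simp add: hom_add[OF hom_diag] single_add)
    then show ?case using nilrad_add[OF V l_add add] by (simp only:)
  next
    case (orbit m a)
    have "orbit_poly m - C (diag n (orbit_poly m)) \<in> nilrad {y. invar y} (opfun \<delta>)"
    proof (cases "inside n m")
      case True
      have o: "orbit_poly m \<in> (R :: 'k mpoly set)" by (rule orbit_poly_in_R[OF True])
      have "lift (orbit_poly m) - C (orbit_poly m) \<in> nilrad {y. invar y} (opfun \<delta>)"
        using opfun_nilpotent[OF d o] by (auto simp: nilrad_def invar_closed invar_lift invar_orbit_poly)
      moreover have "diag n (orbit_poly m) = (orbit_poly m :: 'k mpoly)"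
        using diag_lift[of "orbit_poly m :: 'k mpoly" n] o by (simp add: lift_orbit_poly R_iff)
      ultimately show ?thesis by (simp add: lift_orbit_poly)
    next
      case False
      then show ?thesis using opfun_orbit_outside[OF False, of \<delta>]
        by (auto simp: orbit_poly_outside_diag nilrad_def invar_orbit_poly intro!: exI[of _ 1])
    qed
    then have "C a * (orbit_poly m - C (diag n (orbit_poly m))) \<in> nilrad {y. invar y} (opfun \<delta>)"
      using l_add by (intro nilrad_mult[OF V]) (auto simp: invar_closed)
    moreover have "C (diag n (C a * orbit_poly m)) = C a * C (diag n (orbit_poly m))"
      by (simp add: hom_mult[OF hom_diag] hom_mult[OF hom_single])
    ultimately show ?case by (simp add: right_diff_distrib)
  qed
  with y(2) show ?thesis by simp
qed

text \<open>The element \<open>x\<close> is a root of \<open>\<Prod>\<^bsub>\<tau> \<in> H\<^esub> (t - \<tau> x)\<close>, whose coefficients are, up to sign, the elementary symmetric functions of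
the translates. They are invariant and vanish on the diagonal if all translates of \<open>x\<close> do.\<close>

lemma prod_translates:
  assumes x: "\<And>\<tau>. \<tau> \<in> H \<Longrightarrow> diag n (var_act \<tau> x) = (0 :: 'k::field mpoly)"
  obtains c where "\<And>j. j \<in> {1..card H} \<Longrightarrow> invar (c j)" "\<And>j. j \<in> {1..card H} \<Longrightarrow> diag n (c j) = 0"
    "x ^ card H = (\<Sum>j=1..card H. c j * x ^ (card H - j))"
proof -
  define S where "S j = {B. B \<subseteq> H \<and> card B = j}" for j
  define e where "e j = (\<Sum>B\<in>S j. \<Prod>\<tau>\<in>B. var_act \<tau> x)" for j
  have finS: "finite (S j)" for j unfolding S_def using finite_H by simp
  have inv: "invar (e j)" for j
    unfolding invar_def
  proof
    fix \<sigma> assume s: "\<sigma> \<in> H"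
    have bij: "bij \<sigma>" using s by (rule bij_H)
    have inj: "inj_on ((\<circ>) \<sigma>) B" for B :: "(nat \<Rightarrow> nat) set"
      using bij by (intro inj_onI) (metis bij_is_inj comp_assoc id_comp inv_o_cancel)
    have "var_act \<sigma> (e j) = (\<Sum>B\<in>S j. \<Prod>\<tau>\<in>B. var_act (\<sigma> \<circ> \<tau>) x)"
      by (simp add: e_def hom_sum[OF hom_var_act] hom_prod[OF hom_var_act] var_act_comp)
    also have "\<dots> = (\<Sum>B\<in>S j. \<Prod>\<tau>\<in>(\<circ>) \<sigma> ` B. var_act \<tau> x)"
      by (simp add: prod.reindex[OF inj])
    also have "\<dots> = e j" unfolding e_def
    proof (rule sum.reindex_bij_betw)
      show "bij_betw (image ((\<circ>) \<sigma>)) (S j) (S j)"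
        using bij_betw_Pow[OF translate_H[OF s]] unfolding bij_betw_def
      proof safe
        assume *: "inj_on (image ((\<circ>) \<sigma>)) (Pow H)" "image ((\<circ>) \<sigma>) ` Pow H = Pow H"
        show "inj_on (image ((\<circ>) \<sigma>)) (S j)" by (rule inj_on_subset[OF *(1)]) (auto simp: S_def)
        fix B assume B: "B \<in> S j"
        then show "(\<circ>) \<sigma> ` B \<in> S j" using s comp_in by (auto simp: S_def card_image[OF inj])
        from B have "B \<in> Pow H" by (simp add: S_def)
        then have "B \<in> image ((\<circ>) \<sigma>) ` Pow H" using *(2) by simp
        then obtain B' where "B' \<in> Pow H" "B = (\<circ>) \<sigma> ` B'" by (rule imageE)
        then show "B \<in> image ((\<circ>) \<sigma>) ` S j" using B by (auto simp: S_def card_image[OF inj])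
      qed
    qed
    finally show "var_act \<sigma> (e j) = e j" .
  qed
  have dg: "diag n (e j) = 0" if "j \<in> {1..card H}" for j
    unfolding e_def hom_sum[OF hom_diag] hom_prod[OF hom_diag]
  proof (intro sum.neutral ballI)
    fix B assume "B \<in> S j"
    then have "B \<subseteq> H" "B \<noteq> {}" "finite B" using that finite_subset[OF _ finite_H] by (auto simp: S_def)
    then show "(\<Prod>\<tau>\<in>B. diag n (var_act \<tau> x)) = 0" using x by (intro prod_zero) auto
  qed
  have "(\<Prod>\<tau>\<in>H. x - var_act \<tau> x) = 0"
    using finite_H id_in by (intro prod_zero) (auto intro!: bexI[of _ id])
  then have "0 = (\<Sum>B\<in>Pow H. (- 1) ^ card B * (\<Prod>\<tau>\<in>B. var_act \<tau> x) * x ^ card (H - B))"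
    by (simp add: prod_diff_conv_sum[OF finite_H])
  also have "\<dots> = (\<Sum>j\<in>{0..card H}. \<Sum>B\<in>S j. (- 1) ^ card B * (\<Prod>\<tau>\<in>B. var_act \<tau> x) * x ^ card (H - B))"
  proof -
    have "(\<Sum>j\<in>{0..card H}. \<Sum>B\<in>{B\<in>Pow H. card B = j}. (- 1) ^ card B * (\<Prod>\<tau>\<in>B. var_act \<tau> x) * x ^ card (H - B))
       = (\<Sum>B\<in>Pow H. (- 1) ^ card B * (\<Prod>\<tau>\<in>B. var_act \<tau> x) * x ^ card (H - B))"
      by (rule sum.group) (auto simp: finite_H card_mono)
    then show ?thesis by (simp add: S_def)
  qed
  also have "\<dots> = (\<Sum>j\<in>{0..card H}. (- 1) ^ j * e j * x ^ (card H - j))"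
  proof (rule sum.cong[OF refl])
    fix j assume "j \<in> {0..card H}"
    have "(\<Sum>B\<in>S j. (- 1) ^ card B * (\<Prod>\<tau>\<in>B. var_act \<tau> x) * x ^ card (H - B)) =
        (\<Sum>B\<in>S j. (- 1) ^ j * (\<Prod>\<tau>\<in>B. var_act \<tau> x) * x ^ (card H - j))"
      by (rule sum.cong) (auto simp: S_def card_Diff_subset finite_subset[OF _ finite_H])
    then show "(\<Sum>B\<in>S j. (- 1) ^ card B * (\<Prod>\<tau>\<in>B. var_act \<tau> x) * x ^ card (H - B)) =
        (- 1) ^ j * e j * x ^ (card H - j)"
      by (simp add: e_def sum_distrib_left sum_distrib_right)
  qed
  also have "\<dots> = e 0 * x ^ card H + (\<Sum>j=1..card H. (- 1) ^ j * e j * x ^ (card H - j))"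
    by (subst sum.atLeast_Suc_atMost) auto
  also have "S 0 = {{}}" using finite_subset[OF _ finite_H] by (auto simp: S_def)
  then have "e 0 = 1" by (simp add: e_def)
  finally have "x ^ card H = (\<Sum>j=1..card H. - ((- 1) ^ j * e j) * x ^ (card H - j))"
    by (simp add: sum_negf eq_neg_iff_add_eq_0)
  then show ?thesis
  proof (rule that[rotated 2])
    have "invar ((- 1) ^ j)" for j by (intro invar_closed)
    then show "invar (- ((- 1) ^ j * e j))" for j using inv by (intro invar_closed)
    show "diag n (- ((- 1) ^ j * e j)) = 0" if "j \<in> {1..card H}" for j
      using dg[OF that] by (simp add: hom_simps[OF hom_diag])
  qed
qed

text \<open>Let \<open>L\<close> be the functional of \<open>\<delta>\<close>, \<open>l = L \<circ> Tr\<close>, and let \<open>e\<close> be the separating element. All translates of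
\<open>(w\<^sub>i - x\<^sub>i) e\<close> vanish on the diagonal, so \<open>(w\<^sub>i - x\<^sub>i) e\<close> is nilpotent for \<open>l\<close> by \<open>prod_translates\<close>. Therefore
\<open>x \<mapsto> l (e\<^sup>M x)\<close> is the functional of a combination of the \<open>\<partial>\<^sup>\<beta>\<close> for large \<open>M\<close>. Its value at \<open>r(w)\<close> is \<open>L (Y r(w))\<close>
with \<open>Y = Tr (e\<^sup>M)\<close>, an invariant with value \<open>d\<^sup>M\<close> on the diagonal. As \<open>Y - d\<^sup>M\<close> is nilpotent for \<open>L\<close>, some multiple
\<open>Y S\<close> of \<open>Y\<close> acts on \<open>L\<close> as a power of \<open>d\<^sup>M\<close>, up to sign; replace \<open>e\<^sup>M\<close> by \<open>e\<^sup>M S\<close>.\<close>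

theorem extension_with_denominator:
  assumes d: "\<delta> \<in> diff_ops_lt (R :: 'k::field mpoly set) q" and d': "\<delta> \<in> lin_end R" and k: "separates k"
  shows "\<exists>M K a. \<forall>r\<in>R. disc k ^ M * \<delta> r = (\<Sum>\<beta>\<in>box n K. a \<beta> * ddiff n \<beta> r)"
proof -
  let ?V = "{y :: 'k mpoly pol. invar y}"
  let ?u = "\<lambda>i. Var i - C (Var i) :: 'k mpoly pol"
  let ?s = "sep k :: 'k mpoly pol"
  define L where "L = opfun \<delta>"
  define l where "l x = L (Tr x)" for x
  have L: "coef_linear L" unfolding L_def by (rule coef_linear_opfun)
  have l: "coef_linear l"
    by (simp add: coef_linear_def l_def Tr_add Tr_mult_invar invar_closed coef_linear_simps[OF L])
  note V = subring_invar[where 'a = "'k mpoly"]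
  note ideal_L = nilrad_add[OF V coef_linear_add[OF L]] nilrad_mult[OF V coef_linear_add[OF L]]
  note U = subring_set_UNIV[where 'a = "'k mpoly pol"]
  have L_l: "y \<in> nilrad UNIV l" if nil: "y \<in> nilrad ?V L" for y
  proof -
    obtain j where j: "\<forall>x\<in>?V. L (y ^ j * x) = 0" and y: "invar y" using nil by (auto simp: nilrad_def)
    have "l (y ^ j * x) = 0" for x
      unfolding l_def Tr_mult_invar[OF invar_closed(8)[OF y]] using j invar_Tr by auto
    then show ?thesis by (auto simp: nilrad_def)
  qed
  have nil: "x \<in> nilrad UNIV l" if x: "\<And>\<tau>. \<tau> \<in> H \<Longrightarrow> diag n (var_act \<tau> x) = 0" for x
  proof -
    obtain c where c: "\<And>j. j \<in> {1..card H} \<Longrightarrow> invar (c j)" "\<And>j. j \<in> {1..card H} \<Longrightarrow> diag n (c j) = 0"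
      "x ^ card H = (\<Sum>j=1..card H. c j * x ^ (card H - j))"
      using prod_translates[OF x] by blast
    have "c j \<in> nilrad UNIV l" if "j \<in> {1..card H}" for j
      using L_l invar_diag_nilrad[OF d c(1,2)] that by (simp add: L_def)
    then have "x ^ (card H - j) * c j \<in> nilrad UNIV l" if "j \<in> {1..card H}" for j
      using that nilrad_mult[OF U coef_linear_add[OF l]] by blast
    then have "x ^ card H \<in> nilrad UNIV l" unfolding c(3) mult.commute[of "c _"]
      by (intro nilrad_sum[OF U coef_linear_add[OF l]])
    then show ?thesis using nilrad_power[where y = x and V = UNIV and k = "card H" and l = l] U coef_linear_add[OF l] by simp
  qed
  have us: "?u i * ?s \<in> nilrad UNIV l" if i: "i \<in> {1..n}" for i
  proof (rule nil)
    fix \<tau> assume "\<tau> \<in> H"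
    then show "diag n (var_act \<tau> (?u i * ?s)) = 0"
      using i diag_var_act_sep[OF k, of \<tau>, where 'k = 'k]
      by (cases "\<tau> = id") (simp_all add: hom_mult[OF hom_var_act] hom_mult[OF hom_diag] hom_diff[OF hom_diag])
  qed
  obtain M0 :: nat where M0: "\<forall>j\<ge>M0. \<forall>i\<in>{1..n}. \<forall>x\<in>UNIV. l ((?u i * ?s) ^ j * x) = 0"
    using nilrad_common_power[OF U, where I = "{1..n}" and y = "\<lambda>i. ?u i * ?s" and l = l] us by auto
  \<comment> \<open>The exponent must be positive, so that the translates of \<open>e\<^sup>M\<close> vanish on the diagonal.\<close>
  define M where "M = Suc M0"
  have M: "l ((?u i * ?s) ^ M * x) = 0" if "i \<in> {1..n}" for i x
    using M0[THEN spec, of M] that by (simp add: M_def del: power_Suc)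
  define Y where "Y = Tr (?s ^ M)"
  have Y: "invar Y" unfolding Y_def by (rule invar_Tr)
  have diagY: "diag n Y = disc k ^ M"
  proof -
    have "diag n Y = (\<Sum>\<tau>\<in>H. diag n (var_act \<tau> ?s) ^ M)"
      by (simp add: Y_def Tr_def hom_sum[OF hom_diag] hom_power[OF hom_diag] hom_power[OF hom_var_act])
    also have "\<dots> = diag n ?s ^ M + (\<Sum>\<tau>\<in>H - {id}. diag n (var_act \<tau> ?s) ^ M)"
      by (subst sum.remove[OF finite_H id_in]) simp
    also have "(\<Sum>\<tau>\<in>H - {id}. diag n (var_act \<tau> ?s) ^ M) = 0"
      using diag_var_act_sep[OF k, where 'k = 'k] by (intro sum.neutral) (simp add: M_def)
    finally show ?thesis by (simp add: diag_sep[OF k])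
  qed
  let ?c = "C (disc k ^ M) :: 'k mpoly pol"
  have "invar (Y - ?c)" "diag n (Y - ?c) = 0"
    using Y by (auto intro: invar_closed simp: hom_diff[OF hom_diag] diagY)
  from invar_diag_nilrad[OF d this] obtain j where j: "\<And>x. invar x \<Longrightarrow> L ((Y - ?c) ^ j * x) = 0"
    by (auto simp: nilrad_def L_def)
  \<comment> \<open>The difference of the \<open>j\<close>-th powers of \<open>Y - c\<close> and \<open>- c\<close> is divisible by the difference \<open>Y\<close> of the two.\<close>
  obtain S where S: "invar S" "(Y - ?c) ^ j - (- ?c) ^ j = Y * S"
    using subring_power_diff[OF V, of "Y - ?c" "- ?c" j] Y by (auto simp: invar_closed)
  define g where "g x = l (?s ^ M * S * x)" for x
  have g: "coef_linear g" unfolding g_def by (rule coef_linear_mult[OF l])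
  have g0: "g (?u i ^ j * x) = 0" if i: "i \<in> {1..n}" and j: "j \<ge> M" for i x j
  proof -
    have "?u i ^ j = ?u i ^ M * ?u i ^ (j - M)" using j by (simp flip: power_add)
    then have eq: "?s ^ M * S * (?u i ^ j * x) = (?u i * ?s) ^ M * (?u i ^ (j - M) * S * x)"
      by (simp add: power_mult_distrib mult_ac)
    show ?thesis unfolding g_def eq by (rule M[OF i])
  qed
  define a where "a \<beta> = - ((- 1) ^ j) * g (\<Prod>i=1..n. ?u i ^ \<beta> i)" for \<beta>
  show ?thesis
  proof (rule exI[of _ "M * j"], rule exI[of _ M], rule exI[of _ a], rule ballI)
    fix r :: "'k mpoly" assume r: "r \<in> R"
    then have ir: "invar (lift r)" by (simp add: invar_lift R_iff)
    have "g (lift r) = L (Tr (S * lift r * ?s ^ M))" by (simp add: g_def l_def mult_ac)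
    also have "\<dots> = L (Y * S * lift r)"
      using S(1) ir by (subst Tr_mult_invar) (simp_all add: invar_closed Y_def mult_ac)
    also have "\<dots> = L ((Y - ?c) ^ j * lift r) - L ((- ?c) ^ j * lift r)"
      by (simp add: coef_linear_diff[OF L] left_diff_distrib flip: S(2))
    also have "L ((Y - ?c) ^ j * lift r) = 0" using j ir by blast
    also have "(- ?c) ^ j = C ((- (disc k ^ M)) ^ j)"
      by (simp add: hom_power[OF hom_single] single_uminus)
    also have "L (C ((- (disc k ^ M)) ^ j) * lift r) = (- (disc k ^ M)) ^ j * \<delta> r"
      by (simp add: L_def coef_linear_scale[OF coef_linear_opfun] opfun_lift[OF d' r])
    finally have gl: "g (lift r) = - ((- (disc k ^ M)) ^ j * \<delta> r)" by simp
    have "(- (disc k ^ M)) ^ j = (- 1) ^ j * (disc k ^ (M * j) :: 'k mpoly)"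
      by (simp add: power_minus[of "disc k ^ M"] power_mult)
    then have "disc k ^ (M * j) * \<delta> r = - ((- 1) ^ j) * g (lift r)"
      unfolding gl by (simp flip: mult.assoc power_mult_distrib)
    also have "g (lift r) = (\<Sum>\<beta>\<in>box n M. g (\<Prod>i=1..n. ?u i ^ \<beta> i) * ddiff n \<beta> r)"
      using r by (intro taylor_lift g g0) (simp_all add: R_iff)
    finally show "disc k ^ (M * j) * \<delta> r = (\<Sum>\<beta>\<in>box n M. a \<beta> * ddiff n \<beta> r)"
      by (simp only: a_def sum_distrib_left mult.assoc)
  qed
qed

end

section \<open>Removal of the denominator\<close>

text \<open>The substitution \<open>x\<^sub>i \<mapsto> x\<^sub>j\<close>, whose kernel is generated by \<open>x\<^sub>i - x\<^sub>j\<close>. As the target is a domain, \<open>x\<^sub>i - x\<^sub>j\<close> is prime.\<close>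

definition identify :: "nat \<Rightarrow> nat \<Rightarrow> 'k::field mpoly \<Rightarrow> 'k mpoly" where
  "identify i j = eval_hom C (\<lambda>k. Var (if k = i then j else k))"

lemma hom_identify: "ring_hom_fun (identify i j)"
  unfolding identify_def by (rule hom_eval_hom[OF hom_single])

lemma identify_Var [simp]: "identify i j (Var k) = Var (if k = i then j else k)"
  by (simp add: identify_def eval_hom_Var[OF hom_single])

lemma dvd_diff_identify: "Var i - Var j dvd p - identify i j (p :: 'k::field mpoly)"
proof (induction p rule: poly_mapping_single_induct)
  case (single m a)
  let ?J = "{x. Var i - Var j dvd (x :: 'k mpoly)}"
  have "monomial Var m - monomial (\<lambda>k. Var (if k = i then j else k)) m \<in> ?J"
    by (rule monomial_diff_in_ideal) auto
  then have "Var i - Var j dvd C a * (monomial Var m - monomial (\<lambda>k. Var (if k = i then j else k)) m)"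
    by simp
  moreover have "identify i j (single m a) = C a * monomial (\<lambda>k. Var (if k = i then j else k)) m"
    by (simp add: identify_def eval_hom_single[OF hom_single])
  ultimately show ?case
    unfolding single_conv_monomial[of m a] by (simp add: right_diff_distrib flip: single_conv_monomial)
next
  case (add p q)
  have "p + q - identify i j (p + q) = (p - identify i j p) + (q - identify i j q)"
    by (simp add: hom_add[OF hom_identify])
  then show ?case using add by (metis dvd_add)
qed (simp add: hom_zero[OF hom_identify])

lemma Var_diff_dvd_iff: "Var i - Var j dvd p \<longleftrightarrow> identify i j (p :: 'k::field mpoly) = 0"
proof
  assume "Var i - Var j dvd p"
  then show "identify i j p = 0" by (auto simp: dvd_def hom_mult[OF hom_identify] hom_diff[OF hom_identify])
next
  assume "identify i j p = 0"
  with dvd_diff_identify[of i j p] show "Var i - Var j dvd p" by simp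
qed

text \<open>Retraction onto \<open>k[x\<^sub>1,\<dots>,x\<^sub>n]\<close>. It moves the coefficients of an extension into this ring.\<close>

definition project :: "nat \<Rightarrow> 'k::field mpoly \<Rightarrow> 'k mpoly" where
  "project n = eval_hom C (\<lambda>i. if i \<in> {1..n} then Var i else 0)"

lemma hom_project: "ring_hom_fun (project n)"
  unfolding project_def by (rule hom_eval_hom[OF hom_single])

lemma project_id: "p \<in> poly_ring n \<Longrightarrow> project n p = p"
  by (rule hom_determined[OF hom_project hom_id])
    (auto simp: project_def eval_hom_single[OF hom_single] eval_hom_Var[OF hom_single] poly_ring_def dest!: bspec subsetD)

lemma project_in: "project n p \<in> (poly_ring n :: 'k::field mpoly set)"
proof (induction p rule: poly_mapping_single_induct)
  case (single m a)
  have "(\<Prod>i\<in>A. (if i \<in> {1..n} then Var i else 0) ^ lookup m i) \<in> (poly_ring n :: 'k mpoly set)" for A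
    by (induction A rule: infinite_finite_induct)
      (auto intro!: poly_ring_closed subring_set_power[OF subring_poly_ring] Var_in_poly_ring)
  then show ?case
    by (simp add: project_def eval_hom_single[OF hom_single] monomial_def poly_ring_closed)
qed (simp_all add: hom_zero[OF hom_project] hom_add[OF hom_project] poly_ring_closed)

lemma dmon_in_poly_ring: "dmon n \<beta> m \<in> (poly_ring n :: 'k::field mpoly set)"
proof -
  have "(\<Prod>i\<in>A. of_nat (lookup m i choose \<beta> i) * Var i ^ (lookup m i - \<beta> i)) \<in> (poly_ring n :: 'k mpoly set)"
    if "A \<subseteq> {1..n}" for A using finite_subset[OF that finite_atLeastAtMost] that
    by (induction A rule: finite_induct)
      (auto intro!: poly_ring_closed subring_set_power[OF subring_poly_ring] Var_in_poly_ring
        subring_set_of_nat[OF subring_poly_ring] simp flip: single_of_nat)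
  then show ?thesis by (simp add: dmon_def)
qed

lemma ddiff_in_poly_ring: "ddiff n \<beta> p \<in> (poly_ring n :: 'k::field mpoly set)"
  unfolding ddiff_def lin_ext_def
  by (intro subring_set_sum[OF subring_poly_ring] poly_ring_closed dmon_in_poly_ring)

locale perm_set_no_transpositions = perm_set +
  assumes no_transp: "i \<in> {1..n} \<Longrightarrow> j \<in> {1..n} \<Longrightarrow> i \<noteq> j \<Longrightarrow> swap i j \<notin> H"
begin

text \<open>A permutation all of whose moved points \<open>a\<close> satisfy \<open>{a, \<sigma> a} = {i, j}\<close> is the transposition of \<open>i\<close> and \<open>j\<close>. This is
the place where the absence of transpositions matters.\<close>

lemma separates_avoiding:
  assumes "i \<in> {1..n}" "j \<in> {1..n}" "i \<noteq> j"
  obtains k where "separates k" "\<And>\<sigma>. \<sigma> \<in> H - {id} \<Longrightarrow> {k \<sigma>, \<sigma> (k \<sigma>)} \<noteq> {i, j}"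
proof -
  have "\<exists>a. a \<in> {1..n} \<and> \<sigma> a \<noteq> a \<and> {a, \<sigma> a} \<noteq> {i, j}" if s: "\<sigma> \<in> H - {id}" for \<sigma>
  proof (rule ccontr)
    assume "\<not> ?thesis"
    then have *: "{a, \<sigma> a} = {i, j}" if "a \<in> {1..n}" "\<sigma> a \<noteq> a" for a using that by blast
    have p: "\<sigma> permutes {1..n}" using s perms by blast
    have moved: "a \<in> {1..n}" if "\<sigma> a \<noteq> a" for a using p that by (metis permutes_not_in)
    have fix': "\<sigma> a = a" if "a \<noteq> i" "a \<noteq> j" for a using *[OF moved] that by blast
    obtain a where "\<sigma> a \<noteq> a" using s by (auto simp: fun_eq_iff)
    have inj: "\<sigma> x = \<sigma> y \<longleftrightarrow> x = y" for x y using permutes_inj[OF p] by (auto simp: inj_eq)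
    have "\<sigma> i \<noteq> i"
    proof
      assume i: "\<sigma> i = i"
      then have "a \<noteq> i" using \<open>\<sigma> a \<noteq> a\<close> by auto
      then have "a = j" using \<open>\<sigma> a \<noteq> a\<close> fix'[of a] by auto
      then have "{j, \<sigma> j} = {i, j}" using * moved \<open>\<sigma> a \<noteq> a\<close> by blast
      then have "\<sigma> j = i" using \<open>a = j\<close> \<open>\<sigma> a \<noteq> a\<close> by blast
      then show False using i inj[of i j] assms(3) by simp
    qed
    then have i: "\<sigma> i = j" using *[OF moved, of i] by blast
    have "\<sigma> j \<noteq> j" using i inj[of i j] assms(3) by simp
    then have j: "\<sigma> j = i" using *[OF moved, of j] by blast
    have "\<sigma> = swap i j"
      by (rule ext) (use i j fix' in \<open>auto simp: Transposition.transpose_def\<close>)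
    then show False using s no_transp[OF assms] by blast
  qed
  then have "\<forall>\<sigma>. \<exists>a. \<sigma> \<in> H - {id} \<longrightarrow> a \<in> {1..n} \<and> \<sigma> a \<noteq> a \<and> {a, \<sigma> a} \<noteq> {i, j}" by blast
  then obtain k where "\<forall>\<sigma>. \<sigma> \<in> H - {id} \<longrightarrow> k \<sigma> \<in> {1..n} \<and> \<sigma> (k \<sigma>) \<noteq> k \<sigma> \<and> {k \<sigma>, \<sigma> (k \<sigma>)} \<noteq> {i, j}"
    by metis
  then show ?thesis using that[of k] unfolding separates_def by blast
qed

lemma identify_disc:
  assumes k: "separates k" and ij: "i \<noteq> j" "\<And>\<sigma>. \<sigma> \<in> H - {id} \<Longrightarrow> {k \<sigma>, \<sigma> (k \<sigma>)} \<noteq> {i, j}"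
  shows "identify i j (disc k :: 'k::field mpoly) \<noteq> 0"
proof -
  have "identify i j (Var (k \<sigma>) - Var (\<sigma> (k \<sigma>))) \<noteq> (0 :: 'k mpoly)" if s: "\<sigma> \<in> H - {id}" for \<sigma>
  proof -
    have "k \<sigma> \<noteq> \<sigma> (k \<sigma>)" using k s unfolding separates_def by metis
    then have "(if k \<sigma> = i then j else k \<sigma>) \<noteq> (if \<sigma> (k \<sigma>) = i then j else \<sigma> (k \<sigma>))"
      using ij(2)[OF s] by auto
    then show ?thesis by (simp only: hom_diff[OF hom_identify] identify_Var right_minus_eq Var_inj not_False_eq_True)
  qed
  then show ?thesis unfolding disc_def hom_prod[OF hom_identify] using finite_H by (simp add: prod_zero_iff)
qed

text \<open>The multiple \<open>c \<delta>\<close> of the operator \<open>\<delta>\<close> is the restriction of a combination of divided derivatives.\<close>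

definition extends :: "('k::field mpoly \<Rightarrow> 'k mpoly) \<Rightarrow> 'k mpoly \<Rightarrow> bool" where
  "extends \<delta> c \<longleftrightarrow> (\<exists>K a. \<forall>r\<in>R. c * \<delta> r = (\<Sum>\<beta>\<in>box n K. a \<beta> * ddiff n \<beta> r))"

lemma extends_larger_box:
  fixes c :: "'k::field mpoly"
  assumes "\<forall>r\<in>R. c * \<delta> r = (\<Sum>\<beta>\<in>box n K. a \<beta> * ddiff n \<beta> r)" "K \<le> L"
  shows "\<exists>a. \<forall>r\<in>R. c * \<delta> r = (\<Sum>\<beta>\<in>box n L. a \<beta> * ddiff n \<beta> r)"
proof (intro exI[of _ "\<lambda>\<beta>. if \<beta> \<in> box n K then a \<beta> else 0"] ballI)
  fix r :: "'k mpoly" assume r: "r \<in> R"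
  have "(\<Sum>\<beta>\<in>box n L. (if \<beta> \<in> box n K then a \<beta> else 0) * ddiff n \<beta> r) = (\<Sum>\<beta>\<in>box n K. a \<beta> * ddiff n \<beta> r)"
    by (rule sum.mono_neutral_cong_right) (use box_mono[OF assms(2)] in auto)
  then show "c * \<delta> r = (\<Sum>\<beta>\<in>box n L. (if \<beta> \<in> box n K then a \<beta> else 0) * ddiff n \<beta> r)"
    using assms(1) r by simp
qed

text \<open>Write \<open>\<ell> = x\<^sub>i - x\<^sub>j\<close>. If \<open>c \<ell> \<delta>\<close> and \<open>c' \<delta>\<close> extend with coefficients \<open>a\<^sub>\<beta>\<close> and \<open>b\<^sub>\<beta>\<close>, then \<open>c' a\<^sub>\<beta> = c \<ell> b\<^sub>\<beta>\<close> by
uniqueness. If the prime \<open>\<ell>\<close> does not divide \<open>c'\<close>, it divides all \<open>a\<^sub>\<beta>\<close>, and \<open>\<ell>\<close> may be cancelled.\<close>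

lemma extends_cancel:
  assumes lc: "extends \<delta> (c * (Var i - Var j))" and c': "extends \<delta> c'" and ne: "identify i j c' \<noteq> 0" and ij: "i \<noteq> j"
  shows "extends \<delta> (c :: 'k::field mpoly)"
proof -
  let ?l = "Var i - Var j :: 'k mpoly"
  obtain K1 a1 where 1: "\<forall>r\<in>R. c * ?l * \<delta> r = (\<Sum>\<beta>\<in>box n K1. a1 \<beta> * ddiff n \<beta> r)"
    using lc unfolding extends_def by blast
  obtain K2 a2 where 2: "\<forall>r\<in>R. c' * \<delta> r = (\<Sum>\<beta>\<in>box n K2. a2 \<beta> * ddiff n \<beta> r)"
    using c' unfolding extends_def by blast
  define K where "K = max K1 K2"
  obtain a where a: "\<forall>r\<in>R. c * ?l * \<delta> r = (\<Sum>\<beta>\<in>box n K. a \<beta> * ddiff n \<beta> r)"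
    using extends_larger_box[OF 1, of K] by (auto simp: K_def)
  obtain b where b: "\<forall>r\<in>R. c' * \<delta> r = (\<Sum>\<beta>\<in>box n K. b \<beta> * ddiff n \<beta> r)"
    using extends_larger_box[OF 2, of K] by (auto simp: K_def)
  have "c' * a \<beta> - c * ?l * b \<beta> = 0" if "\<beta> \<in> box n K" for \<beta>
  proof (rule ddiff_unique[OF _ that])
    fix r :: "'k mpoly" assume r: "r \<in> R"
    have "(\<Sum>\<beta>\<in>box n K. (c' * a \<beta> - c * ?l * b \<beta>) * ddiff n \<beta> r) =
      c' * (\<Sum>\<beta>\<in>box n K. a \<beta> * ddiff n \<beta> r) - c * ?l * (\<Sum>\<beta>\<in>box n K. b \<beta> * ddiff n \<beta> r)"
      by (simp only: sum_distrib_left left_diff_distrib sum_subtractf mult.assoc)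
    also have "\<dots> = c' * (c * ?l * \<delta> r) - c * ?l * (c' * \<delta> r)" using a b r by simp
    also have "\<dots> = 0" by (simp only: mult_ac diff_self)
    finally show "(\<Sum>\<beta>\<in>box n K. (c' * a \<beta> - c * ?l * b \<beta>) * ddiff n \<beta> r) = 0" .
  qed
  then have eq: "c' * a \<beta> = ?l * (c * b \<beta>)" if "\<beta> \<in> box n K" for \<beta>
    using that by (simp add: mult_ac)
  have "\<exists>q. a \<beta> = ?l * q" if "\<beta> \<in> box n K" for \<beta>
  proof -
    have "?l dvd c' * a \<beta>" unfolding eq[OF that] by (rule dvd_triv_left)
    then have "identify i j c' * identify i j (a \<beta>) = 0"
      unfolding Var_diff_dvd_iff hom_mult[OF hom_identify] .
    then have "?l dvd a \<beta>" unfolding Var_diff_dvd_iff using ne by simp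
    then show ?thesis by (simp add: dvd_def)
  qed
  then obtain q where q: "\<forall>\<beta>\<in>box n K. a \<beta> = ?l * q \<beta>" by metis
  have "c * \<delta> r = (\<Sum>\<beta>\<in>box n K. q \<beta> * ddiff n \<beta> r)" if r: "r \<in> R" for r
  proof -
    have "?l * (c * \<delta> r) = (\<Sum>\<beta>\<in>box n K. a \<beta> * ddiff n \<beta> r)" using a r by (simp add: mult_ac)
    also have "\<dots> = ?l * (\<Sum>\<beta>\<in>box n K. q \<beta> * ddiff n \<beta> r)"
      unfolding sum_distrib_left by (rule sum.cong) (use q in \<open>auto simp: mult.assoc\<close>)
    finally show ?thesis using ij by (simp add: Var_inj)
  qed
  then show ?thesis unfolding extends_def by blast
qed

text \<open>Every factor of the denominator \<open>disc k\<close> has the form \<open>x\<^sub>i - x\<^sub>j\<close>; it is cancelled against the denominator of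
another choice of moved variables, which is not divisible by \<open>x\<^sub>i - x\<^sub>j\<close>.\<close>

theorem extension:
  assumes d: "\<delta> \<in> diff_ops (R :: 'k::field mpoly set)"
  obtains K a where "\<And>\<beta>. a \<beta> \<in> poly_ring n" "\<And>r. r \<in> R \<Longrightarrow> \<delta> r = (\<Sum>\<beta>\<in>box n K. a \<beta> * ddiff n \<beta> r)"
proof -
  obtain q where q: "\<delta> \<in> diff_ops_lt R q" using d by (auto simp: diff_ops_def)
  have lin: "\<delta> \<in> lin_end R"
  proof (cases q)
    case 0
    then have "\<delta> = 0" using q by simp
    then show ?thesis using subring_setD(1)[OF subring_R[where 'k = 'k]] by (auto simp: lin_end_def)
  qed (use q in auto)
  have ext: "\<exists>M. extends \<delta> (disc k ^ M)" if k: "separates k" for k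
    using extension_with_denominator[OF q lin k] by (simp add: extends_def)
  have cancel: "extends \<delta> c" if *: "extends \<delta> (c * (Var i - Var j))" and ij: "i \<in> {1..n}" "j \<in> {1..n}" "i \<noteq> j" for c i j
  proof -
    obtain k where k: "separates k" "\<And>\<sigma>. \<sigma> \<in> H - {id} \<Longrightarrow> {k \<sigma>, \<sigma> (k \<sigma>)} \<noteq> {i, j}"
      using separates_avoiding[OF ij] by blast
    obtain M where M: "extends \<delta> (disc k ^ M)" using ext[OF k(1)] by blast
    have "identify i j (disc k ^ M) \<noteq> (0 :: 'k mpoly)"
      using identify_disc[OF k(1) ij(3) k(2), where 'k = 'k] by (simp add: hom_power[OF hom_identify])
    then show ?thesis by (rule extends_cancel[OF * M _ ij(3)])
  qed
  obtain k where k: "separates k" using exists_separates by blast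
  obtain M where M: "extends \<delta> (disc k ^ M)" using ext[OF k] by blast
  have cancel_prod: "extends \<delta> c" if "extends \<delta> (c * (\<Prod>\<sigma>\<in>F. Var (k \<sigma>) - Var (\<sigma> (k \<sigma>))))" "F \<subseteq> H - {id}" for c F
    using finite_subset[OF that(2) finite_Diff[OF finite_H]] that
  proof (induction F arbitrary: c rule: finite_induct)
    case (insert \<sigma> F)
    have s': "\<sigma> \<in> H - {id}" using insert.prems by blast
    have s: "k \<sigma> \<in> {1..n}" "\<sigma> (k \<sigma>) \<noteq> k \<sigma>" "\<sigma> \<in> H"
      using bspec[OF k[unfolded separates_def] s'] s' by auto
    have "extends \<delta> (c * (Var (k \<sigma>) - Var (\<sigma> (k \<sigma>))))"
    proof (rule insert.IH)
      show "extends \<delta> (c * (Var (k \<sigma>) - Var (\<sigma> (k \<sigma>))) * (\<Prod>\<sigma>\<in>F. Var (k \<sigma>) - Var (\<sigma> (k \<sigma>))))"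
        using insert.prems(1) by (simp only: prod.insert[OF insert.hyps] mult.assoc)
      show "F \<subseteq> H - {id}" using insert.prems by blast
    qed
    then show ?case by (rule cancel) (use s image_in[OF s(3,1)] in auto)
  qed auto
  have "extends \<delta> (disc k ^ M') \<Longrightarrow> extends \<delta> 1" for M'
  proof (induction M')
    case (Suc M')
    have "extends \<delta> (disc k ^ M')"
    proof (rule cancel_prod)
      show "extends \<delta> (disc k ^ M' * (\<Prod>\<sigma>\<in>H - {id}. Var (k \<sigma>) - Var (\<sigma> (k \<sigma>))))"
        using Suc.prems unfolding power_Suc2 by (simp only: disc_def)
    qed simp
    then show ?case by (rule Suc.IH)
  qed simp
  with M have "extends \<delta> 1" by blast
  then obtain K a where a: "\<forall>r\<in>R. \<delta> r = (\<Sum>\<beta>\<in>box n K. a \<beta> * ddiff n \<beta> r)"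
    unfolding extends_def by auto
  show ?thesis
  proof (rule that[of "\<lambda>\<beta>. project n (a \<beta>)" K])
    fix r :: "'k mpoly" assume r: "r \<in> R"
    then have "\<delta> r \<in> R" using lin unfolding lin_end_def by blast
    then have "\<delta> r \<in> poly_ring n" by (simp add: R_iff)
    then have "\<delta> r = project n (\<delta> r)" by (simp add: project_id)
    also have "\<dots> = (\<Sum>\<beta>\<in>box n K. project n (a \<beta>) * project n (ddiff n \<beta> r))"
      using a r by (simp add: hom_sum[OF hom_project] hom_mult[OF hom_project])
    finally show "\<delta> r = (\<Sum>\<beta>\<in>box n K. project n (a \<beta>) * ddiff n \<beta> r)"
      by (simp add: project_id ddiff_in_poly_ring)
  qed (rule project_in)
qed

end

section \<open>Algebra of differential operators\<close>

definition subalg :: "'k::field mpoly set \<Rightarrow> bool" where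
  "subalg R \<longleftrightarrow> subring_set R \<and> (\<forall>c. C c \<in> R)"

lemma subalgD:
  assumes "subalg R"
  shows "0 \<in> R" "1 \<in> R" "C c \<in> R" "x \<in> R \<Longrightarrow> y \<in> R \<Longrightarrow> x + y \<in> R" "x \<in> R \<Longrightarrow> y \<in> R \<Longrightarrow> x * y \<in> R"
    "x \<in> R \<Longrightarrow> - x \<in> R" "x \<in> R \<Longrightarrow> y \<in> R \<Longrightarrow> x - y \<in> R"
  using assms subring_setD[of R] unfolding subalg_def
  by (auto simp: diff_conv_add_uminus simp del: add_uminus_conv_diff)

lemma subalg_poly_ring: "subalg (poly_ring n)"
  by (simp add: subalg_def subring_poly_ring poly_ring_closed)

lemma lin_endI:
  assumes "\<And>s. s \<in> R \<Longrightarrow> \<delta> s \<in> R" "\<And>s. s \<notin> R \<Longrightarrow> \<delta> s = 0"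
    "\<And>s t. s \<in> R \<Longrightarrow> t \<in> R \<Longrightarrow> \<delta> (s + t) = \<delta> s + \<delta> t"
    "\<And>c s. s \<in> R \<Longrightarrow> \<delta> (C c * s) = C c * \<delta> s"
  shows "\<delta> \<in> lin_end R"
  using assms by (auto simp: lin_end_def Const_eq_C)

lemma lin_endD:
  assumes "\<delta> \<in> lin_end R"
  shows "s \<in> R \<Longrightarrow> \<delta> s \<in> R" "s \<notin> R \<Longrightarrow> \<delta> s = 0"
    "s \<in> R \<Longrightarrow> t \<in> R \<Longrightarrow> \<delta> (s + t) = \<delta> s + \<delta> t"
    "s \<in> R \<Longrightarrow> \<delta> (C c * s) = C c * \<delta> s"
  using assms by (auto simp: lin_end_def Const_eq_C)

lemma lin_end_zero: "subalg R \<Longrightarrow> 0 \<in> lin_end R"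
  by (rule lin_endI) (auto simp: subalgD)

lemma diff_ops_lt_lin_end: "subalg R \<Longrightarrow> \<delta> \<in> diff_ops_lt R m \<Longrightarrow> \<delta> \<in> lin_end R"
  by (cases m) (auto simp: lin_end_zero)

lemma diff_ops_lt_zero: "subalg R \<Longrightarrow> 0 \<in> diff_ops_lt R m"
proof (induction m)
  case (Suc m)
  have "restr R (\<lambda>s. 0 (r * s) - r * 0 s) = 0" for r :: "'a mpoly"
    by (simp add: restr_def fun_eq_iff)
  with Suc show ?case by (simp only: diff_ops_lt.simps lin_end_zero mem_Collect_eq simp_thms) simp
qed simp

lemma diff_ops_lt_mono: "subalg R \<Longrightarrow> \<delta> \<in> diff_ops_lt R m \<Longrightarrow> m \<le> m' \<Longrightarrow> \<delta> \<in> diff_ops_lt R m'"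
proof (induction m arbitrary: \<delta> m')
  case 0
  then have "\<delta> = 0" by simp
  then show ?case using diff_ops_lt_zero[OF 0(1)] by (simp only:)
next
  case (Suc m)
  then obtain m'' where "m' = Suc m''" "m \<le> m''" by (cases m') auto
  with Suc show ?case by auto
qed

lemma diff_ops_lt_add:
  assumes R: "subalg R"
  shows "\<delta> \<in> diff_ops_lt R m \<Longrightarrow> \<epsilon> \<in> diff_ops_lt R m \<Longrightarrow> (\<lambda>s. \<delta> s + \<epsilon> s) \<in> diff_ops_lt R m"
proof (induction m arbitrary: \<delta> \<epsilon>)
  case 0
  then show ?case by (simp add: zero_fun_def)
next
  case (Suc m)
  have d: "\<delta> \<in> lin_end R" "\<epsilon> \<in> lin_end R" using Suc.prems by auto
  have "(\<lambda>s. \<delta> s + \<epsilon> s) \<in> lin_end R"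
    by (rule lin_endI) (use d[THEN lin_endD(1)] d[THEN lin_endD(2)] d[THEN lin_endD(3)] d[THEN lin_endD(4)] R in
        \<open>auto simp: subalgD distrib_left\<close>)
  moreover have "restr R (\<lambda>s. \<delta> (r * s) + \<epsilon> (r * s) - r * (\<delta> s + \<epsilon> s)) \<in> diff_ops_lt R m" if r: "r \<in> R" for r
  proof -
    have "(\<lambda>s. restr R (\<lambda>s. \<delta> (r * s) - r * \<delta> s) s + restr R (\<lambda>s. \<epsilon> (r * s) - r * \<epsilon> s) s) \<in> diff_ops_lt R m"
      using Suc.prems r by (intro Suc.IH) auto
    moreover have "(\<lambda>s. restr R (\<lambda>s. \<delta> (r * s) - r * \<delta> s) s + restr R (\<lambda>s. \<epsilon> (r * s) - r * \<epsilon> s) s)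
        = restr R (\<lambda>s. \<delta> (r * s) + \<epsilon> (r * s) - r * (\<delta> s + \<epsilon> s))"
      by (auto simp: restr_def fun_eq_iff algebra_simps)
    ultimately show ?thesis by simp
  qed
  ultimately show ?case by simp
qed

lemma diff_ops_lt_scale:
  assumes R: "subalg R" and a: "a \<in> R"
  shows "\<delta> \<in> diff_ops_lt R m \<Longrightarrow> (\<lambda>s. a * \<delta> s) \<in> diff_ops_lt R m"
proof (induction m arbitrary: \<delta>)
  case 0
  then show ?case by (simp add: zero_fun_def)
next
  case (Suc m)
  have d: "\<delta> \<in> lin_end R" using Suc.prems by auto
  have "(\<lambda>s. a * \<delta> s) \<in> lin_end R"
    by (rule lin_endI) (use lin_endD[OF d] R a in \<open>auto simp: subalgD distrib_left mult.left_commute\<close>)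
  moreover have "restr R (\<lambda>s. a * \<delta> (r * s) - r * (a * \<delta> s)) \<in> diff_ops_lt R m" if r: "r \<in> R" for r
  proof -
    have "(\<lambda>s. a * restr R (\<lambda>s. \<delta> (r * s) - r * \<delta> s) s) \<in> diff_ops_lt R m"
      using Suc.prems r by (intro Suc.IH) auto
    moreover have "(\<lambda>s. a * restr R (\<lambda>s. \<delta> (r * s) - r * \<delta> s) s) = restr R (\<lambda>s. a * \<delta> (r * s) - r * (a * \<delta> s))"
      by (auto simp: restr_def fun_eq_iff right_diff_distrib mult.left_commute)
    ultimately show ?thesis by simp
  qed
  ultimately show ?case by simp
qed

lemma diff_ops_lt_precompose:
  assumes R: "subalg R" and a: "a \<in> R"
  shows "\<delta> \<in> diff_ops_lt R m \<Longrightarrow> restr R (\<lambda>s. \<delta> (a * s)) \<in> diff_ops_lt R m"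
proof (induction m arbitrary: \<delta>)
  case 0
  then show ?case by (simp add: zero_fun_def restr_def)
next
  case (Suc m)
  have d: "\<delta> \<in> lin_end R" using Suc.prems by auto
  have sc: "\<delta> (a * (C c * s)) = C c * \<delta> (a * s)" if "s \<in> R" for c s
    using lin_endD(4)[OF d subalgD(5)[OF R a that]] by (simp add: mult.left_commute)
  have "restr R (\<lambda>s. \<delta> (a * s)) \<in> lin_end R"
    by (rule lin_endI)
      (use lin_endD[OF d] R a sc in \<open>auto simp: restr_def subalgD distrib_left\<close>)
  moreover have "restr R (\<lambda>s. restr R (\<lambda>s. \<delta> (a * s)) (r * s) - r * restr R (\<lambda>s. \<delta> (a * s)) s) \<in> diff_ops_lt R m"
    if r: "r \<in> R" for r
  proof -
    have "restr R (\<lambda>s. restr R (\<lambda>s. \<delta> (r * s) - r * \<delta> s) (a * s)) \<in> diff_ops_lt R m"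
      using Suc.prems r by (intro Suc.IH) auto
    moreover have "restr R (\<lambda>s. restr R (\<lambda>s. \<delta> (r * s) - r * \<delta> s) (a * s)) =
        restr R (\<lambda>s. restr R (\<lambda>s. \<delta> (a * s)) (r * s) - r * restr R (\<lambda>s. \<delta> (a * s)) s)"
      using a r R by (auto simp: restr_def fun_eq_iff subalgD mult.left_commute)
    ultimately show ?thesis by simp
  qed
  ultimately show ?case by simp
qed

lemma diff_ops_add:
  assumes R: "subalg R" and "\<delta> \<in> diff_ops R" "\<epsilon> \<in> diff_ops R"
  shows "(\<lambda>s. \<delta> s + \<epsilon> s) \<in> diff_ops R"
proof -
  obtain m m' where "\<delta> \<in> diff_ops_lt R m" "\<epsilon> \<in> diff_ops_lt R m'" using assms by (auto simp: diff_ops_def)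
  then have "\<delta> \<in> diff_ops_lt R (max m m')" "\<epsilon> \<in> diff_ops_lt R (max m m')"
    using diff_ops_lt_mono[OF R] by auto
  then show ?thesis using diff_ops_lt_add[OF R] by (auto simp: diff_ops_def)
qed

lemma diff_ops_scale: "subalg R \<Longrightarrow> a \<in> R \<Longrightarrow> \<delta> \<in> diff_ops R \<Longrightarrow> (\<lambda>s. a * \<delta> s) \<in> diff_ops R"
  unfolding diff_ops_def using diff_ops_lt_scale by blast

lemma diff_ops_zero: "subalg R \<Longrightarrow> 0 \<in> diff_ops R"
  using diff_ops_lt_zero by (auto simp: diff_ops_def)

lemma diff_ops_sum:
  assumes "subalg R" "\<And>i. i \<in> A \<Longrightarrow> \<delta> i \<in> diff_ops R"
  shows "(\<lambda>s. \<Sum>i\<in>A. \<delta> i s) \<in> diff_ops R"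
  using assms(2)
proof (induction A rule: infinite_finite_induct)
  case (insert i A)
  then show ?case using diff_ops_add[OF assms(1), of "\<delta> i" "\<lambda>s. \<Sum>i\<in>A. \<delta> i s"] by simp
qed (use diff_ops_zero[OF assms(1)] in \<open>simp_all add: zero_fun_def\<close>)

text \<open>An operator on \<open>P\<close> that maps the subalgebra \<open>R\<close> into itself restricts to an operator of at most the same order, because its
commutators with elements of \<open>R\<close> again map \<open>R\<close> into itself.\<close>

lemma diff_ops_lt_restrict:
  assumes P: "subalg P" and R: "subalg R" "R \<subseteq> P"
  shows "\<delta> \<in> diff_ops_lt P m \<Longrightarrow> \<delta> ` R \<subseteq> R \<Longrightarrow> restr R \<delta> \<in> diff_ops_lt R m"
proof (induction m arbitrary: \<delta>)
  case 0
  then show ?case by (simp add: zero_fun_def restr_def)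
next
  case (Suc m)
  have d: "\<delta> \<in> lin_end P" using Suc.prems by auto
  have im: "\<delta> s \<in> R" if "s \<in> R" for s using Suc.prems(2) that by blast
  have "restr R \<delta> \<in> lin_end R"
    by (rule lin_endI) (use R im lin_endD(3,4)[OF d subsetD[OF R(2)]] subsetD[OF R(2)] in \<open>auto simp: restr_def subalgD\<close>)
  moreover have "restr R (\<lambda>s. restr R \<delta> (r * s) - r * restr R \<delta> s) \<in> diff_ops_lt R m" if r: "r \<in> R" for r
  proof -
    have "restr R (restr P (\<lambda>s. \<delta> (r * s) - r * \<delta> s)) \<in> diff_ops_lt R m"
    proof (rule Suc.IH)
      show "restr P (\<lambda>s. \<delta> (r * s) - r * \<delta> s) \<in> diff_ops_lt P m" using Suc.prems r R by auto
      show "restr P (\<lambda>s. \<delta> (r * s) - r * \<delta> s) ` R \<subseteq> R"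
        using R r im by (auto simp: restr_def subalgD)
    qed
    moreover have "restr R (restr P (\<lambda>s. \<delta> (r * s) - r * \<delta> s)) = restr R (\<lambda>s. restr R \<delta> (r * s) - r * restr R \<delta> s)"
      using R r by (auto simp: restr_def fun_eq_iff subalgD)
    ultimately show ?thesis by simp
  qed
  ultimately show ?case by simp
qed

text \<open>Mutually inverse \<open>k\<close>-algebra isomorphisms between two subalgebras. Both directions are part of the notion since
operators are transported both ways.\<close>

definition alg_iso ::
    "'k::field mpoly set \<Rightarrow> 'k mpoly set \<Rightarrow> ('k mpoly \<Rightarrow> 'k mpoly) \<Rightarrow> ('k mpoly \<Rightarrow> 'k mpoly) \<Rightarrow> bool" where
  "alg_iso A B f g \<longleftrightarrow> subalg A \<and> subalg B \<and> (\<forall>x\<in>A. f x \<in> B \<and> g (f x) = x) \<and> (\<forall>y\<in>B. g y \<in> A \<and> f (g y) = y) \<and>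
     (\<forall>x\<in>A. \<forall>y\<in>A. f (x + y) = f x + f y \<and> f (x * y) = f x * f y) \<and> (\<forall>c. f (C c) = C c)"

lemma alg_isoD:
  assumes "alg_iso A B f g"
  shows "subalg A" "subalg B" "x \<in> A \<Longrightarrow> f x \<in> B" "x \<in> A \<Longrightarrow> g (f x) = x" "y \<in> B \<Longrightarrow> g y \<in> A" "y \<in> B \<Longrightarrow> f (g y) = y"
    "x \<in> A \<Longrightarrow> x' \<in> A \<Longrightarrow> f (x + x') = f x + f x'" "x \<in> A \<Longrightarrow> x' \<in> A \<Longrightarrow> f (x * x') = f x * f x'"
    "f (C c) = C c"
  using assms by (auto simp: alg_iso_def)

lemma alg_iso_sym:
  assumes "alg_iso A B f g"
  shows "alg_iso B A g f"
proof -
  note d = alg_isoD[OF assms]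
  have "g (x + y) = g x + g y \<and> g (x * y) = g x * g y" if "x \<in> B" "y \<in> B" for x y
  proof
    have "g (f (g x + g y)) = g x + g y" "g (f (g x * g y)) = g x * g y"
      using that d(5)[of x] d(5)[of y] by (auto intro!: d(4) simp: subalgD[OF d(1)])
    moreover have "f (g x + g y) = x + y" "f (g x * g y) = x * y"
      using that by (simp_all add: d)
    ultimately show "g (x + y) = g x + g y" "g (x * y) = g x * g y" by simp_all
  qed
  moreover have "g (C c) = C c" for c using d(4)[OF subalgD(3)[OF d(1)]] d(9) by metis
  ultimately show ?thesis using d by (simp add: alg_iso_def)
qed

lemma alg_iso_diff:
  assumes "alg_iso A B f g" "x \<in> A" "y \<in> A"
  shows "f (x - y) = f x - f y"
  using alg_isoD(7)[OF assms(1), of "x - y" y] subalgD(7)[OF alg_isoD(1)[OF assms(1)] assms(2,3)] assms by simp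

lemma alg_iso_zero: "alg_iso A B f g \<Longrightarrow> f 0 = 0"
  using alg_iso_diff[of A B f g 0 0] subalgD(1)[OF alg_isoD(1)] by auto

definition transport ::
    "'k::field mpoly set \<Rightarrow> ('k mpoly \<Rightarrow> 'k mpoly) \<Rightarrow> ('k mpoly \<Rightarrow> 'k mpoly) \<Rightarrow> ('k mpoly \<Rightarrow> 'k mpoly) \<Rightarrow> 'k mpoly \<Rightarrow> 'k mpoly" where
  "transport B f g \<delta> = restr B (\<lambda>s. f (\<delta> (g s)))"

lemma transport_lin_end:
  assumes i: "alg_iso A B f g" and d: "\<delta> \<in> lin_end A"
  shows "transport B f g \<delta> \<in> lin_end B"
proof -
  note f = alg_isoD[OF i] and g = alg_isoD[OF alg_iso_sym[OF i]] and dD = lin_endD[OF d]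
  show ?thesis
    by (rule lin_endI)
      (auto simp: transport_def restr_def dD f(3,7,8,9) g(3,7,8,9) subalgD[OF f(2)] subalgD[OF f(1)])
qed

lemma transport_diff_ops_lt:
  assumes i: "alg_iso A B f g"
  shows "\<delta> \<in> diff_ops_lt A m \<Longrightarrow> transport B f g \<delta> \<in> diff_ops_lt B m"
proof (induction m arbitrary: \<delta>)
  case 0
  then show ?case by (simp add: zero_fun_def restr_def transport_def alg_iso_zero[OF i] fun_eq_iff)
next
  case (Suc m)
  note f = alg_isoD[OF i] and g = alg_isoD[OF alg_iso_sym[OF i]]
  have d: "\<delta> \<in> lin_end A" using Suc.prems by auto
  note dD = lin_endD[OF d]
  have "restr B (\<lambda>s. transport B f g \<delta> (r * s) - r * transport B f g \<delta> s) \<in> diff_ops_lt B m" if r: "r \<in> B" for r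
  proof -
    have "transport B f g (restr A (\<lambda>s. \<delta> (g r * s) - g r * \<delta> s)) \<in> diff_ops_lt B m"
      using Suc.prems g(3)[OF r] by (intro Suc.IH) auto
    moreover have "transport B f g (restr A (\<lambda>s. \<delta> (g r * s) - g r * \<delta> s)) =
        restr B (\<lambda>s. transport B f g \<delta> (r * s) - r * transport B f g \<delta> s)"
    proof (rule ext)
      fix s
      show "transport B f g (restr A (\<lambda>s. \<delta> (g r * s) - g r * \<delta> s)) s =
        restr B (\<lambda>s. transport B f g \<delta> (r * s) - r * transport B f g \<delta> s) s"
    proof (cases "s \<in> B")
      case True
      have A: "g r \<in> A" "g s \<in> A" "\<delta> (g s) \<in> A" "\<delta> (g r * g s) \<in> A"
        using True r by (auto simp: g(3) dD subalgD[OF f(1)])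
      have "transport B f g (restr A (\<lambda>s. \<delta> (g r * s) - g r * \<delta> s)) s = f (\<delta> (g r * g s) - g r * \<delta> (g s))"
        using True A(2) by (simp add: transport_def restr_def)
      also have "\<dots> = f (\<delta> (g r * g s)) - f (g r) * f (\<delta> (g s))"
        using alg_iso_diff[OF i A(4) subalgD(5)[OF f(1) A(1,3)]] f(8)[OF A(1,3)] by simp
      also have "\<dots> = restr B (\<lambda>s. transport B f g \<delta> (r * s) - r * transport B f g \<delta> s) s"
        using True r subalgD(5)[OF f(2) r True] g(8)[OF r True] f(6)[OF r] by (simp add: transport_def restr_def)
      finally show ?thesis .
    qed (simp add: transport_def restr_def)
    qed
    ultimately show ?thesis by simp
  qed
  then show ?case using transport_lin_end[OF i d] by simp
qed

lemma transport_diff_ops: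
  assumes "alg_iso A B f g" "\<delta> \<in> diff_ops A"
  shows "transport B f g \<delta> \<in> diff_ops B"
  using transport_diff_ops_lt[OF assms(1)] assms(2) by (auto simp: diff_ops_def)

lemma ddiff_single: "ddiff n \<beta> (single m a) = C a * dmon n \<beta> m"
  by (simp add: ddiff_def lin_ext_single[OF hom_single])

lemma ddiff_add: "ddiff n \<beta> (p + q) = ddiff n \<beta> p + ddiff n \<beta> q"
  by (simp add: ddiff_def lin_ext_add[OF hom_single])

lemma ddiff_0 [simp]: "ddiff n \<beta> 0 = 0"
  by (simp add: ddiff_def)

lemma ddiff_scale: "ddiff n \<beta> (C c * p) = C c * ddiff n \<beta> p"
proof (induction p rule: poly_mapping_single_induct)
  case (single m a)
  have "ddiff n \<beta> (C c * single m a) = C (c * a) * dmon n \<beta> m"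
    by (simp only: mult_single ddiff_single) simp
  then show ?case by (simp only: ddiff_single hom_mult[OF hom_single] mult.assoc)
next
  case (add p q)
  then show ?case by (simp only: ddiff_add distrib_left)
qed simp

lemma ddiff_shift:
  assumes i: "i \<in> {1..n}"
  shows "ddiff n \<beta> (Var i * p) - Var i * ddiff n \<beta> p = (if \<beta> i = 0 then 0 else ddiff n (\<beta>(i := \<beta> i - 1)) (p :: 'k::field mpoly))"
proof (induction p rule: poly_mapping_single_induct)
  case (single m a)
  have "ddiff n \<beta> (Var i * single m a) - Var i * ddiff n \<beta> (single m a) =
      C a * (dmon n \<beta> (m + single i 1) - Var i * dmon n \<beta> m)"
    by (simp add: Var_def mult_single ddiff_single right_diff_distrib add.commute mult.left_commute)
  then show ?case unfolding dmon_shift[OF i] ddiff_single by (cases "\<beta> i = 0") (simp_all only: if_True if_False mult_zero_right simp_thms)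
next
  case (add p q)
  have "ddiff n \<beta> (Var i * (p + q)) - Var i * ddiff n \<beta> (p + q) =
    (ddiff n \<beta> (Var i * p) - Var i * ddiff n \<beta> p) + (ddiff n \<beta> (Var i * q) - Var i * ddiff n \<beta> q)"
    by (simp add: ddiff_add distrib_left)
  then show ?case unfolding add by (cases "\<beta> i = 0") (simp_all only: if_True if_False ddiff_add add_0 simp_thms)
qed simp

lemma ddiff_lin_end: "restr (poly_ring n) (ddiff n \<beta>) \<in> lin_end (poly_ring n)"
  by (rule lin_endI)
    (auto simp: restr_def ddiff_in_poly_ring ddiff_add ddiff_scale subalgD[OF subalg_poly_ring])

text \<open>The order of an operator on a polynomial ring can be tested on commutators with the variables, by the identity
\<open>[\<delta>, r s] = [\<delta>, r] \<circ> s + r \<circ> [\<delta>, s]\<close>.\<close>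

lemma commutators_generated:
  fixes \<delta> :: "'k::field mpoly \<Rightarrow> 'k mpoly" and n :: nat
  defines "P \<equiv> poly_ring n"
  defines "c \<equiv> (\<lambda>r. restr P (\<lambda>s. \<delta> (r * s) - r * \<delta> s))"
  assumes d: "\<delta> \<in> lin_end P" and var: "\<And>i. i \<in> {1..n} \<Longrightarrow> c (Var i) \<in> diff_ops_lt P m" and r: "r \<in> P"
  shows "c r \<in> diff_ops_lt P m"
proof -
  have P: "subalg P" unfolding P_def by (rule subalg_poly_ring)
  note dD = lin_endD[OF d]
  have const: "c (C a) \<in> diff_ops_lt P m" for a
  proof -
    have "c (C a) = 0" by (auto simp: c_def restr_def fun_eq_iff dD)
    then show ?thesis using diff_ops_lt_zero[OF P] by (simp only:)
  qed
  have add: "c (x + y) \<in> diff_ops_lt P m"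
    if "x \<in> P" "y \<in> P" "c x \<in> diff_ops_lt P m" "c y \<in> diff_ops_lt P m" for x y
  proof -
    have "c (x + y) s = c x s + c y s" for s
      using that(1,2) dD(3)[OF subalgD(5)[OF P that(1)] subalgD(5)[OF P that(2)], of s s]
      by (simp add: c_def restr_def distrib_right)
    then have "c (x + y) = (\<lambda>s. c x s + c y s)" by (rule ext)
    then show ?thesis using diff_ops_lt_add[OF P that(3,4)] by (simp only:)
  qed
  have mult: "c (x * y) \<in> diff_ops_lt P m"
    if "x \<in> P" "y \<in> P" "c x \<in> diff_ops_lt P m" "c y \<in> diff_ops_lt P m" for x y
  proof -
    have "c (x * y) s = restr P (\<lambda>s. c x (y * s)) s + x * c y s" for s
      using subalgD(5)[OF P that(2), of s] by (simp add: c_def restr_def right_diff_distrib mult.assoc)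
    then have "c (x * y) = (\<lambda>s. restr P (\<lambda>s. c x (y * s)) s + x * c y s)" by (rule ext)
    then show ?thesis
      using diff_ops_lt_add[OF P diff_ops_lt_precompose[OF P that(2,3)] diff_ops_lt_scale[OF P that(1,4)]]
      by (simp only:)
  qed
  have one: "c 1 \<in> diff_ops_lt P m" using const[of 1] by simp
  have varP: "Var i \<in> P" if "i \<in> {1..n}" for i using Var_in_poly_ring[OF that] by (simp only: P_def)
  have pow: "Var i ^ e \<in> P \<and> c (Var i ^ e) \<in> diff_ops_lt P m" if i: "i \<in> {1..n}" for i e
  proof (induction e)
    case (Suc e)
    then show ?case using mult[OF varP[OF i] _ var[OF i], of "Var i ^ e"] subalgD(5)[OF P varP[OF i]]
      by (simp only: power_Suc simp_thms)
  qed (use one subalgD(2)[OF P] in simp)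
  have prod: "(\<Prod>i\<in>A. Var i ^ e i) \<in> P \<and> c (\<Prod>i\<in>A. Var i ^ e i) \<in> diff_ops_lt P m"
    if "finite A" "A \<subseteq> {1..n}" for A and e :: "nat \<Rightarrow> nat"
    using that
  proof (induction A rule: finite_induct)
    case (insert i A)
    have i: "i \<in> {1..n}" using insert.prems by blast
    have IH: "(\<Prod>i\<in>A. Var i ^ e i) \<in> P" "c (\<Prod>i\<in>A. Var i ^ e i) \<in> diff_ops_lt P m"
      using insert by blast+
    have p: "Var i ^ e i \<in> P" "c (Var i ^ e i) \<in> diff_ops_lt P m" using pow[OF i] by blast+
    show ?case unfolding prod.insert[OF insert.hyps] using mult[OF p(1) IH(1) p(2) IH(2)] subalgD(5)[OF P p(1) IH(1)] by blast
  qed (use one subalgD(2)[OF P] in simp)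
  have "r \<in> P \<and> c r \<in> diff_ops_lt P m"
  proof (induction r rule: poly_mapping_single_induct)
    case zero
    then show ?case using const[of 0] subalgD(1)[OF P] by simp
  next
    case (add p q)
    then show ?case using \<open>\<And>y x. x \<in> P \<Longrightarrow> y \<in> P \<Longrightarrow> c x \<in> diff_ops_lt P m \<Longrightarrow> c y \<in> diff_ops_lt P m \<Longrightarrow> c (x + y) \<in> diff_ops_lt P m\<close>
        subalgD(4)[OF P] by blast
  next
    case (single k a)
    have "keys k \<subseteq> {1..n}" using single r by (simp add: poly_ring_def P_def)
    then have k: "monomial Var k \<in> P" "c (monomial Var k) \<in> diff_ops_lt P m"
      unfolding monomial_def using prod[of "keys k" "lookup k"] by simp_all
    show ?case unfolding single_conv_monomial[of k a]
      using mult[OF subalgD(3)[OF P] k(1) const k(2)] subalgD(5)[OF P subalgD(3)[OF P] k(1)] by blast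
  qed
  then show ?thesis by blast
qed

text \<open>By induction on \<open>|\<beta>|\<close>, as the commutator with \<open>x\<^sub>i\<close> lowers \<open>\<beta>\<^sub>i\<close>.\<close>

lemma ddiff_diff_op:
  "restr (poly_ring n) (ddiff n \<beta>) \<in> diff_ops_lt (poly_ring n :: 'k::field mpoly set) (Suc (\<Sum>i=1..n. \<beta> i))"
proof (induction "\<Sum>i=1..n. \<beta> i" arbitrary: \<beta> rule: less_induct)
  case less
  let ?P = "poly_ring n :: 'k mpoly set" and ?d = "restr (poly_ring n) (ddiff n \<beta>) :: 'k mpoly \<Rightarrow> 'k mpoly"
  have P: "subalg ?P" by (rule subalg_poly_ring)
  have "restr ?P (\<lambda>s. ?d (r * s) - r * ?d s) \<in> diff_ops_lt ?P (\<Sum>i=1..n. \<beta> i)" if "r \<in> ?P" for r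
  proof (rule commutators_generated[OF ddiff_lin_end _ that])
    fix i assume i: "i \<in> {1..n}"
    have eq: "restr ?P (\<lambda>s. ?d (Var i * s) - Var i * ?d s) s =
        (if \<beta> i = 0 then 0 else restr ?P (ddiff n (\<beta>(i := \<beta> i - 1))) s)" for s
      using subalgD(5)[OF P Var_in_poly_ring[OF i], of s] ddiff_shift[OF i, of \<beta> s]
      by (simp only: restr_def if_True if_False split: if_split) simp
    show "restr ?P (\<lambda>s. ?d (Var i * s) - Var i * ?d s) \<in> diff_ops_lt ?P (\<Sum>i=1..n. \<beta> i)"
    proof (cases "\<beta> i = 0")
      case True
      then have "restr ?P (\<lambda>s. ?d (Var i * s) - Var i * ?d s) = 0" using eq by (auto simp: fun_eq_iff)
      then show ?thesis using diff_ops_lt_zero[OF P] by (simp only:)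
    next
      case False
      let ?\<beta> = "\<beta>(i := \<beta> i - 1)"
      have "(\<Sum>j=1..n. \<beta> j) = \<beta> i + (\<Sum>j\<in>{1..n} - {i}. \<beta> j)" by (rule sum.remove) (use i in auto)
      moreover have "(\<Sum>j=1..n. ?\<beta> j) = ?\<beta> i + (\<Sum>j\<in>{1..n} - {i}. ?\<beta> j)"
        by (rule sum.remove) (use i in auto)
      moreover have "(\<Sum>j\<in>{1..n} - {i}. ?\<beta> j) = (\<Sum>j\<in>{1..n} - {i}. \<beta> j)" by (rule sum.cong) auto
      ultimately have k: "(\<Sum>j=1..n. \<beta> j) = Suc (\<Sum>j=1..n. ?\<beta> j)" using False by simp
      have "restr ?P (\<lambda>s. ?d (Var i * s) - Var i * ?d s) = restr ?P (ddiff n ?\<beta>)"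
        using eq False by (auto simp: fun_eq_iff)
      moreover have "restr ?P (ddiff n ?\<beta>) \<in> diff_ops_lt ?P (\<Sum>i=1..n. \<beta> i)"
        unfolding k by (rule less) (simp only: k lessI)
      ultimately show ?thesis by (simp only:)
    qed
  qed
  then show ?case using ddiff_lin_end by simp
qed

section \<open>Orbit sums on the invariants of a transposition-free group\<close>

text \<open>Exponents occur in two forms: as finitely supported functions, which index monomials, and as arbitrary functions of which
only the values on \<open>{1..n}\<close> matter, which index PBW-elements. Among the latter, the extensional functions are the
chosen representatives.\<close>

definition expo :: "nat \<Rightarrow> (nat \<Rightarrow> nat) \<Rightarrow> nat \<Rightarrow>\<^sub>0 nat" where
  "expo n \<alpha> = Abs_poly_mapping (\<lambda>i. if i \<in> {1..n} then \<alpha> i else 0)"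

lemma lookup_expo: "lookup (expo n \<alpha>) i = (if i \<in> {1..n} then \<alpha> i else 0)"
proof -
  have "finite {i. (if i \<in> {1..n} then \<alpha> i else (0::nat)) \<noteq> 0}"
    by (rule finite_subset[of _ "{1..n}"]) auto
  then show ?thesis by (simp add: expo_def)
qed

lemma inside_expo: "inside n (expo n \<alpha>)"
  by (auto simp: in_keys_iff lookup_expo split: if_splits)

lemma expo_lookup: "inside n m \<Longrightarrow> expo n (lookup m) = m"
proof (rule poly_mapping_eqI)
  fix i assume m: "inside n m"
  have "lookup m i = 0" if "i \<notin> {1..n}"
    using that m by (metis in_keys_iff subsetD)
  then show "lookup (expo n (lookup m)) i = lookup m i"
    by (simp only: lookup_expo split: if_split) simp
qed

lemma expo_cong: "(\<And>i. i \<in> {1..n} \<Longrightarrow> \<alpha> i = \<alpha>' i) \<Longrightarrow> expo n \<alpha> = expo n \<alpha>'"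
  by (rule poly_mapping_eqI) (simp add: lookup_expo)

lemma ddiff_cong: "(\<And>i. i \<in> {1..n} \<Longrightarrow> \<beta> i = \<beta>' i) \<Longrightarrow> ddiff n \<beta> = (ddiff n \<beta>' :: 'k::field mpoly \<Rightarrow> 'k mpoly)"
proof -
  assume "\<And>i. i \<in> {1..n} \<Longrightarrow> \<beta> i = \<beta>' i"
  then have "dmon n \<beta> = (dmon n \<beta>' :: _ \<Rightarrow> 'k mpoly)" by (intro ext dmon_cong)
  then show ?thesis by (simp add: ddiff_def)
qed

definition exps :: "nat \<Rightarrow> (nat \<Rightarrow> nat) set" where
  "exps n = PiE {1..n} (\<lambda>_. UNIV)"

lemma restrict_exps [simp]: "restrict \<alpha> {1..n} \<in> exps n"
  by (auto simp: exps_def)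

lemma expo_inj:
  assumes "\<alpha> \<in> exps n" "\<alpha>' \<in> exps n" "expo n \<alpha> = expo n \<alpha>'"
  shows "\<alpha> = \<alpha>'"
proof (rule PiE_ext[of _ "{1..n}"])
  fix i assume "i \<in> {1..n}"
  then show "\<alpha> i = \<alpha>' i" using arg_cong[OF assms(3), of "\<lambda>m. lookup m i"]
    by (simp only: lookup_expo if_True)
qed (use assms in \<open>auto simp: exps_def\<close>)

text \<open>The operator \<open>x\<^sup>\<alpha> \<partial>\<^sup>\<beta>\<close> with \<open>i = (\<alpha>, \<beta>)\<close>.\<close>

definition pbw_op :: "nat \<Rightarrow> pbw_index \<Rightarrow> 'k::field mpoly \<Rightarrow> 'k mpoly" where
  "pbw_op n i p = single (expo n (fst i)) 1 * ddiff n (snd i) p"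

definition fun_act :: "nat \<Rightarrow> (nat \<Rightarrow> nat) \<Rightarrow> (nat \<Rightarrow> nat) \<Rightarrow> nat \<Rightarrow> nat" where
  "fun_act n \<pi> \<alpha> = restrict (\<alpha> \<circ> inv' \<pi>) {1..n}"

definition idx_act :: "nat \<Rightarrow> (nat \<Rightarrow> nat) \<Rightarrow> pbw_index \<Rightarrow> pbw_index" where
  "idx_act n \<pi> i = (fun_act n \<pi> (fst i), fun_act n \<pi> (snd i))"

lemma var_act_dmon:
  assumes p: "\<pi> permutes {1..n}"
  shows "var_act \<pi> (dmon n \<beta> m) = (dmon n (fun_act n \<pi> \<beta>) (exp_act \<pi> m) :: 'k::field mpoly)"
proof -
  have bij: "bij \<pi>" using p by (rule permutes_bij)
  let ?f = "\<lambda>j. of_nat (lookup (exp_act \<pi> m) j choose fun_act n \<pi> \<beta> j) *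
      Var j ^ (lookup (exp_act \<pi> m) j - fun_act n \<pi> \<beta> j) :: 'k mpoly"
  have "dmon n (fun_act n \<pi> \<beta>) (exp_act \<pi> m) = prod (?f \<circ> \<pi>) {1..n}"
    unfolding dmon_def by (rule prod.permute[OF p])
  also have "\<dots> = (\<Prod>i=1..n. of_nat (lookup m i choose \<beta> i) * Var (\<pi> i) ^ (lookup m i - \<beta> i))"
  proof (rule prod.cong[OF refl])
    fix i assume i: "i \<in> {1..n}"
    have "\<pi> i \<in> {1..n}" using permutes_in_image[OF p] i by simp
    then have "fun_act n \<pi> \<beta> (\<pi> i) = \<beta> i"
      unfolding fun_act_def using bij by (simp only: restrict_apply if_True o_apply inv_f_f[OF bij_is_inj])
    then show "(?f \<circ> \<pi>) i = of_nat (lookup m i choose \<beta> i) * Var (\<pi> i) ^ (lookup m i - \<beta> i)"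
      by (simp add: lookup_exp_act' bij)
  qed
  also have "\<dots> = var_act \<pi> (dmon n \<beta> m)"
  proof -
    have "var_act \<pi> (of_nat k :: 'k mpoly) = of_nat k" for k
      using var_act_const[of \<pi> "of_nat k :: 'k"] by (simp only: single_of_nat)
    then show ?thesis by (simp add: dmon_def hom_simps[OF hom_var_act])
  qed
  finally show ?thesis by simp
qed

lemma var_act_ddiff:
  assumes p: "\<pi> permutes {1..n}"
  shows "var_act \<pi> (ddiff n \<beta> q) = (ddiff n (fun_act n \<pi> \<beta>) (var_act \<pi> q) :: 'k::field mpoly)"
proof (induction q rule: poly_mapping_single_induct)
  case (single m a)
  show ?case
    by (simp only: ddiff_single var_act_single[OF permutes_bij[OF p]] hom_mult[OF hom_var_act] var_act_const var_act_dmon[OF p])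
qed (simp_all add: ddiff_add hom_add[OF hom_var_act] hom_zero[OF hom_var_act])

lemma exp_act_expo:
  assumes p: "\<pi> permutes {1..n}"
  shows "exp_act \<pi> (expo n \<alpha>) = expo n (fun_act n \<pi> \<alpha>)"
proof (rule poly_mapping_eqI)
  fix j
  have "inv' \<pi> j \<in> {1..n} \<longleftrightarrow> j \<in> {1..n}"
    using permutes_in_image[OF permutes_inv[OF p]] .
  then show "lookup (exp_act \<pi> (expo n \<alpha>)) j = lookup (expo n (fun_act n \<pi> \<alpha>)) j"
    by (simp add: lookup_exp_act permutes_bij[OF p] lookup_expo fun_act_def)
qed

text \<open>Conjugation by \<open>\<pi>\<close> permutes the PBW-elements.\<close>

lemma var_act_pbw_op:
  assumes p: "\<pi> permutes {1..n}"
  shows "var_act \<pi> (pbw_op n i q) = pbw_op n (idx_act n \<pi> i) (var_act \<pi> q :: 'k::field mpoly)"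
  by (simp add: pbw_op_def idx_act_def hom_mult[OF hom_var_act] var_act_ddiff[OF p]
      var_act_single[OF permutes_bij[OF p]] exp_act_expo[OF p])

lemma pbw_op_in: "pbw_op n i q \<in> (poly_ring n :: 'k::field mpoly set)"
proof -
  have "single (expo n (fst i)) 1 \<in> (poly_ring n :: 'k mpoly set)"
    using inside_expo by (auto simp: poly_ring_def)
  then show ?thesis unfolding pbw_op_def by (rule poly_ring_closed(6)[OF _ ddiff_in_poly_ring])
qed

lemma fun_act_comp:
  assumes "\<sigma> permutes {1..n}" "\<tau> permutes {1..n}"
  shows "fun_act n (\<sigma> \<circ> \<tau>) \<alpha> = fun_act n \<sigma> (fun_act n \<tau> \<alpha>)"
proof (rule ext)
  fix i
  have "inv' \<sigma> i \<in> {1..n} \<longleftrightarrow> i \<in> {1..n}"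
    by (rule permutes_in_image[OF permutes_inv[OF assms(1)]])
  then show "fun_act n (\<sigma> \<circ> \<tau>) \<alpha> i = fun_act n \<sigma> (fun_act n \<tau> \<alpha>) i"
    unfolding fun_act_def o_inv_distrib[OF permutes_bij[OF assms(1)] permutes_bij[OF assms(2)]]
    by (simp add: restrict_def)
qed

lemma fun_act_id: "\<alpha> \<in> exps n \<Longrightarrow> fun_act n id \<alpha> = \<alpha>"
  by (simp add: fun_act_def exps_def inv_id)

lemma fun_act_exps: "fun_act n \<pi> \<alpha> \<in> exps n"
  unfolding fun_act_def by (rule restrict_exps)

abbreviation idxs :: "nat \<Rightarrow> (pbw_index) set" where
  "idxs n \<equiv> exps n \<times> exps n"

lemma idx_act_idxs: "idx_act n \<pi> i \<in> idxs n"
  by (simp add: idx_act_def fun_act_exps)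

lemma idx_act_comp:
  "\<sigma> permutes {1..n} \<Longrightarrow> \<tau> permutes {1..n} \<Longrightarrow> idx_act n (\<sigma> \<circ> \<tau>) i = idx_act n \<sigma> (idx_act n \<tau> i)"
  by (simp add: idx_act_def fun_act_comp)

lemma idx_act_id: "i \<in> idxs n \<Longrightarrow> idx_act n id i = i"
  by (auto simp: idx_act_def fun_act_id)

context perm_set
begin

definition iorb :: "pbw_index \<Rightarrow> (pbw_index) set" where
  "iorb i = (\<lambda>\<pi>. idx_act n \<pi> i) ` H"

lemma finite_iorb [simp]: "finite (iorb i)"
  by (simp add: iorb_def finite_H)

lemma in_iorb_self: "i \<in> idxs n \<Longrightarrow> i \<in> iorb i"
  unfolding iorb_def using id_in idx_act_id by (metis image_eqI)

lemma iorb_idxs: "iorb i \<subseteq> idxs n"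
  using idx_act_idxs unfolding iorb_def by blast

lemma idx_act_inv:
  assumes "\<pi> \<in> H" "i \<in> idxs n"
  shows "idx_act n (inv' \<pi>) (idx_act n \<pi> i) = i"
proof -
  have "idx_act n (inv' \<pi>) (idx_act n \<pi> i) = idx_act n (inv' \<pi> \<circ> \<pi>) i"
    using assms by (intro idx_act_comp[symmetric] perms inv_in)
  also have "inv' \<pi> \<circ> \<pi> = id" using bij_H[OF assms(1)] by (simp add: bij_is_inj)
  finally show ?thesis using assms(2) by (simp only: idx_act_id)
qed

lemma iorb_eq:
  assumes i: "i \<in> idxs n" and j: "j \<in> iorb i"
  shows "iorb j = iorb i"
proof -
  obtain \<tau> where t: "\<tau> \<in> H" "j = idx_act n \<tau> i" using j unfolding iorb_def by blast
  have 1: "iorb (idx_act n \<sigma> k) \<subseteq> iorb k" if "\<sigma> \<in> H" for \<sigma> k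
  proof
    fix x assume "x \<in> iorb (idx_act n \<sigma> k)"
    then obtain \<rho> where r: "\<rho> \<in> H" "x = idx_act n \<rho> (idx_act n \<sigma> k)" unfolding iorb_def by blast
    then have "x = idx_act n (\<rho> \<circ> \<sigma>) k" by (simp add: idx_act_comp[OF perms[OF r(1)] perms[OF that]])
    then show "x \<in> iorb k" unfolding iorb_def using comp_in[OF r(1) that] by blast
  qed
  have "i = idx_act n (inv' \<tau>) j" using idx_act_inv[OF t(1) i] t(2) by simp
  then have "iorb i \<subseteq> iorb j" using 1[OF inv_in[OF t(1)], of j] by simp
  moreover have "iorb j \<subseteq> iorb i" unfolding t(2) by (rule 1[OF t(1)])
  ultimately show ?thesis by blast
qed

lemma bij_betw_idx_act:
  assumes "\<pi> \<in> H" and F: "F \<subseteq> idxs n" "\<And>\<sigma> i. \<sigma> \<in> H \<Longrightarrow> i \<in> F \<Longrightarrow> idx_act n \<sigma> i \<in> F"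
  shows "bij_betw (idx_act n \<pi>) F F"
proof (rule bij_betwI[where g = "idx_act n (inv' \<pi>)"])
  have bij: "bij \<pi>" by (rule bij_H[OF assms(1)])
  show "idx_act n \<pi> \<in> F \<rightarrow> F" "idx_act n (inv' \<pi>) \<in> F \<rightarrow> F"
    using F(2) assms(1) inv_in by auto
  show "idx_act n (inv' \<pi>) (idx_act n \<pi> i) = i" if "i \<in> F" for i
    using idx_act_inv[OF assms(1)] that F(1) by blast
  show "idx_act n \<pi> (idx_act n (inv' \<pi>) i) = i" if "i \<in> F" for i
    using idx_act_inv[OF inv_in[OF assms(1)], of i] that F(1) inv_inv_eq[OF bij] by auto
qed

lemma iorb_stable: "i \<in> idxs n \<Longrightarrow> j \<in> iorb i \<Longrightarrow> \<pi> \<in> H \<Longrightarrow> idx_act n \<pi> j \<in> iorb i"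
  using iorb_eq[of i j] unfolding iorb_def by blast

text \<open>Group the terms by \<open>\<beta>\<close>: uniqueness of the coefficients \<open>a\<^sub>\<beta> \<in> P\<close> reduces the claim to the independence of the
monomials.\<close>

lemma pbw_op_independent:
  fixes c :: "pbw_index \<Rightarrow> 'k::field"
  assumes F: "finite F" "F \<subseteq> idxs n"
    and 0: "\<And>r. r \<in> R \<Longrightarrow> (\<Sum>i\<in>F. C (c i) * pbw_op n i r) = 0"
    and i: "i \<in> F"
  shows "c i = 0"
proof -
  \<comment> \<open>A box that contains all \<open>\<beta>\<close> that occur.\<close>
  define K where "K = Suc (\<Sum>i\<in>F. \<Sum>j=1..n. snd i j)"
  have box: "snd i \<in> box n K" if "i \<in> F" for i
  proof -
    have "snd i j < K" if j: "j \<in> {1..n}" for j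
    proof -
      have "snd i j \<le> (\<Sum>j=1..n. snd i j)" using j by (intro member_le_sum) auto
      also have "\<dots> \<le> (\<Sum>i\<in>F. \<Sum>j=1..n. snd i j)" using \<open>i \<in> F\<close> F(1) by (intro member_le_sum) auto
      finally show ?thesis by (simp add: K_def)
    qed
    moreover have "snd i \<in> exps n" using F(2) \<open>i \<in> F\<close> by auto
    ultimately show ?thesis unfolding box_def exps_def PiE_iff by blast
  qed
  define a where "a \<beta> = (\<Sum>i\<in>{i \<in> F. snd i = \<beta>}. C (c i) * single (expo n (fst i)) (1::'k))" for \<beta>
  have "a (snd i) = 0"
  proof (rule ddiff_unique[OF _ box[OF i]])
    fix r :: "'k mpoly" assume r: "r \<in> R"
    have "(\<Sum>\<beta>\<in>box n K. a \<beta> * ddiff n \<beta> r) =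
        (\<Sum>\<beta>\<in>box n K. \<Sum>i\<in>{i \<in> F. snd i = \<beta>}. C (c i) * pbw_op n i r)"
      by (rule sum.cong[OF refl]) (simp add: a_def sum_distrib_right pbw_op_def mult.assoc)
    also have "\<dots> = (\<Sum>i\<in>F. C (c i) * pbw_op n i r)"
      by (rule sum.group) (use F box in auto)
    finally show "(\<Sum>\<beta>\<in>box n K. a \<beta> * ddiff n \<beta> r) = 0" using 0[OF r] by simp
  qed
  then have "0 = lookup (a (snd i)) (expo n (fst i))" by simp
  also have "\<dots> = (\<Sum>j\<in>{j \<in> F. snd j = snd i}. if j = i then c i else 0)"
    unfolding a_def lookup_sum
  proof (rule sum.cong[OF refl])
    fix j assume j: "j \<in> {j \<in> F. snd j = snd i}"
    have "j \<in> idxs n" "i \<in> idxs n" using i j F(2) by blast+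
    then have "expo n (fst j) = expo n (fst i) \<longleftrightarrow> fst j = fst i"
      using expo_inj[of "fst j" n "fst i"] by (auto simp: mem_Times_iff)
    then have "expo n (fst j) = expo n (fst i) \<longleftrightarrow> j = i" using j by (auto simp: prod_eq_iff)
    then show "lookup (C (c j) * single (expo n (fst j)) 1) (expo n (fst i)) = (if j = i then c i else 0)"
      by (simp add: mult_single lookup_single when_def)
  qed
  also have "\<dots> = c i" using i F(1) by simp
  finally show ?thesis by simp
qed

theorem orbit_sums_independent:
  fixes u :: "(pbw_index) set \<Rightarrow> 'k::field"
  assumes T: "finite T" "T \<subseteq> iorb ` idxs n"
    and 0: "\<And>r. r \<in> R \<Longrightarrow> (\<Sum>B\<in>T. C (u B) * (\<Sum>i\<in>B. pbw_op n i r)) = 0"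
    and B: "B \<in> T"
  shows "u B = 0"
proof -
  define F where "F = \<Union> T"
  have orb: "iorb i = B" "i \<in> idxs n" if "i \<in> B" "B \<in> T" for i B
  proof -
    obtain j where j: "j \<in> idxs n" "B = iorb j" using T(2) \<open>B \<in> T\<close> by blast
    show "iorb i = B" using iorb_eq[OF j(1)] that(1) j(2) by simp
    show "i \<in> idxs n" using that(1) j(2) iorb_idxs by blast
  qed
  have fin: "finite F" unfolding F_def by (rule finite_Union[OF T(1)]) (use T(2) finite_iorb in blast)
  have sub: "F \<subseteq> idxs n" unfolding F_def using orb(2) by blast
  obtain i where i: "i \<in> idxs n" "B = iorb i" using T(2) B by blast
  have "u (iorb i) = 0"
  proof (rule pbw_op_independent[OF fin sub])
    show "i \<in> F" unfolding F_def using i B in_iorb_self by blast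
    fix r :: "'k mpoly" assume r: "r \<in> R"
    have "(\<Sum>i\<in>F. C (u (iorb i)) * pbw_op n i r) = (\<Sum>B\<in>T. \<Sum>i\<in>{i \<in> F. iorb i = B}. C (u (iorb i)) * pbw_op n i r)"
      by (rule sum.group[symmetric]) (use fin T(1) orb in \<open>auto simp: F_def\<close>)
    also have "\<dots> = (\<Sum>B\<in>T. C (u B) * (\<Sum>i\<in>B. pbw_op n i r))"
    proof (rule sum.cong[OF refl])
      fix B assume B: "B \<in> T"
      have "{i \<in> F. iorb i = B} = B"
      proof (intro equalityI subsetI)
        fix x assume "x \<in> {i \<in> F. iorb i = B}"
        then show "x \<in> B" using in_iorb_self[of x] sub by blast
      qed (use orb B F_def in blast)
      then show "(\<Sum>i\<in>{i \<in> F. iorb i = B}. C (u (iorb i)) * pbw_op n i r) = C (u B) * (\<Sum>i\<in>B. pbw_op n i r)"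
        unfolding sum_distrib_left by (intro sum.cong) (auto simp: orb(1)[OF _ B])
    qed
    finally show "(\<Sum>i\<in>F. C (u (iorb i)) * pbw_op n i r) = 0" using 0[OF r] by simp
  qed
  then show ?thesis by (simp only: i(2))
qed

lemma subalg_R: "subalg (R :: 'k::field mpoly set)"
  by (simp add: subalg_def subring_R C_in_R)

theorem orbit_sum_diff_op:
  assumes B: "B \<in> iorb ` idxs n"
  shows "restr R (\<lambda>r. \<Sum>i\<in>B. pbw_op n i r) \<in> diff_ops (R :: 'k::field mpoly set)"
proof -
  let ?P = "poly_ring n :: 'k mpoly set"
  have P: "subalg ?P" by (rule subalg_poly_ring)
  obtain i0 where i0: "i0 \<in> idxs n" "B = iorb i0" using B by blast
  have "(\<lambda>s. \<Sum>i\<in>B. single (expo n (fst i)) 1 * restr ?P (ddiff n (snd i)) s) \<in> diff_ops ?P"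
  proof (rule diff_ops_sum[OF P], rule diff_ops_scale[OF P])
    fix i :: "pbw_index"
    show "single (expo n (fst i)) 1 \<in> ?P" using inside_expo by (auto simp: poly_ring_def)
    show "restr ?P (ddiff n (snd i)) \<in> diff_ops ?P" using ddiff_diff_op unfolding diff_ops_def by blast
  qed
  then obtain m where m: "(\<lambda>s. \<Sum>i\<in>B. single (expo n (fst i)) 1 * restr ?P (ddiff n (snd i)) s) \<in> diff_ops_lt ?P m"
    (is "?D \<in> _") unfolding diff_ops_def by blast
  have sub: "R \<subseteq> ?P" by (auto simp: R_iff)
  have eq: "?D r = (\<Sum>i\<in>B. pbw_op n i r)" if "r \<in> ?P" for r
    using that by (simp add: pbw_op_def restr_def)
  have "(\<Sum>i\<in>B. pbw_op n i r) \<in> R" if r: "r \<in> R" for r :: "'k mpoly"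
    unfolding R_iff invar_def
  proof (intro conjI ballI)
    show "(\<Sum>i\<in>B. pbw_op n i r) \<in> ?P" by (intro subring_set_sum[OF subring_poly_ring] pbw_op_in)
    fix \<pi> assume p: "\<pi> \<in> H"
    have "var_act \<pi> r = r" using r p by (simp add: R_iff invar_def)
    then have "var_act \<pi> (\<Sum>i\<in>B. pbw_op n i r) = (\<Sum>i\<in>B. pbw_op n (idx_act n \<pi> i) r)"
      by (simp add: hom_sum[OF hom_var_act] var_act_pbw_op[OF perms[OF p]])
    also have "\<dots> = (\<Sum>i\<in>B. pbw_op n i r)"
      using i0 iorb_idxs iorb_stable[OF i0(1)]
      by (intro sum.reindex_bij_betw bij_betw_idx_act[OF p]) auto
    finally show "var_act \<pi> (\<Sum>i\<in>B. pbw_op n i r) = (\<Sum>i\<in>B. pbw_op n i r)" .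
  qed
  then have "?D ` R \<subseteq> R" using eq sub by auto
  from diff_ops_lt_restrict[OF P subalg_R sub m this]
  have "restr R ?D \<in> diff_ops R" unfolding diff_ops_def by blast
  also have "restr R ?D = restr R (\<lambda>r. \<Sum>i\<in>B. pbw_op n i r)"
    using eq sub by (auto simp: restr_def fun_eq_iff)
  finally show ?thesis .
qed

end

text \<open>Extend \<open>\<delta>\<close> to \<open>\<Sum>c\<^sub>i b\<^sub>i\<close> with PBW-elements \<open>b\<^sub>i\<close>. For \<open>r \<in> R\<close> and \<open>\<pi> \<in> H\<close>, both \<open>r\<close> and \<open>\<delta> r\<close> are fixed by \<open>\<pi>\<close>, so the
conjugate \<open>\<Sum>c\<^sub>i b\<^bsub>\<pi> i\<^esub>\<close> extends \<open>\<delta>\<close> as well. By independence on \<open>R\<close>, the coefficients are constant on orbits.\<close>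

theorem (in perm_set_no_transpositions) orbit_sums_span:
  assumes d: "\<delta> \<in> diff_ops (R :: 'k::field mpoly set)"
  shows "\<exists>T u. finite T \<and> T \<subseteq> iorb ` idxs n \<and>
    (\<forall>r\<in>R. \<delta> r = (\<Sum>B\<in>T. C (u B) * (\<Sum>i\<in>B. pbw_op n i r)))"
proof -
  obtain K a where a: "\<And>\<beta>. a \<beta> \<in> (poly_ring n :: 'k mpoly set)"
    "\<And>r. r \<in> R \<Longrightarrow> \<delta> r = (\<Sum>\<beta>\<in>box n K. a \<beta> * ddiff n \<beta> r)"
    using extension[OF d] by metis
  have lin: "\<delta> \<in> lin_end R" using d diff_ops_lt_lin_end[OF subalg_R] unfolding diff_ops_def by blast
  define keyset where "keyset \<beta> = (\<lambda>m. restrict (lookup m) {1..n}) ` keys (a \<beta>)" for \<beta>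
  define F where "F = (\<lambda>(\<beta>, \<alpha>). (\<alpha>, \<beta>)) ` Sigma (box n K) keyset"
  define c where "c i = lookup (a (snd i)) (expo n (fst i))" for i
  have finF: "finite F" unfolding F_def keyset_def by auto
  have subF: "F \<subseteq> idxs n" unfolding F_def keyset_def
    by (auto simp: box_def exps_def PiE_iff)
  have a_sum: "a \<beta> = (\<Sum>\<alpha>\<in>keyset \<beta>. C (c (\<alpha>, \<beta>)) * single (expo n \<alpha>) 1)" for \<beta>
  proof -
    have ex: "expo n (restrict (lookup m) {1..n}) = m" if "m \<in> keys (a \<beta>)" for m
    proof -
      have "inside n m" using that a(1)[of \<beta>] by (simp add: poly_ring_def)
      then show ?thesis using expo_lookup expo_cong[of n "restrict (lookup m) {1..n}" "lookup m"]
        by (simp only: restrict_apply if_True)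
    qed
    have inj: "inj_on (\<lambda>m. restrict (lookup m) {1..n}) (keys (a \<beta>))"
      by (rule inj_on_inverseI[where g = "expo n"]) (rule ex)
    have "(\<Sum>\<alpha>\<in>keyset \<beta>. C (c (\<alpha>, \<beta>)) * single (expo n \<alpha>) 1) =
        (\<Sum>m\<in>keys (a \<beta>). single m (lookup (a \<beta>) m))"
      unfolding keyset_def sum.reindex[OF inj] by (rule sum.cong[OF refl]) (simp only: o_apply c_def ex fst_conv snd_conv mult_single add_0 mult_1_right)
    also have "\<dots> = a \<beta>" by (rule poly_mapping_sum_singles[symmetric])
    finally show ?thesis by simp
  qed
  have expand: "\<delta> r = (\<Sum>i\<in>F. C (c i) * pbw_op n i r)" if r: "r \<in> R" for r
  proof -
    have "\<delta> r = (\<Sum>\<beta>\<in>box n K. \<Sum>\<alpha>\<in>keyset \<beta>. C (c (\<alpha>, \<beta>)) * pbw_op n (\<alpha>, \<beta>) r)"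
      unfolding a(2)[OF r] by (rule sum.cong[OF refl], subst a_sum) (simp add: sum_distrib_right pbw_op_def mult.assoc)
    also have "\<dots> = (\<Sum>(\<beta>, \<alpha>)\<in>Sigma (box n K) keyset. C (c (\<alpha>, \<beta>)) * pbw_op n (\<alpha>, \<beta>) r)"
      by (rule sum.Sigma) (auto simp: keyset_def)
    also have "\<dots> = (\<Sum>i\<in>F. C (c i) * pbw_op n i r)"
      unfolding F_def by (subst sum.reindex) (auto simp: inj_on_def case_prod_unfold)
    finally show ?thesis .
  qed
  define c' where "c' i = (if i \<in> F then c i else 0)" for i
  have c'_sum: "\<delta> r = (\<Sum>i\<in>F'. C (c' i) * pbw_op n i r)" if "r \<in> R" "finite F'" "F \<subseteq> F'" for r F'
    unfolding expand[OF that(1)] by (rule sum.mono_neutral_cong_left) (use that in \<open>auto simp: c'_def\<close>)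
  have c'_inv: "c' (idx_act n \<pi> i) = c' i" if p: "\<pi> \<in> H" and i: "i \<in> idxs n" for \<pi> i
  proof -
    \<comment> \<open>A stable finite index set is needed to compare coefficients before and after the action.\<close>
    define F' where "F' = \<Union> (iorb ` insert i F)"
    have self: "x \<in> F'" if "x \<in> insert i F" for x
      unfolding F'_def using in_iorb_self[of x] subF i that by blast
    have F': "finite F'" "F' \<subseteq> idxs n" "F \<subseteq> F'" "i \<in> F'"
    proof -
      show "finite F'" unfolding F'_def using finF by simp
      show "F' \<subseteq> idxs n" unfolding F'_def using iorb_idxs by blast
    qed (use self in blast)+
    have stable: "idx_act n \<sigma> j \<in> F'" if s: "\<sigma> \<in> H" and j: "j \<in> F'" for \<sigma> j
    proof -
      obtain l where l: "l \<in> insert i F" "j \<in> iorb l" using j unfolding F'_def by blast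
      then have "idx_act n \<sigma> j \<in> iorb l" using iorb_stable[OF _ l(2) s] subF i by blast
      then show ?thesis unfolding F'_def using l(1) by blast
    qed
    have "c' (idx_act n \<pi> i) - c' (idx_act n (inv' \<pi>) (idx_act n \<pi> i)) = 0"
    proof (rule pbw_op_independent[OF F'(1,2), where c = "\<lambda>j. c' j - c' (idx_act n (inv' \<pi>) j)"])
      show "idx_act n \<pi> i \<in> F'" by (rule stable[OF p F'(4)])
      fix r :: "'k mpoly" assume r: "r \<in> R"
      have rinv: "var_act \<pi> r = r" using r p by (simp add: R_iff invar_def)
      have "\<delta> r \<in> R" by (rule lin_endD(1)[OF lin r])
      then have "\<delta> r = var_act \<pi> (\<delta> r)" using p by (simp add: R_iff invar_def)
      also have "\<dots> = (\<Sum>j\<in>F'. C (c' j) * pbw_op n (idx_act n \<pi> j) r)"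
        unfolding c'_sum[OF r F'(1,3)]
        by (simp add: hom_sum[OF hom_var_act] hom_mult[OF hom_var_act] var_act_pbw_op[OF perms[OF p]] rinv)
      also have "\<dots> = (\<Sum>j\<in>F'. C (c' (idx_act n (inv' \<pi>) (idx_act n \<pi> j))) * pbw_op n (idx_act n \<pi> j) r)"
        by (rule sum.cong[OF refl]) (use idx_act_inv[OF p] F'(2) in auto)
      also have "\<dots> = (\<Sum>j\<in>F'. C (c' (idx_act n (inv' \<pi>) j)) * pbw_op n j r)"
        by (rule sum.reindex_bij_betw[OF bij_betw_idx_act[OF p F'(2) stable]])
      finally have "(\<Sum>j\<in>F'. C (c' j) * pbw_op n j r) = (\<Sum>j\<in>F'. C (c' (idx_act n (inv' \<pi>) j)) * pbw_op n j r)"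
        using c'_sum[OF r F'(1,3)] by simp
      then show "(\<Sum>j\<in>F'. C (c' j - c' (idx_act n (inv' \<pi>) j)) * pbw_op n j r) = 0"
        by (simp add: hom_diff[OF hom_single] left_diff_distrib sum_subtractf)
    qed
    then show ?thesis using idx_act_inv[OF p i] by simp
  qed
  define F0 where "F0 = {i \<in> F. c' i \<noteq> 0}"
  define rp where "rp B = (SOME i. i \<in> B)" for B :: "(pbw_index) set"
  have orb_c': "c' j = c' i" if "i \<in> idxs n" "j \<in> iorb i" for i j
    using that c'_inv unfolding iorb_def by blast
  show ?thesis
  proof (rule exI[of _ "iorb ` F0"], rule exI[of _ "\<lambda>B. c' (rp B)"], intro conjI ballI)
    show "finite (iorb ` F0)" "iorb ` F0 \<subseteq> iorb ` idxs n" using finF subF by (auto simp: F0_def)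
    fix r :: "'k mpoly" assume r: "r \<in> R"
    have "\<delta> r = (\<Sum>i\<in>F0. C (c' i) * pbw_op n i r)"
      unfolding c'_sum[OF r finF order_refl] by (rule sum.mono_neutral_right) (use finF in \<open>auto simp: F0_def\<close>)
    also have "\<dots> = (\<Sum>B\<in>iorb ` F0. \<Sum>i\<in>{i \<in> F0. iorb i = B}. C (c' i) * pbw_op n i r)"
      by (rule sum.image_gen) (use finF in \<open>simp add: F0_def\<close>)
    also have "\<dots> = (\<Sum>B\<in>iorb ` F0. C (c' (rp B)) * (\<Sum>i\<in>B. pbw_op n i r))"
    proof (rule sum.cong[OF refl])
      fix B assume "B \<in> iorb ` F0"
      then obtain i where i: "i \<in> F0" "B = iorb i" by blast
      have ii: "i \<in> idxs n" using i subF by (auto simp: F0_def)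
      have "{j \<in> F0. iorb j = B} = B"
      proof (intro equalityI subsetI)
        fix j assume "j \<in> {j \<in> F0. iorb j = B}"
        then show "j \<in> B" using in_iorb_self[of j] subF by (auto simp: F0_def)
      next
        fix j assume j: "j \<in> B"
        then have "c' j \<noteq> 0" using orb_c'[OF ii, of j] i by (simp add: F0_def)
        then show "j \<in> {j \<in> F0. iorb j = B}"
          using iorb_eq[OF ii, of j] j i(2) by (auto simp: F0_def c'_def split: if_splits)
      qed
      moreover have "rp B \<in> B" unfolding rp_def i(2) by (rule someI[of _ i]) (rule in_iorb_self[OF ii])
      then have "c' j = c' (rp B)" if "j \<in> B" for j using orb_c'[OF ii] that i(2) by simp
      ultimately show "(\<Sum>j\<in>{j \<in> F0. iorb j = B}. C (c' j) * pbw_op n j r) = C (c' (rp B)) * (\<Sum>i\<in>B. pbw_op n i r)"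
        by (simp add: sum_distrib_left)
    qed
    finally show "\<delta> r = (\<Sum>B\<in>iorb ` F0. C (c' (rp B)) * (\<Sum>i\<in>B. pbw_op n i r))" .
  qed
qed

section \<open>Orbit sums in arbitrary polynomial coordinates\<close>

lemma sum_fun_apply: "(\<Sum>f\<in>A. F f) s = (\<Sum>f\<in>A. F f s)"
  for F :: "'i \<Rightarrow> 'a \<Rightarrow> 'b::comm_monoid_add"
  by (induction A rule: infinite_finite_induct) auto

text \<open>Independence of a family, with possible repetitions counted, includes its injectivity.\<close>

lemma is_k_basisI:
  assumes indep: "\<And>T u. finite T \<Longrightarrow> T \<subseteq> I \<Longrightarrow> (\<Sum>i\<in>T. op_scale (u i) (f i)) = 0 \<Longrightarrow> \<forall>i\<in>T. u i = 0"
    and sub: "f ` I \<subseteq> V" "op.subspace V"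
    and span: "\<And>\<delta>. \<delta> \<in> V \<Longrightarrow> \<exists>T u. finite T \<and> T \<subseteq> I \<and> \<delta> = (\<Sum>i\<in>T. op_scale (u i) (f i))"
  shows "is_k_basis f I (V :: ('k::field mpoly \<Rightarrow> 'k mpoly) set)"
proof -
  have inj: "inj_on f I"
  proof (rule inj_onI, rule ccontr)
    fix i j assume ij: "i \<in> I" "j \<in> I" "f i = f j" "i \<noteq> j"
    define u :: "'a \<Rightarrow> 'k" where "u l = (if l = i then 1 else - 1)" for l
    have "(\<Sum>l\<in>{i, j}. op_scale (u l) (f l)) = op_scale 1 (f i) + op_scale (- 1) (f j)"
      using ij(4) by (simp add: u_def)
    also have "\<dots> = 0" by (simp only: ij(3) op.scale_minus_left add.right_inverse)
    finally have "\<forall>l\<in>{i, j}. u l = 0" using ij by (intro indep) auto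
    then show False by (simp add: u_def)
  qed
  moreover have "op.independent (f ` I)"
    unfolding op.independent_explicit_finite_subsets
  proof (intro allI impI)
    fix S v assume S: "S \<subseteq> f ` I" "finite S" and 0: "(\<Sum>v'\<in>S. op_scale (v v') v') = 0"
    obtain T where T: "T \<subseteq> I" "finite T" "S = f ` T" using finite_subset_image[OF S(2,1)] by blast
    have injT: "inj_on f T" using inj T(1) by (rule inj_on_subset)
    have "(\<Sum>i\<in>T. op_scale (v (f i)) (f i)) = 0" using 0 unfolding T(3) sum.reindex[OF injT] by (simp only: o_def)
    then have "\<forall>i\<in>T. v (f i) = 0" by (rule indep[OF T(2,1), where u = "\<lambda>i. v (f i)"])
    then show "\<forall>v'\<in>S. v v' = 0" unfolding T(3) by blast
  qed
  moreover have "op.span (f ` I) = V"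
  proof (rule equalityI)
    show "op.span (f ` I) \<subseteq> V" using sub by (rule op.span_minimal)
    show "V \<subseteq> op.span (f ` I)"
    proof
      fix \<delta> assume "\<delta> \<in> V"
      then obtain T u where T: "finite T" "T \<subseteq> I" "\<delta> = (\<Sum>i\<in>T. op_scale (u i) (f i))" using span by blast
      show "\<delta> \<in> op.span (f ` I)" unfolding T(3)
        by (intro op.span_sum op.span_scale op.span_base) (use T(2) in blast)
    qed
  qed
  ultimately show ?thesis by (simp add: is_k_basis_def)
qed

lemma subspace_diff_ops:
  assumes R: "subalg R"
  shows "op.subspace (diff_ops R)"
proof (rule op.subspaceI)
  show "0 \<in> diff_ops R" by (rule diff_ops_zero[OF R])
  show "\<delta> + \<epsilon> \<in> diff_ops R" if "\<delta> \<in> diff_ops R" "\<epsilon> \<in> diff_ops R" for \<delta> \<epsilon>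
    using diff_ops_add[OF R that] by (simp add: plus_fun_def)
  show "op_scale c \<delta> \<in> diff_ops R" if "\<delta> \<in> diff_ops R" for c \<delta>
    unfolding op_scale_def Const_eq_C by (rule diff_ops_scale[OF R subalgD(3)[OF R] that])
qed

lemma alg_iso_image:
  assumes f: "ring_hom_fun f" "\<And>c. f (C c) = C c" and A: "subalg A" and g: "\<And>x. x \<in> A \<Longrightarrow> g (f x) = x"
  shows "alg_iso A (f ` A) f g"
proof -
  have "subring_set (f ` A)"
    unfolding subring_set_def
  proof (intro conjI ballI)
    show "0 \<in> f ` A" using hom_zero[OF f(1)] subalgD(1)[OF A] by (metis image_eqI)
    show "1 \<in> f ` A" using hom_one[OF f(1)] subalgD(2)[OF A] by (metis image_eqI)
    show "- y \<in> f ` A" if "y \<in> f ` A" for y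
      using that hom_uminus[OF f(1)] subalgD(6)[OF A] by (metis (no_types, lifting) imageE imageI)
    show "y + y' \<in> f ` A" "y * y' \<in> f ` A" if y: "y \<in> f ` A" "y' \<in> f ` A" for y y'
    proof -
      obtain x x' where x: "x \<in> A" "x' \<in> A" "y = f x" "y' = f x'" using y by blast
      have "y + y' = f (x + x')" "y * y' = f (x * x')" by (simp_all add: x hom_add[OF f(1)] hom_mult[OF f(1)])
      then show "y + y' \<in> f ` A" "y * y' \<in> f ` A" using subalgD(4,5)[OF A x(1,2)] by blast+
    qed
  qed
  moreover have "C c \<in> f ` A" for c using f(2) subalgD(3)[OF A] by (metis image_eqI)
  ultimately show ?thesis
    unfolding alg_iso_def subalg_def using A g f
    by (auto simp: hom_add[OF f(1)] hom_mult[OF f(1)] subalg_def)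
qed

lemma hom_subst: "ring_hom_fun (subst z)"
  unfolding subst_eq_eval_hom by (rule hom_eval_hom[OF hom_single])

lemma subst_C [simp]: "subst z (C c) = C c"
  by (simp add: subst_eq_eval_hom eval_hom_single[OF hom_single])

lemma subst_Var [simp]: "subst z (Var i) = z i"
  by (simp add: subst_eq_eval_hom eval_hom_Var[OF hom_single])

lemma mon_eq_subst: "mon n z \<alpha> = subst z (single (expo n \<alpha>) 1)"
proof -
  have "subst z (single (expo n \<alpha>) 1) = monomial z (expo n \<alpha>)"
    by (simp add: subst_eq_eval_hom eval_hom_single[OF hom_single])
  also have "\<dots> = (\<Prod>i=1..n. z i ^ lookup (expo n \<alpha>) i)"
    by (rule monomial_superset[OF finite_atLeastAtMost inside_expo])
  also have "\<dots> = mon n z \<alpha>" by (simp add: mon_def lookup_expo)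
  finally show ?thesis by simp
qed

lemma var_act_poly_ring:
  assumes "\<pi> permutes {1..n}" "q \<in> poly_ring n"
  shows "var_act \<pi> q \<in> (poly_ring n :: 'k::field mpoly set)"
proof -
  have "q \<in> poly_ring n \<longrightarrow> var_act \<pi> q \<in> (poly_ring n :: 'k mpoly set)"
  proof -
    have "var_act \<pi> q \<in> (poly_ring n :: 'k mpoly set)" if q: "q \<in> poly_ring n"
    proof (induction q rule: poly_mapping_single_induct)
      case (single m a)
      then have "keys m \<subseteq> {1..n}" using q by (simp add: poly_ring_def)
      then have "keys (exp_act \<pi> m) \<subseteq> {1..n}"
        using permutes_in_image[OF assms(1)] by (auto simp: keys_exp_act permutes_bij[OF assms(1)])
      then show ?case by (simp add: var_act_single permutes_bij[OF assms(1)] poly_ring_def)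
    qed (simp_all add: hom_zero[OF hom_var_act] hom_add[OF hom_var_act] poly_ring_closed)
    then show ?thesis by blast
  qed
  then show ?thesis using assms(2) by blast
qed

text \<open>A polynomial ring \<open>P\<close> in variables \<open>z\<^sub>i\<close> inside the given polynomials; \<open>coord\<close> is the inverse of \<open>x\<^sub>i \<mapsto> z\<^sub>i\<close>.\<close>

locale polynomial_coordinates =
  fixes n :: nat and z :: "nat \<Rightarrow> 'k::field mpoly" and P :: "'k mpoly set"
  assumes poly_ring_on: "is_poly_ring_on n z P"
begin

definition coord :: "'k mpoly \<Rightarrow> 'k mpoly" where
  "coord = the_inv_into (poly_ring n) (subst z)"

lemma P_eq: "P = subst z ` poly_ring n"
  using poly_ring_on by (simp add: is_poly_ring_on_def bij_betw_def)

lemma coord_subst: "q \<in> poly_ring n \<Longrightarrow> coord (subst z q) = q"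
  using poly_ring_on unfolding coord_def is_poly_ring_on_def bij_betw_def by (simp add: the_inv_into_f_f)

lemma iso: "A \<subseteq> poly_ring n \<Longrightarrow> subalg A \<Longrightarrow> alg_iso A (subst z ` A) (subst z) coord"
  by (rule alg_iso_image[OF hom_subst]) (auto intro: coord_subst)

lemma iso_P: "alg_iso (poly_ring n) P (subst z) coord"
  unfolding P_eq by (rule iso[OF order_refl subalg_poly_ring])

text \<open>The divided derivatives of \<open>P\<close> are the transported ones of \<open>k[x\<^sub>1,\<dots>,x\<^sub>n]\<close>: these are linear with the required values on
monomials, and the monomials span \<open>P\<close>.\<close>

lemma divided_deriv_eq: "divided_deriv n z P \<beta> = restr P (\<lambda>s. subst z (ddiff n \<beta> (coord s)))"
  (is "_ = ?D")
  unfolding divided_deriv_def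
proof (rule the_equality)
  let ?Q = "\<lambda>\<delta>. \<delta> \<in> lin_end P \<and> (\<forall>\<gamma>. \<delta> (mon n z \<gamma>) =
        (\<Prod>i = 1..n. of_nat (\<gamma> i choose \<beta> i)) * mon n z (\<lambda>i. \<gamma> i - \<beta> i))"
  have single_in: "single (expo n \<gamma>) 1 \<in> (poly_ring n :: 'k mpoly set)" for \<gamma>
    using inside_expo by (auto simp: poly_ring_def)
  have D: "?D (subst z q) = subst z (ddiff n \<beta> q)" if "q \<in> poly_ring n" for q
    using that by (simp add: restr_def P_eq coord_subst)
  have "?D \<in> lin_end P"
  proof -
    have "?D = transport P (subst z) coord (restr (poly_ring n) (ddiff n \<beta>))"
      using alg_isoD(5)[OF iso_P] by (auto simp: transport_def restr_def fun_eq_iff)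
    then show ?thesis using transport_lin_end[OF iso_P ddiff_lin_end] by simp
  qed
  moreover have mon: "?D (mon n z \<gamma>) = (\<Prod>i = 1..n. of_nat (\<gamma> i choose \<beta> i)) * mon n z (\<lambda>i. \<gamma> i - \<beta> i)" for \<gamma>
  proof -
    have of_nat: "subst z (of_nat k) = of_nat k" for k
      using subst_C[of z "of_nat k"] by (simp only: single_of_nat)
    have "?D (mon n z \<gamma>) = subst z (dmon n \<beta> (expo n \<gamma>))"
      unfolding mon_eq_subst D[OF single_in] by (simp add: ddiff_single)
    also have "\<dots> = (\<Prod>i = 1..n. of_nat (\<gamma> i choose \<beta> i) * z i ^ (\<gamma> i - \<beta> i))"
      unfolding dmon_def hom_prod[OF hom_subst]
      by (rule prod.cong[OF refl]) (simp add: hom_mult[OF hom_subst] hom_power[OF hom_subst] of_nat lookup_expo)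
    finally show ?thesis by (simp add: mon_def prod.distrib)
  qed
  ultimately show "?Q ?D" by blast
  fix \<delta> assume \<delta>: "?Q \<delta>"
  then have lin: "\<delta> \<in> lin_end P" by blast
  note P = alg_isoD(2)[OF iso_P]
  have "\<delta> (subst z q) = ?D (subst z q)" if q: "q \<in> poly_ring n" for q
  proof -
    have "q \<in> poly_ring n \<and> \<delta> (subst z q) = ?D (subst z q)"
    proof (induction q rule: poly_mapping_single_induct)
      case zero
      have "\<delta> (C 0 * 0) = C 0 * \<delta> 0" "?D (C 0 * 0) = C 0 * ?D 0"
        using lin_endD(4)[OF lin subalgD(1)[OF P]] lin_endD(4)[OF \<open>?D \<in> lin_end P\<close> subalgD(1)[OF P]] by blast+
      then show ?case by (simp add: hom_zero[OF hom_subst] poly_ring_closed)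
    next
      case (add p q)
      then have "subst z p \<in> P" "subst z q \<in> P" by (auto simp: P_eq)
      then show ?case using add lin_endD(3)[OF lin] lin_endD(3)[OF \<open>?D \<in> lin_end P\<close>]
        by (simp only: hom_add[OF hom_subst] poly_ring_closed simp_thms)
    next
      case (single m a)
      then have m: "inside n m" using q by (simp add: poly_ring_def)
      have eq: "subst z (single m a) = C a * mon n z (lookup m)"
        unfolding mon_eq_subst expo_lookup[OF m] using hom_mult[OF hom_subst, of z "C a" "single m 1"]
        by (simp add: mult_single)
      have "mon n z (lookup m) \<in> P" unfolding mon_eq_subst P_eq using single_in by blast
      then have "\<delta> (subst z (single m a)) = ?D (subst z (single m a))"
        unfolding eq using \<delta> mon lin_endD(4)[OF lin] lin_endD(4)[OF \<open>?D \<in> lin_end P\<close>] by simp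
      moreover have "single m a \<in> poly_ring n" using m by (simp add: poly_ring_def)
      ultimately show ?case by blast
    qed
    then show ?thesis by blast
  qed
  then have "\<delta> s = ?D s" for s
  proof (cases "s \<in> P")
    case False
    then show ?thesis using lin_endD(2)[OF lin] by (simp add: restr_def)
  qed (auto simp: P_eq)
  then show "\<delta> = ?D" by (rule ext)
qed

definition pbw_elem :: "pbw_index \<Rightarrow> 'k mpoly \<Rightarrow> 'k mpoly" where
  "pbw_elem i = (\<lambda>s. mon n z (fst i) * divided_deriv n z P (snd i) s)"

lemma pbw_elem_subst: "q \<in> poly_ring n \<Longrightarrow> pbw_elem i (subst z q) = subst z (pbw_op n i q)"
proof -
  assume q: "q \<in> poly_ring n"
  then have "subst z q \<in> P" by (simp add: P_eq)
  then show ?thesis unfolding pbw_elem_def divided_deriv_eq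
    by (simp add: restr_def coord_subst[OF q] mon_eq_subst pbw_op_def hom_mult[OF hom_subst])
qed

lemma pbw_elem_outside: "s \<notin> P \<Longrightarrow> pbw_elem i s = 0"
  by (simp add: pbw_elem_def divided_deriv_eq restr_def)

lemma pbw_basis_eq: "pbw_basis n z P = pbw_elem ` idxs n"
proof (intro equalityI subsetI)
  fix \<delta> assume "\<delta> \<in> pbw_basis n z P"
  then obtain \<alpha> \<beta> where d: "\<delta> = (\<lambda>s. mon n z \<alpha> * divided_deriv n z P \<beta> s)" by (auto simp: pbw_basis_def)
  have "mon n z \<alpha> = mon n z (restrict \<alpha> {1..n})" by (simp add: mon_def)
  moreover have "divided_deriv n z P \<beta> = divided_deriv n z P (restrict \<beta> {1..n})"
  proof -
    have "ddiff n \<beta> = (ddiff n (restrict \<beta> {1..n}) :: 'k mpoly \<Rightarrow> 'k mpoly)" by (rule ddiff_cong) simp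
    then show ?thesis unfolding divided_deriv_eq by (simp only:)
  qed
  ultimately have "\<delta> = pbw_elem (restrict \<alpha> {1..n}, restrict \<beta> {1..n})"
    by (simp only: d pbw_elem_def fst_conv snd_conv)
  moreover have "(restrict \<alpha> {1..n}, restrict \<beta> {1..n}) \<in> idxs n" by (intro SigmaI restrict_exps)
  ultimately show "\<delta> \<in> pbw_elem ` idxs n" by blast
next
  fix \<delta> assume "\<delta> \<in> pbw_elem ` idxs n"
  then show "\<delta> \<in> pbw_basis n z P" by (auto simp: pbw_basis_def pbw_elem_def)
qed

end

text \<open>A group \<open>\<G>\<close> acts on \<open>P\<close> through the permutations \<open>H\<close> of the coordinates. Orbits depend only on the set of induced
permutations; the action of the inverse is included because conjugation uses it.\<close>

locale permuted_coordinates =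
  polynomial_coordinates n z P + perm_set_no_transpositions n H
  for n :: nat and z :: "nat \<Rightarrow> 'k::field mpoly" and P :: "'k mpoly set" and H :: "(nat \<Rightarrow> nat) set" +
  fixes \<G> :: "('g, 'b) monoid_scheme" and \<phi> :: "'g \<Rightarrow> 'k mpoly \<Rightarrow> 'k mpoly"
  assumes group_to_perm: "g \<in> carrier \<G> \<Longrightarrow> \<exists>\<pi>\<in>H. \<forall>q\<in>poly_ring n.
      \<phi> g (subst z q) = subst z (var_act \<pi> q) \<and> \<phi> (inv\<^bsub>\<G>\<^esub> g) (subst z q) = subst z (var_act (inv' \<pi>) q)"
    and perm_to_group: "\<pi> \<in> H \<Longrightarrow> \<exists>g\<in>carrier \<G>. \<forall>q\<in>poly_ring n.
      \<phi> g (subst z q) = subst z (var_act \<pi> q) \<and> \<phi> (inv\<^bsub>\<G>\<^esub> g) (subst z q) = subst z (var_act (inv' \<pi>) q)"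
begin

definition inv_ring :: "'k mpoly set" where
  "inv_ring = subst z ` R"

lemma R_sub: "(R :: 'k mpoly set) \<subseteq> poly_ring n"
  by (auto simp: R_iff)

lemma iso_R: "alg_iso R inv_ring (subst z) coord"
  unfolding inv_ring_def by (rule iso[OF R_sub subalg_R])

lemma inj_pbw_elem: "inj_on pbw_elem (idxs n)"
proof (rule inj_onI, rule ccontr)
  fix i j assume ij: "i \<in> idxs n" "j \<in> idxs n" "pbw_elem i = pbw_elem j" "i \<noteq> j"
  define c :: "pbw_index \<Rightarrow> 'k" where "c l = (if l = i then 1 else - 1)" for l
  have "c i = 0"
  proof (rule pbw_op_independent[of "{i, j}"])
    fix r :: "'k mpoly" assume "r \<in> R"
    then have r: "r \<in> poly_ring n" using R_sub by blast
    have "subst z (pbw_op n i r) = subst z (pbw_op n j r)"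
      using ij(3) pbw_elem_subst[OF r] by metis
    then have "pbw_op n i r = pbw_op n j r" using coord_subst[OF pbw_op_in] by metis
    then show "(\<Sum>l\<in>{i, j}. C (c l) * pbw_op n l r) = 0"
      using ij(4) by (simp add: c_def single_uminus)
  qed (use ij in auto)
  then show False by (simp add: c_def)
qed

lemma conj_act_pbw_elem:
  assumes \<pi>: "\<pi> \<in> H" and g: "\<forall>q\<in>poly_ring n. \<phi> g (subst z q) = subst z (var_act \<pi> q) \<and>
      \<phi> (inv\<^bsub>\<G>\<^esub> g) (subst z q) = subst z (var_act (inv' \<pi>) q)"
  shows "conj_act \<G> \<phi> P g (pbw_elem i) = pbw_elem (idx_act n \<pi> i)"
proof (rule ext)
  fix s
  show "conj_act \<G> \<phi> P g (pbw_elem i) s = pbw_elem (idx_act n \<pi> i) s"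
  proof (cases "s \<in> P")
    case True
    then obtain q where q: "q \<in> poly_ring n" "s = subst z q" by (auto simp: P_eq)
    let ?q = "var_act (inv' \<pi>) q"
    have q': "?q \<in> poly_ring n" by (rule var_act_poly_ring[OF perms[OF inv_in[OF \<pi>]] q(1)])
    have "var_act \<pi> ?q = var_act (\<pi> \<circ> inv' \<pi>) q" by (simp only: var_act_comp)
    also have "\<pi> \<circ> inv' \<pi> = id" using bij_is_surj[OF bij_H[OF \<pi>]] unfolding surj_iff .
    finally have qq: "var_act \<pi> ?q = q" by (simp only: var_act_id)
    have "conj_act \<G> \<phi> P g (pbw_elem i) s = \<phi> g (pbw_elem i (\<phi> (inv\<^bsub>\<G>\<^esub> g) (subst z q)))"
      using True q(2) by (simp add: conj_act_def restr_def)
    also have "\<phi> (inv\<^bsub>\<G>\<^esub> g) (subst z q) = subst z ?q" using g q(1) by blast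
    also have "pbw_elem i (subst z ?q) = subst z (pbw_op n i ?q)" by (rule pbw_elem_subst[OF q'])
    also have "\<phi> g (subst z (pbw_op n i ?q)) = subst z (var_act \<pi> (pbw_op n i ?q))" using g pbw_op_in by blast
    also have "var_act \<pi> (pbw_op n i ?q) = pbw_op n (idx_act n \<pi> i) q"
      unfolding var_act_pbw_op[OF perms[OF \<pi>]] qq ..
    also have "subst z (pbw_op n (idx_act n \<pi> i) q) = pbw_elem (idx_act n \<pi> i) s"
      by (simp add: q pbw_elem_subst)
    finally show ?thesis .
  next
    case False
    then show ?thesis by (simp add: conj_act_def restr_def pbw_elem_outside)
  qed
qed

lemma pbw_orbits_eq: "pbw_orbits \<G> \<phi> n z P = (`) pbw_elem ` iorb ` idxs n"
proof -
  have "orbit \<G> (conj_act \<G> \<phi> P) (pbw_elem i) = pbw_elem ` iorb i" for i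
  proof (intro equalityI subsetI)
    fix \<delta> assume "\<delta> \<in> orbit \<G> (conj_act \<G> \<phi> P) (pbw_elem i)"
    then obtain g where g: "g \<in> carrier \<G>" "\<delta> = conj_act \<G> \<phi> P g (pbw_elem i)" by (auto simp: orbit_def)
    obtain \<pi> where "\<pi> \<in> H" "\<delta> = pbw_elem (idx_act n \<pi> i)"
      using group_to_perm[OF g(1)] conj_act_pbw_elem g(2) by metis
    then show "\<delta> \<in> pbw_elem ` iorb i" unfolding iorb_def by blast
  next
    fix \<delta> assume "\<delta> \<in> pbw_elem ` iorb i"
    then obtain \<pi> where p: "\<pi> \<in> H" "\<delta> = pbw_elem (idx_act n \<pi> i)" unfolding iorb_def by blast
    obtain g where "g \<in> carrier \<G>" "conj_act \<G> \<phi> P g (pbw_elem i) = \<delta>"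
      using perm_to_group[OF p(1)] conj_act_pbw_elem[OF p(1)] p(2) by metis
    then show "\<delta> \<in> orbit \<G> (conj_act \<G> \<phi> P) (pbw_elem i)" by (auto simp: orbit_def)
  qed
  then have "(\<lambda>i. orbit \<G> (conj_act \<G> \<phi> P) (pbw_elem i)) ` idxs n = (\<lambda>i. pbw_elem ` iorb i) ` idxs n"
    by (intro image_cong refl)
  moreover have "pbw_orbits \<G> \<phi> n z P = (\<lambda>i. orbit \<G> (conj_act \<G> \<phi> P) (pbw_elem i)) ` idxs n"
    unfolding pbw_orbits_def orbits_def pbw_basis_eq by blast
  ultimately show ?thesis by (simp only: image_image)
qed

lemma restr_orbit_sum_subst:
  assumes B: "B \<in> iorb ` idxs n" and r: "r \<in> R"
  shows "restr_orbit_sum inv_ring (pbw_elem ` B) (subst z r) = subst z (\<Sum>i\<in>B. pbw_op n i r)"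
proof -
  have "B \<subseteq> idxs n" using B iorb_idxs by blast
  then have inj: "inj_on pbw_elem B" using inj_pbw_elem by (rule inj_on_subset[rotated])
  have "restr_orbit_sum inv_ring (pbw_elem ` B) (subst z r) = (\<Sum>i\<in>B. pbw_elem i (subst z r))"
    using r unfolding restr_orbit_sum_def restr_def inv_ring_def
    by (simp add: sum_fun_apply sum.reindex[OF inj])
  also have "\<dots> = subst z (\<Sum>i\<in>B. pbw_op n i r)"
    using r R_sub by (simp add: hom_sum[OF hom_subst] pbw_elem_subst subset_iff)
  finally show ?thesis .
qed

lemma restr_orbit_sum_outside: "s \<notin> inv_ring \<Longrightarrow> restr_orbit_sum inv_ring A s = 0"
  by (simp add: restr_orbit_sum_def restr_def)

lemma inj_image_pbw_elem: "inj_on ((`) pbw_elem) (iorb ` idxs n)"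
proof (rule inj_onI)
  fix A B assume AB: "A \<in> iorb ` idxs n" "B \<in> iorb ` idxs n" "pbw_elem ` A = pbw_elem ` B"
  then have "A \<subseteq> idxs n" "B \<subseteq> idxs n" using iorb_idxs by blast+
  then show "A = B" using inj_on_image_eq_iff[OF inj_pbw_elem] AB(3) by blast
qed

lemma sum_orbit_sums_subst:
  assumes T: "T \<subseteq> iorb ` idxs n" and r: "r \<in> R"
  shows "(\<Sum>A\<in>(`) pbw_elem ` T. op_scale (u A) (restr_orbit_sum inv_ring A)) (subst z r) =
    subst z (\<Sum>B\<in>T. C (u (pbw_elem ` B)) * (\<Sum>i\<in>B. pbw_op n i r))"
proof -
  have inj: "inj_on ((`) pbw_elem) T" using inj_image_pbw_elem T by (rule inj_on_subset)
  have "(\<Sum>A\<in>(`) pbw_elem ` T. op_scale (u A) (restr_orbit_sum inv_ring A)) (subst z r) =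
      (\<Sum>B\<in>T. C (u (pbw_elem ` B)) * restr_orbit_sum inv_ring (pbw_elem ` B) (subst z r))"
    by (simp add: sum.reindex[OF inj] sum_fun_apply op_scale_def Const_eq_C)
  also have "\<dots> = (\<Sum>B\<in>T. C (u (pbw_elem ` B)) * subst z (\<Sum>i\<in>B. pbw_op n i r))"
    using T r by (intro sum.cong) (auto simp: restr_orbit_sum_subst)
  also have "\<dots> = subst z (\<Sum>B\<in>T. C (u (pbw_elem ` B)) * (\<Sum>i\<in>B. pbw_op n i r))"
    by (simp add: hom_sum[OF hom_subst] hom_mult[OF hom_subst])
  finally show ?thesis .
qed

text \<open>Transport of independence and spanning from \<open>k[x\<^sub>1,\<dots>,x\<^sub>n]\<close> to \<open>P\<close>.\<close>

theorem pbw_orbit_sums_basis: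
  "is_k_basis (restr_orbit_sum inv_ring) (pbw_orbits \<G> \<phi> n z P) (diff_ops inv_ring)"
proof (rule is_k_basisI)
  have inv: "subalg inv_ring" using iso_R by (rule alg_isoD)
  show "op.subspace (diff_ops inv_ring)" by (rule subspace_diff_ops[OF inv])
  show "restr_orbit_sum inv_ring ` pbw_orbits \<G> \<phi> n z P \<subseteq> diff_ops inv_ring"
  proof
    fix \<delta> assume "\<delta> \<in> restr_orbit_sum inv_ring ` pbw_orbits \<G> \<phi> n z P"
    then obtain B where B: "B \<in> iorb ` idxs n" "\<delta> = restr_orbit_sum inv_ring (pbw_elem ` B)"
      unfolding pbw_orbits_eq by blast
    have "\<delta> s = transport inv_ring (subst z) coord (restr R (\<lambda>r. \<Sum>i\<in>B. pbw_op n i r)) s" for s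
    proof (cases "s \<in> inv_ring")
      case True
      then obtain r where r: "r \<in> R" "s = subst z r" unfolding inv_ring_def by blast
      have "coord s = r" using r coord_subst R_sub by blast
      then show ?thesis using True r B by (simp add: restr_orbit_sum_subst transport_def restr_def)
    next
      case False
      then show ?thesis by (simp add: B(2) restr_orbit_sum_outside transport_def restr_def)
    qed
    then have "\<delta> = transport inv_ring (subst z) coord (restr R (\<lambda>r. \<Sum>i\<in>B. pbw_op n i r))" by (rule ext)
    then show "\<delta> \<in> diff_ops inv_ring"
      using transport_diff_ops[OF iso_R orbit_sum_diff_op[OF B(1)]] by (simp only:)
  qed
  show "\<forall>A\<in>T. u A = 0" if T: "finite T" "T \<subseteq> pbw_orbits \<G> \<phi> n z P"
    and 0: "(\<Sum>A\<in>T. op_scale (u A) (restr_orbit_sum inv_ring A)) = 0" for T u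
  proof -
    obtain T' where T': "T' \<subseteq> iorb ` idxs n" "finite T'" "T = (`) pbw_elem ` T'"
      using finite_subset_image[OF T(1), of "(`) pbw_elem" "iorb ` idxs n"] T(2) unfolding pbw_orbits_eq by blast
    have "u (pbw_elem ` B) = 0" if B: "B \<in> T'" for B
    proof (rule orbit_sums_independent[OF T'(2,1) _ B, where u = "\<lambda>B. u (pbw_elem ` B)"])
      fix r :: "'k mpoly" assume r: "r \<in> R"
      let ?q = "\<Sum>B\<in>T'. C (u (pbw_elem ` B)) * (\<Sum>i\<in>B. pbw_op n i r)"
      have "subst z ?q = 0" using sum_orbit_sums_subst[OF T'(1) r, of u] 0 unfolding T'(3) by simp
      moreover have "?q \<in> poly_ring n"
        by (intro subring_set_sum[OF subring_poly_ring] poly_ring_closed pbw_op_in)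
      ultimately show "?q = 0" using coord_subst[of ?q] coord_subst[of 0] hom_zero[OF hom_subst, of z]
        by (simp add: poly_ring_closed)
    qed
    then show ?thesis unfolding T'(3) by blast
  qed
  show "\<exists>T u. finite T \<and> T \<subseteq> pbw_orbits \<G> \<phi> n z P \<and> \<delta> = (\<Sum>A\<in>T. op_scale (u A) (restr_orbit_sum inv_ring A))"
    if d: "\<delta> \<in> diff_ops inv_ring" for \<delta>
  proof -
    have lin: "\<delta> \<in> lin_end inv_ring" using d diff_ops_lt_lin_end[OF inv] unfolding diff_ops_def by blast
    have "\<exists>T u. finite T \<and> T \<subseteq> iorb ` idxs n \<and>
      (\<forall>r\<in>R. transport R coord (subst z) \<delta> r = (\<Sum>B\<in>T. C (u B) * (\<Sum>i\<in>B. pbw_op n i r)))"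
      by (rule orbit_sums_span[OF transport_diff_ops[OF alg_iso_sym[OF iso_R] d]])
    then obtain T u where Tu: "finite T \<and> T \<subseteq> iorb ` idxs n \<and>
      (\<forall>r\<in>R. transport R coord (subst z) \<delta> r = (\<Sum>B\<in>T. C (u B) * (\<Sum>i\<in>B. pbw_op n i r)))"
      by (elim exE)
    note T = conjunct1[OF Tu] conjunct1[OF conjunct2[OF Tu]] conjunct2[OF conjunct2[OF Tu]]
    define v where "v A = u (the_inv_into (iorb ` idxs n) ((`) pbw_elem) A)" for A
    have v: "v (pbw_elem ` B) = u B" if "B \<in> T" for B
      unfolding v_def the_inv_into_f_f[OF inj_image_pbw_elem subsetD[OF T(2) that]] by (rule refl)
    have "\<delta> s = (\<Sum>A\<in>(`) pbw_elem ` T. op_scale (v A) (restr_orbit_sum inv_ring A)) s" for s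
    proof (cases "s \<in> inv_ring")
      case True
      then obtain r where r: "r \<in> R" "s = subst z r" unfolding inv_ring_def by blast
      have "\<delta> s \<in> inv_ring" by (rule lin_endD(1)[OF lin True])
      then have "\<delta> s = subst z (transport R coord (subst z) \<delta> r)"
        using r by (simp add: transport_def restr_def alg_isoD(6)[OF iso_R])
      also have "\<dots> = subst z (\<Sum>B\<in>T. C (v (pbw_elem ` B)) * (\<Sum>i\<in>B. pbw_op n i r))"
        unfolding bspec[OF T(3) r(1)] by (simp add: v)
      finally show ?thesis unfolding r(2) sum_orbit_sums_subst[OF T(2) r(1)] .
    next
      case False
      then show ?thesis
        by (simp add: lin_endD(2)[OF lin] sum_fun_apply op_scale_def restr_orbit_sum_outside)
    qed
    then have "\<delta> = (\<Sum>A\<in>(`) pbw_elem ` T. op_scale (v A) (restr_orbit_sum inv_ring A))" by (rule ext)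
    moreover have "(`) pbw_elem ` T \<subseteq> pbw_orbits \<G> \<phi> n z P" unfolding pbw_orbits_eq using T(2) by blast
    ultimately show ?thesis using T(1) by blast
  qed
qed

end

section \<open>Leading monomials and block-symmetric polynomials\<close>

text \<open>The polynomial has leading monomial \<open>m\<close>, with coefficient 1. The order on exponents is lexicographic with
\<open>x\<^sub>1 > x\<^sub>2 > \<dots>\<close>, and it is compatible with addition.\<close>

definition monic_at :: "'a::comm_ring_1 pol \<Rightarrow> (nat \<Rightarrow>\<^sub>0 nat) \<Rightarrow> bool" where
  "monic_at p m \<longleftrightarrow> (\<exists>p'. p = single m 1 + p' \<and> (\<forall>k\<in>keys p'. k < m))"

lemma lookup_C_mult: "lookup (C c * p) m = c * lookup p m"
  by (simp add: mult_map_scale_conv_mult[symmetric] Poly_Mapping.map.rep_eq when_def)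

lemma monic_at_one: "monic_at 1 0"
  unfolding monic_at_def by (intro exI[of _ 0]) simp

lemma monic_at_mult:
  assumes "monic_at p m" "monic_at q l"
  shows "monic_at (p * q) (m + l)"
proof -
  obtain p' q' where p: "p = single m 1 + p'" "\<forall>k\<in>keys p'. k < m"
    and q: "q = single l 1 + q'" "\<forall>k\<in>keys q'. k < l"
    using assms unfolding monic_at_def by blast
  have 1: "k < m + l" if k: "k \<in> keys (single m 1 * q')" for k
  proof -
    obtain a b where ab: "k = a + b" "a \<in> keys (single m (1::'a))" "b \<in> keys q'"
      using keys_mult[of "single m 1" q'] k by blast
    then have "a = m" by (simp split: if_splits)
    then show ?thesis using ab q(2) by (simp add: add_strict_left_mono)
  qed
  have 2: "k < m + l" if k: "k \<in> keys (p' * q)" for k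
  proof -
    obtain a b where ab: "k = a + b" "a \<in> keys p'" "b \<in> keys q"
      using keys_mult[of p' q] k by blast
    have "b \<le> l" using ab(3) q Poly_Mapping.keys_add[of "single l 1" q']
      by (auto split: if_splits dest!: subsetD)
    then show ?thesis using ab p(2) by (simp add: add_less_le_mono)
  qed
  have "p * q = single (m + l) 1 + (single m 1 * q' + p' * q)"
    by (simp add: p(1) q(1) algebra_simps mult_single)
  moreover have "\<forall>k\<in>keys (single m 1 * q' + p' * q). k < m + l"
    using Poly_Mapping.keys_add[of "single m 1 * q'" "p' * q"] 1 2 by blast
  ultimately show ?thesis unfolding monic_at_def by blast
qed

lemma monic_at_power: "monic_at p m \<Longrightarrow> monic_at (p ^ e) (\<Sum>j<e. m)"
proof (induction e)
  case (Suc e)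
  then show ?case using monic_at_mult[of p m "p ^ e" "\<Sum>j<e. m"] by (simp add: add.commute del: sum_constant)
qed (simp add: monic_at_one)

lemma monic_at_prod: "(\<And>i. i \<in> A \<Longrightarrow> monic_at (f i) (g i)) \<Longrightarrow> monic_at (\<Prod>i\<in>A. f i) (\<Sum>i\<in>A. g i)"
  by (induction A rule: infinite_finite_induct) (auto simp: monic_at_one intro: monic_at_mult)

lemma monic_at_lookup:
  assumes "monic_at p m"
  shows "lookup p m = 1" "k \<in> keys p \<Longrightarrow> k \<le> m" "m < k \<Longrightarrow> lookup p k = 0"
proof -
  obtain p' where p: "p = single m 1 + p'" "\<forall>k\<in>keys p'. k < m"
    using assms unfolding monic_at_def by blast
  have "m \<notin> keys p'" using p(2) by blast
  then show 1: "lookup p m = 1" by (simp add: p(1) lookup_add in_keys_iff)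
  show 2: "k \<le> m" if "k \<in> keys p" for k
    using that p Poly_Mapping.keys_add[of "single m 1" p'] by (auto split: if_splits dest!: subsetD)
  show "m < k \<Longrightarrow> lookup p k = 0" using 2[of k] by (metis in_keys_iff leD)
qed

lemma exponent_lessI:
  assumes "lookup m k < lookup m' k" "\<And>k'. k' < k \<Longrightarrow> lookup m k' = lookup m' k'"
  shows "m < (m' :: nat \<Rightarrow>\<^sub>0 nat)"
  unfolding less_poly_mapping.rep_eq less_fun_def using assms by blast

text \<open>The lexicographic order is well-founded in finitely many variables only.\<close>

lemma wf_inside: "wf {(m, m'). m < m' \<and> inside n m \<and> inside n m'}"
proof -
  let ?f = "\<lambda>m :: nat \<Rightarrow>\<^sub>0 nat. map (lookup m) [1..<Suc n]"
  have "{(m, m'). m < m' \<and> inside n m \<and> inside n m'} \<subseteq> inv_image (lexn less_than n) ?f"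
  proof clarify
    fix m m' :: "nat \<Rightarrow>\<^sub>0 nat" assume "m < m'" and m: "inside n m" "inside n m'"
    then obtain k where k: "lookup m k < lookup m' k"
      "\<And>k'. k' < k \<Longrightarrow> lookup m k' = lookup m' k'"
      unfolding less_poly_mapping.rep_eq less_fun_def by blast
    have "k \<in> keys m'" using k(1) by (simp add: in_keys_iff)
    then have "k \<in> {1..n}" using m(2) by blast
    then have "[1..<Suc n] = [1..<k] @ [k..<Suc n]" "[k..<Suc n] = k # [Suc k..<Suc n]"
      using upt_add_eq_append[of 1 k "Suc n - k"] upt_conv_Cons[of k "Suc n"] by simp_all
    then have split: "[1..<Suc n] = [1..<k] @ k # [Suc k..<Suc n]" by simp
    have "map (lookup m) [1..<k] = map (lookup m') [1..<k]" using k(2) by simp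
    then have "(?f m, ?f m') \<in> lexn less_than n"
      unfolding lexn_conv split map_append list.map using k(1) \<open>k \<in> {1..n}\<close> by fastforce
    then show "(m, m') \<in> inv_image (lexn less_than n) ?f" by simp
  qed
  then show ?thesis by (rule wf_subset[OF wf_inv_image[OF wf_lexn[OF wf_less_than]]])
qed

definition ind :: "nat set \<Rightarrow> nat \<Rightarrow>\<^sub>0 nat" where
  "ind B = (\<Sum>b\<in>B. single b 1)"

lemma lookup_ind: "finite B \<Longrightarrow> lookup (ind B) c = (if c \<in> B then 1 else 0)"
  by (simp add: ind_def lookup_sum lookup_single when_def)

lemma prod_X: "(\<Prod>i\<in>B. X i) = (single (ind B) 1 :: 'k::field mpoly)"
proof (induction B rule: infinite_finite_induct)
  case (insert b B)
  then show ?case by (simp add: X_def ind_def mult_single)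
qed (simp_all add: ind_def)

lemma elem_sym_eq: "elem_sym A j = (\<Sum>B | B \<subseteq> A \<and> card B = j. single (ind B) (1 :: 'k::field))"
  by (simp add: elem_sym_def prod_X)

lemma var_act_elem_sym:
  assumes "bij \<sigma>"
  shows "var_act \<sigma> (elem_sym A j) = (elem_sym (\<sigma> ` A) j :: 'k::field mpoly)"
proof -
  have inj: "inj_on \<sigma> B" for B using assms by (meson bij_is_inj inj_on_subset subset_UNIV)
  have "var_act \<sigma> (elem_sym A j) = (\<Sum>B | B \<subseteq> A \<and> card B = j. \<Prod>i\<in>B. X (\<sigma> i) :: 'k mpoly)"
    by (simp add: elem_sym_def hom_sum[OF hom_var_act] hom_prod[OF hom_var_act] X_eq_Var)
  also have "\<dots> = (\<Sum>B | B \<subseteq> A \<and> card B = j. \<Prod>i\<in>\<sigma> ` B. X i)"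
    by (simp add: prod.reindex[OF inj])
  also have "\<dots> = elem_sym (\<sigma> ` A) j" unfolding elem_sym_def
  proof (rule sum.reindex_bij_betw)
    show "bij_betw (image \<sigma>) {B. B \<subseteq> A \<and> card B = j} {B. B \<subseteq> \<sigma> ` A \<and> card B = j}"
      unfolding bij_betw_def
    proof (intro conjI equalityI subsetI)
      show "inj_on (image \<sigma>) {B. B \<subseteq> A \<and> card B = j}"
        by (rule inj_onI) (simp add: inj_image_eq_iff[OF bij_is_inj[OF assms]])
    next
      fix B assume B: "B \<in> {B. B \<subseteq> \<sigma> ` A \<and> card B = j}"
      then have "B \<subseteq> \<sigma> ` A" by blast
      then obtain B' where B': "B' \<subseteq> A" "B = \<sigma> ` B'" by (rule subset_imageE)
      have "card B' = j" using B B'(2) card_image[OF inj[of B']] by simp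
      then show "B \<in> image \<sigma> ` {B. B \<subseteq> A \<and> card B = j}" using B' by blast
    next
      fix B assume "B \<in> image \<sigma> ` {B. B \<subseteq> A \<and> card B = j}"
      then obtain B' where "B' \<subseteq> A" "card B' = j" "B = \<sigma> ` B'" by blast
      then show "B \<in> {B. B \<subseteq> \<sigma> ` A \<and> card B = j}" using card_image[OF inj[of B']] by blast
    qed
  qed
  finally show ?thesis .
qed

text \<open>A partition of \<open>{1..n}\<close>; \<open>cl a\<close> is the block of \<open>a\<close>. The invariants of the product of the symmetric groups of the blocks are
determined here for all partitions at once.\<close>

locale blocks =
  fixes n :: nat and cl :: "nat \<Rightarrow> nat set"
  assumes cl_self: "a \<in> {1..n} \<Longrightarrow> a \<in> cl a"
    and cl_sub: "a \<in> {1..n} \<Longrightarrow> cl a \<subseteq> {1..n}"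
    and cl_eq: "a \<in> {1..n} \<Longrightarrow> b \<in> cl a \<Longrightarrow> cl b = cl a"
begin

definition stab :: "(nat \<Rightarrow> nat) set" where
  "stab = {\<sigma>. \<sigma> permutes {1..n} \<and> (\<forall>a\<in>{1..n}. \<sigma> a \<in> cl a)}"

definition below :: "nat \<Rightarrow> nat set" where
  "below a = {b \<in> cl a. b \<le> a}"

definition rank :: "nat \<Rightarrow> nat" where
  "rank a = card (below a)"

text \<open>The elementary symmetric polynomials of the blocks, indexed by the elements of the blocks: the \<open>j\<close>-th element of a block stands
for the polynomial of degree \<open>j\<close>.\<close>

definition E :: "nat \<Rightarrow> 'k::field mpoly" where
  "E a = elem_sym (cl a) (rank a)"

lemma finite_cl: "a \<in> {1..n} \<Longrightarrow> finite (cl a)"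
  using cl_sub finite_subset by blast

lemma finite_below: "a \<in> {1..n} \<Longrightarrow> finite (below a)"
  using finite_cl by (simp add: below_def)

lemma rank_less:
  assumes "a \<in> {1..n}" "b \<in> cl a" "a < b"
  shows "rank a < rank b"
proof -
  have b: "b \<in> {1..n}" "cl b = cl a" using assms cl_sub cl_eq by blast+
  have "below a \<subseteq> below b" using assms b(2) by (auto simp: below_def)
  moreover have "b \<in> below b" "b \<notin> below a" using assms cl_self[OF b(1)] by (auto simp: below_def)
  ultimately have "below a \<subset> below b" by blast
  then show ?thesis unfolding rank_def by (rule psubset_card_mono[OF finite_below[OF b(1)]])
qed

lemma rank_bij:
  assumes "a \<in> {1..n}"
  shows "bij_betw rank (cl a) {1..card (cl a)}"
proof -
  have *: "x \<in> {1..n}" "cl x = cl a" if "x \<in> cl a" for x using that assms cl_sub cl_eq by blast+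
  have inj: "inj_on rank (cl a)"
  proof (rule inj_onI)
    fix x y assume xy: "x \<in> cl a" "y \<in> cl a" "rank x = rank y"
    then show "x = y" using rank_less[of x y] rank_less[of y x] * by (metis less_irrefl linorder_neqE_nat)
  qed
  have "rank ` cl a \<subseteq> {1..card (cl a)}"
  proof
    fix r assume "r \<in> rank ` cl a"
    then obtain x where x: "x \<in> cl a" "r = rank x" by blast
    have "below x \<subseteq> cl a" using *[OF x(1)] by (auto simp: below_def)
    then have "r \<le> card (cl a)" using finite_cl[OF assms] x(2) by (simp add: rank_def card_mono)
    moreover have "x \<in> below x" using cl_self *[OF x(1)] by (auto simp: below_def)
    then have "r \<noteq> 0" using x(2) finite_below[OF *(1)[OF x(1)]] by (auto simp: rank_def)
    ultimately show "r \<in> {1..card (cl a)}" by simp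
  qed
  moreover have "card (rank ` cl a) = card {1..card (cl a)}" by (simp add: card_image[OF inj])
  ultimately have "rank ` cl a = {1..card (cl a)}" by (simp add: card_subset_eq)
  then show ?thesis using inj by (simp add: bij_betw_def)
qed

text \<open>Among the \<open>j\<close>-element subsets of a block, the set of the \<open>j\<close> smallest elements gives the lexicographically largest
monomial.\<close>

lemma monic_at_E:
  assumes a: "a \<in> {1..n}"
  shows "monic_at (E a :: 'k::field mpoly) (ind (below a))"
proof -
  let ?S = "{B. B \<subseteq> cl a \<and> card B = rank a}"
  have fin: "finite ?S" using finite_cl[OF a] by simp
  have mem: "below a \<in> ?S" by (auto simp: below_def rank_def)
  have "E a = single (ind (below a)) 1 + (\<Sum>B\<in>?S - {below a}. single (ind B) (1::'k))"
    unfolding E_def elem_sym_eq by (rule sum.remove[OF fin mem])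
  moreover have "k < ind (below a)"
    if k: "k \<in> keys (\<Sum>B\<in>?S - {below a}. single (ind B) (1::'k))" for k
  proof -
    have "k \<in> (\<Union>B\<in>?S - {below a}. keys (single (ind B) (1::'k)))"
      using k keys_sum[of "\<lambda>B. single (ind B) (1::'k)" "?S - {below a}"] by blast
    then obtain B where B: "B \<subseteq> cl a" "card B = rank a" "B \<noteq> below a" "k = ind B" by (auto split: if_splits)
    have finB: "finite B" using B(1) finite_cl[OF a] finite_subset by blast
    have ne: "below a - B \<noteq> {}"
    proof
      assume "below a - B = {}"
      then have "below a \<subseteq> B" by blast
      then have "below a = B" using B(2) finB by (simp add: card_subset_eq rank_def)
      then show False using B(3) by simp
    qed
    define c where "c = Min (below a - B)"
    have c: "c \<in> below a" "c \<notin> B" using Min_in[OF _ ne] finite_below[OF a] by (auto simp: c_def)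
    have "ind B < ind (below a)"
    proof (rule exponent_lessI[of _ c])
      show "lookup (ind B) c < lookup (ind (below a)) c"
        using c by (simp add: lookup_ind finB finite_below[OF a])
      fix d assume d: "d < c"
      have "d \<notin> below a - B"
      proof
        assume "d \<in> below a - B"
        then have "c \<le> d" unfolding c_def using finite_below[OF a] by (intro Min_le) auto
        then show False using d by simp
      qed
      moreover have "d \<in> below a" if "d \<in> B" using that B(1) d c(1) by (auto simp: below_def)
      ultimately show "lookup (ind B) d = lookup (ind (below a)) d"
        by (auto simp: lookup_ind finB finite_below[OF a])
    qed
    then show ?thesis by (simp only: B(4))
  qed
  ultimately show ?thesis unfolding monic_at_def by blast
qed

text \<open>The leading monomial of \<open>\<Prod>E\<^sub>i\<^bsup>m\<^sub>i\<^esup>\<close>. Its exponent at \<open>c\<close> is the sum of the \<open>m\<^sub>i\<close> with \<open>i \<ge> c\<close> in the block of \<open>c\<close>.\<close>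

definition LM :: "(nat \<Rightarrow>\<^sub>0 nat) \<Rightarrow> nat \<Rightarrow>\<^sub>0 nat" where
  "LM m = (\<Sum>i=1..n. \<Sum>j<lookup m i. ind (below i))"

lemma monic_at_monomial_E:
  assumes m: "inside n m"
  shows "monic_at (monomial E m :: 'k::field mpoly) (LM m)"
proof -
  have "monomial E m = (\<Prod>i=1..n. (E i :: 'k mpoly) ^ lookup m i)"
    by (rule monomial_superset) (use m in auto)
  moreover have "monic_at (\<Prod>i=1..n. (E i :: 'k mpoly) ^ lookup m i) (LM m)"
    unfolding LM_def by (intro monic_at_prod monic_at_power monic_at_E)
  ultimately show ?thesis by simp
qed

definition above :: "nat \<Rightarrow> nat set" where
  "above c = {i \<in> cl c. c \<le> i}"

lemma lookup_LM:
  assumes c: "c \<in> {1..n}"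
  shows "lookup (LM m) c = (\<Sum>i\<in>above c. lookup m i)"
proof -
  have "lookup (LM m) c = (\<Sum>i=1..n. if c \<in> below i then lookup m i else 0)"
    unfolding LM_def lookup_sum by (rule sum.cong) (auto simp: lookup_ind finite_below)
  also have "\<dots> = (\<Sum>i\<in>{i \<in> {1..n}. c \<in> below i}. lookup m i)"
    by (rule sum.inter_filter[symmetric]) simp
  also have "{i \<in> {1..n}. c \<in> below i} = above c"
  proof (intro equalityI subsetI)
    fix i assume "i \<in> {i \<in> {1..n}. c \<in> below i}"
    then show "i \<in> above c" using cl_eq[of i c] cl_self[of i] by (auto simp: below_def above_def)
  next
    fix i assume i: "i \<in> above c"
    then have "i \<in> {1..n}" "cl i = cl c" using cl_sub[OF c] cl_eq[OF c] by (auto simp: above_def)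
    then show "i \<in> {i \<in> {1..n}. c \<in> below i}" using i cl_self[OF c] by (auto simp: below_def above_def)
  qed
  finally show ?thesis .
qed

lemma LM_inside: "inside n (LM m)"
proof -
  have "lookup (LM m) c = 0" if c: "c \<notin> {1..n}" for c
    unfolding LM_def lookup_sum
  proof (intro sum.neutral ballI)
    fix i j assume i: "i \<in> {1..n}"
    have "c \<notin> below i" using cl_sub[OF i] c by (auto simp: below_def)
    then show "lookup (ind (below i)) c = 0" by (simp add: lookup_ind finite_below[OF i])
  qed
  then show ?thesis by (metis in_keys_iff subsetI)
qed

lemma above_split:
  assumes c: "c \<in> {1..n}"
  shows "above c = insert c (above c - {c})" "finite (above c)"
  using cl_self[OF c] finite_cl[OF c] by (auto simp: above_def)

text \<open>At the largest index where \<open>m\<close> and \<open>m'\<close> differ, the sums of the exponents above differ as well.\<close>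

lemma LM_inj:
  assumes m: "inside n m" "inside n m'" and eq: "LM m = LM m'"
  shows "m = m'"
proof (rule ccontr)
  assume "m \<noteq> m'"
  define D where "D = {i \<in> {1..n}. lookup m i \<noteq> lookup m' i}"
  have "D \<noteq> {}"
  proof
    assume "D = {}"
    then have D: "i \<notin> D" for i by blast
    have "lookup m i = lookup m' i" for i
    proof (cases "i \<in> {1..n}")
      case True
      then show ?thesis using D[of i] by (simp add: D_def)
    next
      case False
      then have "i \<notin> keys m" "i \<notin> keys m'" using m by blast+
      then show ?thesis by (simp add: in_keys_iff)
    qed
    then have "m = m'" by (rule poly_mapping_eqI)
    then show False using \<open>m \<noteq> m'\<close> by blast
  qed
  \<comment> \<open>The exponents of \<open>m\<close> and \<open>m'\<close> agree above \<open>c\<close>, so the sums in question differ only in the term at \<open>c\<close>.\<close>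
  define c where "c = Max D"
  have "finite D" by (simp add: D_def)
  then have c: "c \<in> D" unfolding c_def using \<open>D \<noteq> {}\<close> by (rule Max_in)
  then have c1: "c \<in> {1..n}" by (simp add: D_def)
  have "lookup m i = lookup m' i" if "i \<in> above c - {c}" for i
  proof (rule ccontr)
    assume *: "lookup m i \<noteq> lookup m' i"
    have "i \<in> {1..n}" using that cl_sub[OF c1] by (auto simp: above_def)
    then have "i \<in> D" using * by (simp add: D_def)
    then have "i \<le> c" unfolding c_def using \<open>finite D\<close> by (simp add: Max_ge)
    moreover have "c \<le> i" "i \<noteq> c" using that unfolding above_def by blast+
    ultimately show False by linarith
  qed
  then have rest: "(\<Sum>i\<in>above c - {c}. lookup m i) = (\<Sum>i\<in>above c - {c}. lookup m' i)"
    by (intro sum.cong) auto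
  have ca: "c \<in> above c" using above_split(1)[OF c1] by blast
  have "(\<Sum>i\<in>above c. lookup m i) = (\<Sum>i\<in>above c. lookup m' i)"
    using eq lookup_LM[OF c1] by metis
  then have "lookup m c = lookup m' c"
    unfolding sum.remove[OF above_split(2)[OF c1] ca] rest by simp
  then show False using c by (simp add: D_def)
qed

text \<open>Take for \<open>m\<^sub>c\<close> the difference of the exponents \<open>k\<close> at \<open>c\<close> and at the next element of the block.\<close>

lemma LM_surj:
  assumes k: "inside n k" and dec: "\<And>a b. a \<in> {1..n} \<Longrightarrow> b \<in> cl a \<Longrightarrow> a < b \<Longrightarrow> lookup k b \<le> lookup k a"
  shows "\<exists>m. inside n m \<and> LM m = k"
proof -
  define next_val where "next_val c = (if above c - {c} = {} then 0 else lookup k (Min (above c - {c})))" for c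
  define m where "m = expo n (\<lambda>c. lookup k c - next_val c)"
  have sum: "(\<Sum>i\<in>above c. lookup m i) = lookup k c" if "c \<in> {1..n}" for c
    using that
  proof (induction "n - c" arbitrary: c rule: less_induct)
    case less
    note c = less.prems
    have ca: "c \<in> above c" using above_split(1)[OF c] by blast
    have mc: "lookup m c = lookup k c - next_val c" using c by (simp add: m_def lookup_expo)
    have *: "(\<Sum>i\<in>above c. lookup m i) = lookup m c + (\<Sum>i\<in>above c - {c}. lookup m i)"
      by (rule sum.remove[OF above_split(2)[OF c] ca])
    show ?case
    proof (cases "above c - {c} = {}")
      case True
      then have "next_val c = 0" by (simp add: next_val_def)
      then show ?thesis using * mc by (simp only: True sum.empty)
    next
      case False
      define d where "d = Min (above c - {c})"
      have fin: "finite (above c - {c})" using above_split(2)[OF c] by simp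
      have d: "d \<in> above c - {c}" unfolding d_def by (rule Min_in[OF fin False])
      then have d1: "d \<in> cl c" "c < d" by (auto simp: above_def)
      then have d2: "d \<in> {1..n}" "cl d = cl c" using cl_sub[OF c] cl_eq[OF c] by auto
      have "above c - {c} = above d"
      proof (intro equalityI subsetI)
        fix i assume i: "i \<in> above c - {c}"
        then have "d \<le> i" unfolding d_def by (rule Min_le[OF fin])
        then show "i \<in> above d" using i d2 by (simp add: above_def)
      qed (use d1 d2 in \<open>auto simp: above_def\<close>)
      moreover have "(\<Sum>i\<in>above d. lookup m i) = lookup k d"
        using d1 d2(1) by (intro less.hyps) auto
      moreover have "next_val c = lookup k d" using False by (simp add: next_val_def d_def)
      moreover have "lookup k d \<le> lookup k c" by (rule dec[OF c d1])
      ultimately show ?thesis using * mc by simp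
    qed
  qed
  have "LM m = k"
  proof (rule poly_mapping_eqI)
    fix c
    show "lookup (LM m) c = lookup k c"
    proof (cases "c \<in> {1..n}")
      case True
      then show ?thesis using lookup_LM sum by simp
    next
      case False
      then have "c \<notin> keys (LM m)" "c \<notin> keys k" using LM_inside k by blast+
      then show ?thesis by (simp add: in_keys_iff)
    qed
  qed
  then show ?thesis using inside_expo unfolding m_def by blast
qed

lemma E_inj: "inj_on (E :: nat \<Rightarrow> 'k::field mpoly) {1..n}"
proof (rule inj_onI)
  fix a b assume ab: "a \<in> {1..n}" "b \<in> {1..n}" and eq: "E a = (E b :: 'k mpoly)"
  have le: "ind (below a) \<le> ind (below b)"
    if "monic_at (E b :: 'k mpoly) (ind (below a))" "monic_at (E b :: 'k mpoly) (ind (below b))" for a b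
    using monic_at_lookup(2)[OF that(2), of "ind (below a)"] monic_at_lookup(1)[OF that(1)] by (simp add: in_keys_iff)
  have "monic_at (E b :: 'k mpoly) (ind (below a))" "monic_at (E b :: 'k mpoly) (ind (below b))"
    using monic_at_E[OF ab(1), where 'k = 'k] monic_at_E[OF ab(2), where 'k = 'k] eq by simp_all
  then have "ind (below a) = ind (below b)"
    using monic_at_lookup(1,2) by (metis antisym in_keys_iff zero_neq_one)
  then have "c \<in> below a \<longleftrightarrow> c \<in> below b" for c
    using lookup_ind[OF finite_below[OF ab(1)], of c] lookup_ind[OF finite_below[OF ab(2)], of c]
    by (metis zero_neq_one)
  then show "a = b" using cl_self ab by (auto simp: below_def intro: antisym)
qed

abbreviation T :: "'k::field mpoly set" where
  "T \<equiv> ring_of_invariants stab (poly_ring n)"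

lemma T_iff: "p \<in> T \<longleftrightarrow> p \<in> poly_ring n \<and> (\<forall>\<sigma>\<in>stab. var_act \<sigma> p = p)"
  by (simp add: ring_of_invariants_def perm_act_eq_var_act)

lemma subalg_T: "subalg (T :: 'k::field mpoly set)"
  unfolding subalg_def subring_set_def
  by (auto simp: T_iff poly_ring_closed hom_simps[OF hom_var_act])

lemma stab_image_cl:
  assumes "\<sigma> \<in> stab" "a \<in> {1..n}"
  shows "\<sigma> ` cl a = cl a"
proof (rule card_subset_eq[OF finite_cl[OF assms(2)]])
  have p: "\<sigma> permutes {1..n}" using assms(1) by (simp add: stab_def)
  show "\<sigma> ` cl a \<subseteq> cl a"
  proof
    fix y assume "y \<in> \<sigma> ` cl a"
    then obtain x where x: "x \<in> cl a" "y = \<sigma> x" by blast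
    then have "x \<in> {1..n}" "cl x = cl a" using cl_sub[OF assms(2)] cl_eq[OF assms(2)] by auto
    then show "y \<in> cl a" using assms(1) x(2) by (auto simp: stab_def)
  qed
  show "card (\<sigma> ` cl a) = card (cl a)" using permutes_inj_on[OF p] by (rule card_image)
qed

lemma E_in_T:
  assumes a: "a \<in> {1..n}"
  shows "E a \<in> (T :: 'k::field mpoly set)"
  unfolding T_iff
proof (intro conjI ballI)
  have X_in: "X i \<in> (poly_ring n :: 'k mpoly set)" if "i \<in> cl a" for i
    using that cl_sub[OF a] Var_in_poly_ring unfolding X_eq_Var by blast
  have "(\<Prod>i\<in>B. X i) \<in> (poly_ring n :: 'k mpoly set)" if "B \<subseteq> cl a" for B
    using finite_subset[OF that finite_cl[OF a]] that
    by (induction B rule: finite_induct) (auto simp: poly_ring_closed X_in)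
  then show "(E a :: 'k mpoly) \<in> poly_ring n"
    unfolding E_def elem_sym_def by (intro subring_set_sum[OF subring_poly_ring]) auto
  fix \<sigma> assume s: "\<sigma> \<in> stab"
  then have "bij \<sigma>" by (auto simp: stab_def dest: permutes_bij)
  then show "var_act \<sigma> (E a :: 'k mpoly) = E a" by (simp add: E_def var_act_elem_sym stab_image_cl[OF s a])
qed

lemma monomial_E_in_T:
  assumes "inside n m"
  shows "monomial E m \<in> (T :: 'k::field mpoly set)"
proof -
  have S: "subring_set (T :: 'k mpoly set)" using subalg_T[where 'k = 'k] by (simp add: subalg_def)
  have "(\<Prod>i\<in>A. E i ^ lookup m i) \<in> (T :: 'k mpoly set)" if "A \<subseteq> {1..n}" for A
    using finite_subset[OF that finite_atLeastAtMost] that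
    by (induction A rule: finite_induct) (auto intro!: subring_setD[OF S] subring_set_power[OF S] E_in_T)
  then show ?thesis unfolding monomial_def using assms by blast
qed

lemma subst_in_T:
  assumes "q \<in> poly_ring n"
  shows "subst E q \<in> (T :: 'k::field mpoly set)"
proof -
  have S: "subring_set (T :: 'k mpoly set)" using subalg_T[where 'k = 'k] by (simp add: subalg_def)
  show ?thesis
    unfolding subst_eq_eval_hom eval_hom_def
  proof (intro subring_set_sum[OF S] subring_setD(5)[OF S] subalgD(3)[OF subalg_T] monomial_E_in_T)
    show "inside n m" if "m \<in> keys q" for m using that assms by (simp add: poly_ring_def)
  qed
qed

text \<open>The products of the \<open>E\<^sub>i\<close> have pairwise different leading monomials, so the largest of these cannot cancel.\<close>

lemma subst_E_nonzero:
  assumes q: "q \<in> poly_ring n" "q \<noteq> 0"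
  shows "subst E q \<noteq> (0 :: 'k::field mpoly)"
proof
  assume 0: "subst E q = 0"
  have ins: "inside n k" if "k \<in> keys q" for k using q(1) that by (simp add: poly_ring_def)
  have ne: "LM ` keys q \<noteq> {}" using q(2) by simp
  define M where "M = Max (LM ` keys q)"
  have "M \<in> LM ` keys q" unfolding M_def by (rule Max_in[OF _ ne]) simp
  then obtain k where k: "k \<in> keys q" "M = LM k" by blast
  have "lookup (subst E q) M = (\<Sum>j\<in>keys q. if j = k then lookup q k else 0)"
    unfolding subst_eq_eval_hom eval_hom_def lookup_sum
  proof (rule sum.cong[OF refl])
    fix j assume j: "j \<in> keys q"
    have mon: "monic_at (monomial E j :: 'k mpoly) (LM j)" by (rule monic_at_monomial_E[OF ins[OF j]])
    show "lookup (C (lookup q j) * monomial E j) M = (if j = k then lookup q k else 0)"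
    proof (cases "j = k")
      case True
      then show ?thesis using monic_at_lookup(1)[OF mon] k(2) by (simp add: lookup_C_mult)
    next
      case False
      then have "LM j \<noteq> LM k" using LM_inj ins j k(1) by blast
      moreover have "LM j \<le> M" unfolding M_def using j by (intro Max_ge) auto
      ultimately have "LM j < M" using k(2) by simp
      then show ?thesis using monic_at_lookup(3)[OF mon] False by (simp add: lookup_C_mult)
    qed
  qed
  also have "\<dots> = lookup q k" using k(1) by simp
  finally have "lookup q k = 0" using 0 by simp
  then show False using k(1) by (simp add: in_keys_iff)
qed

text \<open>Otherwise exchanging \<open>a\<close> and \<open>b\<close> would give a larger monomial of the invariant \<open>p\<close>.\<close>

lemma T_leading_decreasing:
  assumes p: "p \<in> (T :: 'k::field mpoly set)" "p \<noteq> 0" and a: "a \<in> {1..n}" "b \<in> cl a" "a < b"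
  shows "lookup (Max (keys p)) b \<le> lookup (Max (keys p)) a"
proof (rule ccontr)
  define m where "m = Max (keys p)"
  assume "\<not> ?thesis"
  then have less: "lookup m a < lookup m b" by (simp add: m_def)
  have m: "m \<in> keys p" unfolding m_def by (rule Max_in) (use p(2) in auto)
  let ?t = "swap a b"
  have b: "b \<in> {1..n}" "cl b = cl a" using a cl_sub cl_eq by blast+
  have "?t \<in> stab" unfolding stab_def
    using a b cl_self by (auto simp: Transposition.transpose_def intro: permutes_swap_id)
  then have "var_act ?t p = p" using p(1) by (simp add: T_iff)
  then have "lookup p (exp_act ?t m) = lookup p m"
    using lookup_var_act[of ?t p m] by simp
  then have "exp_act ?t m \<in> keys p" using m by (simp add: in_keys_iff)
  then have "exp_act ?t m \<le> m" unfolding m_def by (intro Max_ge) auto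
  moreover have "m < exp_act ?t m"
    by (rule exponent_lessI[of _ a]) (use less a(3) in \<open>simp_all add: lookup_exp_act Transposition.transpose_def\<close>)
  ultimately show False by simp
qed

text \<open>The leading monomial of an invariant is that of some product of the \<open>E\<^sub>i\<close>; subtract a multiple of the product and
use well-founded induction.\<close>

lemma subst_E_surj:
  assumes p: "p \<in> (T :: 'k::field mpoly set)"
  shows "\<exists>q\<in>poly_ring n. subst E q = p"
proof -
  have main: "\<forall>p\<in>(T :: 'k mpoly set). p \<noteq> 0 \<longrightarrow> Max (keys p) = m \<longrightarrow> (\<exists>q\<in>poly_ring n. subst E q = p)" for m
  proof (induction m rule: wf_induct_rule[OF wf_inside[of n]])
    case (1 m)
    show ?case
    proof (intro ballI impI)
      fix p :: "'k mpoly" assume p: "p \<in> T" "p \<noteq> 0" "Max (keys p) = m"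
      have mk: "m \<in> keys p" unfolding p(3)[symmetric] by (rule Max_in) (use p(2) in auto)
      have pin: "inside n j" if "j \<in> keys p" for j using p(1) that unfolding T_iff by (simp add: poly_ring_def)
      obtain k where k: "inside n k" "LM k = m"
        using LM_surj[OF pin[OF mk]] T_leading_decreasing[OF p(1,2)] p(3) by blast
      define c where "c = lookup p m"
      define p' where "p' = p - C c * monomial E k"
      have mon: "monic_at (monomial E k :: 'k mpoly) m" using monic_at_monomial_E[OF k(1)] k(2) by simp
      have p'T: "p' \<in> T" unfolding p'_def
        using subalgD(7)[OF subalg_T p(1) subalgD(5)[OF subalg_T subalgD(3)[OF subalg_T] monomial_E_in_T[OF k(1)]]] .
      have small: "j < m" if j: "j \<in> keys p'" for j
      proof -
        have lj: "lookup p' j = lookup p j - c * lookup (monomial E k) j"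
          by (simp add: p'_def lookup_minus lookup_C_mult)
        have "j \<noteq> m" using j lj monic_at_lookup(1)[OF mon] by (auto simp: in_keys_iff c_def)
        moreover have "j \<le> m"
        proof (cases "j \<in> keys p")
          case True
          then show ?thesis unfolding p(3)[symmetric] by (intro Max_ge) auto
        next
          case False
          then have "j \<in> keys (monomial E k :: 'k mpoly)" using j lj by (auto simp: in_keys_iff)
          then show ?thesis by (rule monic_at_lookup(2)[OF mon])
        qed
        ultimately show ?thesis by simp
      qed
      have "\<exists>q'\<in>poly_ring n. subst E q' = p'"
      proof (cases "p' = 0")
        case True
        then show ?thesis using poly_ring_closed(1) hom_zero[OF hom_subst] by blast
      next
        case False
        let ?m = "Max (keys p')"
        have mem: "?m \<in> keys p'" by (rule Max_in) (use False in auto)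
        have "inside n ?m" using p'T mem unfolding T_iff by (simp add: poly_ring_def)
        then have "(?m, m) \<in> {(m, m'). m < m' \<and> inside n m \<and> inside n m'}"
          using small[OF mem] pin[OF mk] by simp
        from bspec[OF 1[OF this] p'T] False show ?thesis by simp
      qed
      then obtain q' where q': "q' \<in> poly_ring n" "subst E q' = p'" by blast
      have "subst E (q' + single k c) = p"
        unfolding hom_add[OF hom_subst] q'(2) p'_def
        by (simp add: subst_eq_eval_hom eval_hom_single[OF hom_single])
      moreover have "q' + single k c \<in> poly_ring n"
        using q'(1) k(1) by (intro poly_ring_closed) (auto simp: poly_ring_def)
      ultimately show "\<exists>q\<in>poly_ring n. subst E q = p" by blast
    qed
  qed
  show ?thesis
  proof (cases "p = 0")
    case True
    then show ?thesis using poly_ring_closed(1) hom_zero[OF hom_subst] by blast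
  next
    case False
    then show ?thesis using main p by blast
  qed
qed

theorem is_poly_ring_on_E: "is_poly_ring_on n E (T :: 'k::field mpoly set)"
  unfolding is_poly_ring_on_def bij_betw_def
proof
  show "inj_on (subst E) (poly_ring n :: 'k mpoly set)"
  proof (rule inj_onI, rule ccontr)
    fix p q :: "'k mpoly" assume pq: "p \<in> poly_ring n" "q \<in> poly_ring n" "subst E p = subst E q" "p \<noteq> q"
    have "subst E (p - q) \<noteq> 0"
      by (rule subst_E_nonzero[OF subalgD(7)[OF subalg_poly_ring pq(1,2)]]) (use pq(4) in simp)
    then show False by (simp add: hom_diff[OF hom_subst] pq(3))
  qed
  show "subst E ` poly_ring n = (T :: 'k mpoly set)"
    using subst_in_T subst_E_surj by blast
qed

end

section \<open>The subgroup generated by the transpositions\<close>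

lemma transpose_conj:
  assumes "bij g"
  shows "g \<circ> swap a b \<circ> inv' g = swap (g a) (g b)"
proof -
  have "swap (g a) (g b) \<circ> g = g \<circ> swap a b"
    using bij_is_inj[OF assms] by (auto simp: fun_eq_iff Transposition.transpose_def inj_eq)
  then have "g \<circ> swap a b \<circ> inv' g = swap (g a) (g b) \<circ> (g \<circ> inv' g)"
    by (simp only: o_assoc)
  also have "g \<circ> inv' g = id" using bij_is_surj[OF assms] unfolding surj_iff .
  finally show ?thesis by (simp only: comp_id)
qed

text \<open>The situation of the theorem: \<open>G\<close> is an arbitrary group of permutations.\<close>

locale perm_subgroup =
  fixes n :: nat and G :: "(nat \<Rightarrow> nat) set"
  assumes subgroup_G: "subgroup G (sym_group n)"
begin

lemma G_perm: "g \<in> G \<Longrightarrow> g permutes {1..n}"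
  using subgroup.subset[OF subgroup_G] sym_group_carrier by blast

lemma G_id: "id \<in> G"
  using subgroup.one_closed[OF subgroup_G] by (simp add: sym_group_one)

lemma G_comp: "g \<in> G \<Longrightarrow> h \<in> G \<Longrightarrow> g \<circ> h \<in> G"
  using subgroup.m_closed[OF subgroup_G, of g h] by (simp add: sym_group_mult)

lemma G_inv: "g \<in> G \<Longrightarrow> inv' g \<in> G"
  using subgroup.m_inv_closed[OF subgroup_G, of g] subgroup.mem_carrier[OF subgroup_G, of g] by simp

sublocale perm_set n G
  by unfold_locales (fact G_perm G_id G_comp G_inv)+

lemma group_G: "group (perm_group n G)"
  by (rule subgroup.subgroup_is_group[OF subgroup_G sym_group_is_group])

lemma inv_G: "g \<in> G \<Longrightarrow> inv\<^bsub>perm_group n G\<^esub> g = inv' g"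
  using group.m_inv_consistent[OF sym_group_is_group subgroup_G] subgroup.mem_carrier[OF subgroup_G, of g] by simp

text \<open>Being equal or exchanged by a transposition in \<open>G\<close> is an equivalence relation, since \<open>(a c) = (a b) (b c) (a b)\<close>.\<close>

definition block :: "nat \<Rightarrow> nat set" where
  "block a = {b. b = a \<or> (a \<in> {1..n} \<and> b \<in> {1..n} \<and> swap a b \<in> G)}"

lemma block_sym: "b \<in> block a \<Longrightarrow> a \<in> block b"
  by (auto simp: block_def transpose_commute)

lemma block_trans:
  assumes "b \<in> block a" "c \<in> block b"
  shows "c \<in> block a"
proof (cases "a = b \<or> b = c \<or> a = c")
  case False
  then have t: "swap a b \<in> G" "swap b c \<in> G" "a \<in> {1..n}" "c \<in> {1..n}"
    using assms by (auto simp: block_def)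
  have "swap a b \<circ> swap b c \<circ> swap a b \<in> G"
    using t by (intro G_comp)
  moreover have "swap a b \<circ> swap b c \<circ> swap a b = swap a c"
    using False by (auto simp: fun_eq_iff Transposition.transpose_def)
  ultimately show ?thesis using t by (simp add: block_def)
qed (use assms in \<open>auto simp: block_def\<close>)

sublocale blocks n block
proof
  fix a b assume "a \<in> {1..n}" "b \<in> block a"
  then show "block b = block a" using block_sym block_trans by blast
qed (auto simp: block_def)

definition N :: "(nat \<Rightarrow> nat) set" where
  "N = generate (sym_group n) (G \<inter> transpositions n)"

lemma transpose_in:
  assumes "a \<in> {1..n}" "b \<in> block a"
  shows "swap a b \<in> N"
proof (cases "a = b")
  case True
  then show ?thesis using generate.one[of "sym_group n"] by (simp add: N_def sym_group_one id_def)
next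
  case False
  then have "swap a b \<in> G \<inter> transpositions n" using assms by (auto simp: block_def transpositions_def)
  then show ?thesis unfolding N_def by (rule generate.incl)
qed

lemma N_comp: "\<sigma> \<in> N \<Longrightarrow> \<tau> \<in> N \<Longrightarrow> \<sigma> \<circ> \<tau> \<in> N"
  unfolding N_def using generate.eng[of \<sigma> "sym_group n" _ \<tau>] by (simp add: sym_group_mult)

lemma stab_comp: "\<sigma> \<in> stab \<Longrightarrow> \<tau> \<in> stab \<Longrightarrow> \<sigma> \<circ> \<tau> \<in> stab"
proof -
  assume s: "\<sigma> \<in> stab" "\<tau> \<in> stab"
  have "\<sigma> (\<tau> a) \<in> block a" if "a \<in> {1..n}" for a
  proof -
    have 1: "\<tau> a \<in> block a" using s that by (simp add: stab_def)
    then have "\<tau> a \<in> {1..n}" using cl_sub[OF that] by blast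
    then have "\<sigma> (\<tau> a) \<in> block (\<tau> a)" using s by (simp add: stab_def)
    then show ?thesis by (rule block_trans[OF 1])
  qed
  moreover have "\<sigma> \<circ> \<tau> permutes {1..n}" using s by (auto simp: stab_def intro: permutes_compose)
  ultimately show ?thesis by (simp add: stab_def)
qed

lemma transposition_in_stab:
  assumes "h \<in> G \<inter> transpositions n"
  shows "h \<in> stab"
proof -
  obtain a b where h: "h = swap a b" "a \<in> {1..n}" "b \<in> {1..n}" "h \<in> G"
    using assms by (auto simp: transpositions_def)
  have "h c \<in> block c" for c
    using h by (auto simp: block_def Transposition.transpose_def transpose_commute)
  then show ?thesis using G_perm[OF h(4)] by (simp add: stab_def)
qed

text \<open>The group generated by the transpositions contains every permutation that preserves the blocks: if \<open>\<sigma>\<close> moves \<open>a\<close>, the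
composition of \<open>\<sigma>\<close> with the transposition of \<open>a\<close> and \<open>\<sigma> a\<close> moves fewer points.\<close>

lemma N_eq_stab: "N = stab"
proof (intro equalityI subsetI)
  fix \<sigma> assume "\<sigma> \<in> N"
  then show "\<sigma> \<in> stab" unfolding N_def
  proof (induction rule: generate.induct)
    case one
    have "id permutes {1..n}" by (rule permutes_id)
    moreover have "\<forall>a\<in>{1..n}. id a \<in> block a" using cl_self by simp
    ultimately show ?case unfolding sym_group_one stab_def by blast
  next
    case (incl h)
    then show ?case by (rule transposition_in_stab)
  next
    case (inv h)
    then have "h \<in> carrier (sym_group n)" using G_perm by (auto simp: sym_group_carrier)
    moreover have "inv' h = h" using inv by (auto simp: transpositions_def)
    ultimately show ?case using transposition_in_stab[OF inv] by simp
  next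
    case (eng h1 h2)
    show ?case unfolding sym_group_mult by (rule stab_comp[OF eng.IH])
  qed
next
  fix \<sigma> assume "\<sigma> \<in> stab"
  then show "\<sigma> \<in> N"
  proof (induction "card {x \<in> {1..n}. \<sigma> x \<noteq> x}" arbitrary: \<sigma> rule: less_induct)
    case less
    have p: "\<sigma> permutes {1..n}" using less.prems by (simp add: stab_def)
    show ?case
    proof (cases "\<sigma> = id")
      case True
      then show ?thesis using generate.one[of "sym_group n"] by (simp add: N_def sym_group_one)
    next
      case False
      then obtain a where a: "\<sigma> a \<noteq> a" by (auto simp: fun_eq_iff)
      then have a1: "a \<in> {1..n}" using p by (metis permutes_not_in)
      then have blk: "\<sigma> a \<in> block a" using less.prems by (simp add: stab_def)
      let ?t = "swap a (\<sigma> a)"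
      have tN: "?t \<in> N" by (rule transpose_in[OF a1 blk])
      have "?t \<in> G \<inter> transpositions n"
      proof
        show "?t \<in> G" using blk a by (simp add: block_def)
        have "\<sigma> a \<in> {1..n}" using blk cl_sub[OF a1] by blast
        then show "?t \<in> transpositions n" unfolding transpositions_def using a1 a[symmetric] by blast
      qed
      then have ts: "?t \<circ> \<sigma> \<in> stab" using transposition_in_stab less.prems by (intro stab_comp)
      have "{x \<in> {1..n}. (?t \<circ> \<sigma>) x \<noteq> x} \<subset> {x \<in> {1..n}. \<sigma> x \<noteq> x}"
      proof
        show "{x \<in> {1..n}. (?t \<circ> \<sigma>) x \<noteq> x} \<subseteq> {x \<in> {1..n}. \<sigma> x \<noteq> x}"
        proof (clarify)
          fix x assume x: "(?t \<circ> \<sigma>) x \<noteq> x" "\<sigma> x = x"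
          have "x \<noteq> a" using a x(2) by auto
          moreover have "x \<noteq> \<sigma> a" using x(2) a permutes_inj[OF p] by (metis injD)
          ultimately show False using x by simp
        qed
        have "a \<in> {x \<in> {1..n}. \<sigma> x \<noteq> x}" "a \<notin> {x \<in> {1..n}. (?t \<circ> \<sigma>) x \<noteq> x}" using a a1 by simp_all
        then show "{x \<in> {1..n}. (?t \<circ> \<sigma>) x \<noteq> x} \<noteq> {x \<in> {1..n}. \<sigma> x \<noteq> x}" by blast
      qed
      then have "card {x \<in> {1..n}. (?t \<circ> \<sigma>) x \<noteq> x} < card {x \<in> {1..n}. \<sigma> x \<noteq> x}"
        by (intro psubset_card_mono) auto
      then have "?t \<circ> \<sigma> \<in> N" using ts by (rule less.hyps)
      then have "?t \<circ> (?t \<circ> \<sigma>) \<in> N" by (rule N_comp[OF tN])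
      then show ?thesis by (simp add: o_assoc)
    qed
  qed
qed

lemma N_sub_G: "N \<subseteq> G"
  unfolding N_def by (rule group.generate_subgroup_incl[OF sym_group_is_group _ subgroup_G]) blast

lemma block_image:
  assumes g: "g \<in> G" and a: "a \<in> {1..n}"
  shows "block (g a) = g ` block a"
proof -
  have 1: "h ` block b \<subseteq> block (h b)" if h: "h \<in> G" "b \<in> {1..n}" for h b
  proof clarify
    fix c assume c: "c \<in> block b"
    show "h c \<in> block (h b)"
    proof (cases "c = b")
      case False
      then have "swap b c \<in> G" "c \<in> {1..n}" using c by (auto simp: block_def)
      then have "swap (h b) (h c) \<in> G"
        unfolding transpose_conj[OF bij_H[OF h(1)], symmetric] using h(1) by (intro G_comp G_inv)
      then show ?thesis using image_in[OF h(1)] \<open>c \<in> {1..n}\<close> h(2) by (simp add: block_def)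
    qed (simp add: block_def)
  qed
  have bij: "bij g" by (rule bij_H[OF g])
  have "block (g a) \<subseteq> g ` block a"
  proof
    fix c assume c: "c \<in> block (g a)"
    have "inv' g ` block (g a) \<subseteq> block (inv' g (g a))"
      by (rule 1[OF G_inv[OF g] image_in[OF g a]])
    then have "inv' g c \<in> block a" using c bij by (auto simp: bij_is_inj)
    moreover have "c = g (inv' g c)" using bij by (simp add: bij_is_surj surj_f_inv_f)
    ultimately show "c \<in> g ` block a" by blast
  qed
  then show ?thesis using 1[OF g a] by blast
qed

text \<open>An element of the block of \<open>a\<close> is the image of \<open>a\<close> under a single transposition.\<close>

lemma orbits_N: "orbits (perm_group n N) {1..n} (\<lambda>\<sigma> i. \<sigma> i) = block ` {1..n}"
proof -
  have "orbit (perm_group n N) (\<lambda>\<sigma> i. \<sigma> i) a = block a" if a: "a \<in> {1..n}" for a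
  proof (intro equalityI subsetI)
    fix b assume "b \<in> orbit (perm_group n N) (\<lambda>\<sigma> i. \<sigma> i) a"
    then obtain \<sigma> where "\<sigma> \<in> N" "b = \<sigma> a" by (auto simp: orbit_def)
    then show "b \<in> block a" using a by (simp add: N_eq_stab stab_def)
  next
    fix b assume b: "b \<in> block a"
    have "swap a b \<in> N" by (rule transpose_in[OF a b])
    then show "b \<in> orbit (perm_group n N) (\<lambda>\<sigma> i. \<sigma> i) a" unfolding orbit_def
      by (auto intro!: exI[of _ "swap a b"])
  qed
  then show ?thesis unfolding orbits_def by blast
qed

lemma orbit_elem_syms_eq: "orbit_elem_syms n N = (E ` {1..n} :: 'k::field mpoly set)"
proof (intro equalityI subsetI)
  fix p :: "'k mpoly" assume "p \<in> orbit_elem_syms n N"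
  then obtain a j where a: "a \<in> {1..n}" "j \<in> {1..card (block a)}" "p = elem_sym (block a) j"
    unfolding orbit_elem_syms_def orbits_N by blast
  then have "j \<in> rank ` block a" using bij_betw_imp_surj_on[OF rank_bij[OF a(1)]] by simp
  then obtain b where b: "b \<in> block a" "j = rank b" by blast
  then have "p = E b" using cl_eq[OF a(1)] a(3) by (simp add: E_def)
  then show "p \<in> E ` {1..n}" using b cl_sub[OF a(1)] by blast
next
  fix p :: "'k mpoly" assume "p \<in> E ` {1..n}"
  then obtain a where a: "a \<in> {1..n}" "p = E a" by blast
  have "rank a \<in> {1..card (block a)}" using rank_bij[OF a(1)] cl_self[OF a(1)] by (auto simp: bij_betw_def)
  then show "p \<in> orbit_elem_syms n N" unfolding orbit_elem_syms_def orbits_N a(2) E_def using a(1) by blast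
qed

lemma bij_E: "bij_betw E {1..n} (orbit_elem_syms n N :: 'k::field mpoly set)"
  unfolding orbit_elem_syms_eq bij_betw_def using E_inj by blast

lemma subgroup_N: "subgroup N (perm_group n G)"
proof -
  have "subgroup N (sym_group n)" unfolding N_def
    by (rule group.generate_is_subgroup[OF sym_group_is_group]) (use subgroup.subset[OF subgroup_G] in blast)
  then show ?thesis by (rule group.subgroup_incl[OF sym_group_is_group _ subgroup_G N_sub_G])
qed

text \<open>Elements of \<open>G\<close> map blocks to blocks.\<close>

lemma N_conj:
  assumes g: "g \<in> G" and h: "h \<in> N"
  shows "g \<circ> h \<circ> inv' g \<in> N"
proof -
  have bij: "bij g" by (rule bij_H[OF g])
  have inG: "g \<circ> h \<circ> inv' g \<in> G" using g h N_sub_G by (intro G_comp G_inv) auto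
  have "g (h (inv' g a)) \<in> block a" if a: "a \<in> {1..n}" for a
  proof -
    let ?b = "inv' g a"
    have b: "?b \<in> {1..n}" by (rule image_in[OF G_inv[OF g] a])
    have "h ?b \<in> block ?b" using h b by (simp add: N_eq_stab stab_def)
    then have "g (h ?b) \<in> block (g ?b)" using block_image[OF g b] by blast
    then show ?thesis using bij by (simp add: bij_is_surj surj_f_inv_f)
  qed
  then show ?thesis using G_perm[OF inG] by (simp add: N_eq_stab stab_def)
qed

lemma normal_N: "N \<lhd> perm_group n G"
proof (rule group.normal_invI[OF group_G subgroup_N])
  fix g h assume "g \<in> carrier (perm_group n G)" "h \<in> N"
  then show "g \<otimes>\<^bsub>perm_group n G\<^esub> h \<otimes>\<^bsub>perm_group n G\<^esub> inv\<^bsub>perm_group n G\<^esub> g \<in> N"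
    using N_conj by (simp add: inv_G sym_group_mult)
qed

lemma perm_act_T:
  assumes g: "g \<in> G" and p: "p \<in> T"
  shows "var_act g p \<in> (T :: 'k::field mpoly set)"
  unfolding T_iff
proof (intro conjI ballI)
  show "var_act g p \<in> poly_ring n" using p by (intro var_act_poly_ring G_perm[OF g]) (simp add: T_iff)
  fix \<sigma> assume s: "\<sigma> \<in> stab"
  have bij: "bij g" by (rule bij_H[OF g])
  have "inv' g \<circ> \<sigma> \<circ> inv' (inv' g) \<in> stab"
    using N_conj[OF G_inv[OF g], of \<sigma>] s by (simp add: N_eq_stab)
  then have "var_act (inv' g \<circ> \<sigma> \<circ> g) p = p" using p by (simp add: T_iff inv_inv_eq[OF bij])
  then have "var_act (g \<circ> (inv' g \<circ> \<sigma> \<circ> g)) p = var_act g p" by (simp only: var_act_comp)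
  also have "g \<circ> (inv' g \<circ> \<sigma> \<circ> g) = (g \<circ> inv' g) \<circ> (\<sigma> \<circ> g)" by (simp only: o_assoc)
  also have "g \<circ> inv' g = id" using bij_is_surj[OF bij] unfolding surj_iff .
  finally show "var_act \<sigma> (var_act g p) = var_act g p" by (simp only: id_comp var_act_comp)
qed

text \<open>The image of an elementary symmetric polynomial of a block is the one of the same degree of the image block.\<close>

lemma var_act_E:
  assumes g: "g \<in> G" and a: "a \<in> {1..n}"
  obtains b where "b \<in> block (g a)" "rank b = rank a" "var_act g (E a) = (E b :: 'k::field mpoly)"
proof -
  have ga: "g a \<in> {1..n}" by (rule image_in[OF g a])
  have "card (block (g a)) = card (block a)"
    unfolding block_image[OF g a] by (rule card_image) (use G_perm[OF g] in \<open>rule permutes_inj_on\<close>)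
  then have "rank a \<in> {1..card (block (g a))}" using rank_bij[OF a] cl_self[OF a] by (auto simp: bij_betw_def)
  then have "rank a \<in> rank ` block (g a)" using bij_betw_imp_surj_on[OF rank_bij[OF ga]] by simp
  then obtain b where b: "b \<in> block (g a)" "rank b = rank a" by force
  have "var_act g (E a :: 'k mpoly) = elem_sym (block (g a)) (rank a)"
    by (simp add: E_def var_act_elem_sym[OF bij_H[OF g]] block_image[OF g a])
  also have "\<dots> = E b" using b cl_eq[OF ga b(1)] by (simp add: E_def)
  finally show ?thesis using that b by blast
qed

text \<open>If \<open>g\<close> exchanges \<open>E a\<close> and \<open>E b\<close>, then \<open>a\<close> and \<open>b\<close> have the same rank in different blocks, and \<open>g\<close> exchanges these
blocks. All other \<open>E c\<close> are fixed, so the two blocks contain no further elements, and \<open>g\<close> preserves the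
remaining blocks. Thus \<open>(a b) g\<close> preserves all blocks and lies in \<open>N\<close>, whence \<open>(a b)\<close> lies in \<open>G\<close>, a contradiction to \<open>a\<close>
and \<open>b\<close> being in different blocks.\<close>

lemma no_transposition_of_E:
  assumes g: "g \<in> G" and ab: "a \<in> {1..n}" "b \<in> {1..n}" "a \<noteq> b"
    and swap: "var_act g (E a) = (E b :: 'k::field mpoly)" "var_act g (E b) = (E a :: 'k mpoly)"
    and fixed: "\<And>c. c \<in> {1..n} \<Longrightarrow> c \<noteq> a \<Longrightarrow> c \<noteq> b \<Longrightarrow> var_act g (E c) = (E c :: 'k mpoly)"
  shows False
proof -
  have det: "y \<in> block (g x) \<and> rank y = rank x"
    if x: "x \<in> {1..n}" "y \<in> {1..n}" "var_act g (E x) = (E y :: 'k mpoly)" for x y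
  proof -
    obtain y' where y': "y' \<in> block (g x)" "rank y' = rank x" "var_act g (E x) = (E y' :: 'k mpoly)"
      by (rule var_act_E[OF g x(1)])
    have "y' \<in> {1..n}" using cl_sub[OF image_in[OF g x(1)]] y'(1) by blast
    then have "y' = y" using E_inj[where 'k = 'k] y'(3) x(2,3) by (auto dest: inj_onD)
    then show ?thesis using y' by simp
  qed
  have ba: "b \<in> block (g a)" "rank b = rank a" using det[OF ab(1,2) swap(1)] by auto
  have ab': "a \<in> block (g b)" using det[OF ab(2,1) swap(2)] by auto
  have blk: "block b = block (g a)" "block a = block (g b)"
    using cl_eq[OF image_in[OF g ab(1)] ba(1)] cl_eq[OF image_in[OF g ab(2)] ab'] by auto
  have rank_inj: "x = y" if "x \<in> {1..n}" "y \<in> block x" "rank x = rank y" for x y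
    using rank_bij[OF that(1)] cl_self[OF that(1)] that by (auto simp: bij_betw_def inj_on_def)
  have ne: "b \<notin> block a" using rank_inj[OF ab(1), of b] ba(2) ab(3) by auto
  have single_a: "c = a" if c: "c \<in> block a" for c
  proof (rule ccontr)
    assume "c \<noteq> a"
    have c1: "c \<in> {1..n}" "block c = block a" using c cl_sub[OF ab(1)] cl_eq[OF ab(1)] by auto
    have "c \<noteq> b" using c ne by auto
    then have "c \<in> block (g c)" using det[OF c1(1) c1(1) fixed[OF c1(1) \<open>c \<noteq> a\<close>]] by auto
    moreover have "block (g c) = block (g a)"
      using block_image[OF g c1(1)] block_image[OF g ab(1)] c1(2) by simp
    ultimately have "c \<in> block b" using blk by simp
    then show False using c ne block_sym block_trans by blast
  qed
  have single_b: "c = b" if c: "c \<in> block b" for c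
  proof (rule ccontr)
    assume "c \<noteq> b"
    have c1: "c \<in> {1..n}" "block c = block b" using c cl_sub[OF ab(2)] cl_eq[OF ab(2)] by auto
    have "c \<noteq> a" using c ne block_sym by auto
    then have "c \<in> block (g c)" using det[OF c1(1) c1(1) fixed[OF c1(1) _ \<open>c \<noteq> b\<close>]] by auto
    moreover have "block (g c) = block (g b)"
      using block_image[OF g c1(1)] block_image[OF g ab(2)] c1(2) by simp
    ultimately have "c \<in> block a" using blk by simp
    then show False using c ne block_sym block_trans by blast
  qed
  have gab: "g a = b" "g b = a"
    using single_b[of "g a"] single_a[of "g b"] blk cl_self[OF image_in[OF g ab(1)]] cl_self[OF image_in[OF g ab(2)]] by auto
  have inj: "g x = g y \<longleftrightarrow> x = y" for x y using bij_is_inj[OF bij_H[OF g]] by (simp add: inj_eq)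
  let ?t = "swap a b"
  have "(?t \<circ> g) c \<in> block c" if c: "c \<in> {1..n}" for c
  proof -
    consider "c = a" | "c = b" | "c \<noteq> a" "c \<noteq> b" by blast
    then show ?thesis
    proof cases
      case 3
      have "g c \<noteq> a" "g c \<noteq> b" using gab inj 3 by metis+
      then have "(?t \<circ> g) c = g c" by simp
      moreover have "c \<in> block (g c)" using det[OF c c fixed[OF c 3]] by auto
      ultimately show ?thesis using block_sym by simp
    qed (use gab cl_self ab in auto)
  qed
  moreover have "?t \<circ> g permutes {1..n}"
    using permutes_compose[OF G_perm[OF g] permutes_swap_id[OF ab(1,2)]] .
  ultimately have "?t \<circ> g \<in> N" unfolding N_eq_stab stab_def by blast
  then have "?t \<circ> g \<circ> inv' g \<in> G" by (rule G_comp[OF subsetD[OF N_sub_G] G_inv[OF g]])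
  moreover have "?t \<circ> g \<circ> inv' g = ?t \<circ> (g \<circ> inv' g)" by (simp only: o_assoc)
  moreover have "g \<circ> inv' g = id" using bij_is_surj[OF bij_H[OF g]] unfolding surj_iff .
  ultimately have "?t \<in> G" by (simp only: comp_id)
  then show False using ne ab by (simp add: block_def)
qed

end

section \<open>Action on the elementary symmetric polynomials\<close>

lemma is_poly_ring_on_reindex:
  assumes z: "is_poly_ring_on n z P" and p: "\<pi> permutes {1..n}" and y: "\<And>i. i \<in> {1..n} \<Longrightarrow> y i = z (\<pi> i)"
  shows "is_poly_ring_on n y (P :: 'k::field mpoly set)"
proof -
  have eq: "subst y q = subst z (var_act \<pi> q)" if q: "q \<in> poly_ring n" for q
  proof (rule hom_determined[OF hom_subst hom_comp[OF hom_subst hom_var_act]])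
    fix m i assume "m \<in> keys q" "i \<in> keys m"
    then have "i \<in> {1..n}" using q unfolding poly_ring_def by blast
    then show "subst y (Var i) = subst z (var_act \<pi> (Var i))" using y by simp
  qed simp
  have bij: "bij \<pi>" by (rule permutes_bij[OF p])
  have "bij_betw (var_act \<pi>) (poly_ring n :: 'k mpoly set) (poly_ring n)"
  proof (rule bij_betwI[where g = "var_act (inv' \<pi>)"])
    show "var_act \<pi> \<in> poly_ring n \<rightarrow> (poly_ring n :: 'k mpoly set)"
      "var_act (inv' \<pi>) \<in> poly_ring n \<rightarrow> (poly_ring n :: 'k mpoly set)"
      using var_act_poly_ring p permutes_inv[OF p] by blast+
    have "inv' \<pi> \<circ> \<pi> = id" "\<pi> \<circ> inv' \<pi> = id" using permutes_inv_o[OF p] by auto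
    then show "var_act (inv' \<pi>) (var_act \<pi> q) = q" "var_act \<pi> (var_act (inv' \<pi>) q) = q"
      for q :: "'k mpoly"
      by (simp_all only: var_act_comp[symmetric] var_act_id)
  qed
  then have "bij_betw (subst z \<circ> var_act \<pi>) (poly_ring n) P"
    using z unfolding is_poly_ring_on_def by (rule bij_betw_trans)
  then show ?thesis unfolding is_poly_ring_on_def
    by (rule bij_betw_cong[THEN iffD1, rotated]) (simp add: eq)
qed

context perm_subgroup
begin

text \<open>A coset acts like any of its elements because \<open>N\<close> fixes \<open>T\<close>, which is stable under \<open>G\<close> by normality.\<close>

lemma coset_act_eq:
  assumes g: "g \<in> G" and s: "s \<in> (T :: 'k::field mpoly set)"
  shows "coset_act (N #>\<^bsub>perm_group n G\<^esub> g) s = var_act g s"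
proof -
  have coset: "N #>\<^bsub>perm_group n G\<^esub> g = (\<lambda>h. h \<circ> g) ` N"
    unfolding r_coset_def by (auto simp: sym_group_mult)
  have "(\<lambda>\<sigma>. perm_act \<sigma> s) ` (N #>\<^bsub>perm_group n G\<^esub> g) = (\<lambda>h. var_act h (var_act g s)) ` N"
    unfolding coset image_image perm_act_eq_var_act var_act_comp ..
  also have "\<dots> = {var_act g s}"
  proof -
    have "var_act h (var_act g s) = var_act g s" if "h \<in> N" for h
      using perm_act_T[OF g s] that unfolding T_iff N_eq_stab by blast
    moreover have "N \<noteq> {}" using subgroup.one_closed[OF subgroup_N] by blast
    ultimately show ?thesis by auto
  qed
  finally show ?thesis by (simp add: coset_act_def)
qed

end

text \<open>An arbitrary enumeration \<open>y\<close> of the elementary symmetric polynomials of the \<open>N\<close>-orbits.\<close>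

locale symmetric_coordinates = perm_subgroup n G for n :: nat and G :: "(nat \<Rightarrow> nat) set" +
  fixes y :: "nat \<Rightarrow> 'k::field mpoly"
  assumes bij_y: "bij_betw y {1..n} (orbit_elem_syms n N)"
begin

text \<open>The permutation that relates \<open>y\<close> to the standard enumeration \<open>E\<close>.\<close>

definition label :: "nat \<Rightarrow> nat" where
  "label i = (if i \<in> {1..n} then the_inv_into {1..n} (E :: nat \<Rightarrow> 'k mpoly) (y i) else i)"

lemma label_bij: "bij_betw label {1..n} {1..n}"
proof -
  have "bij_betw (the_inv_into {1..n} (E :: nat \<Rightarrow> 'k mpoly) \<circ> y) {1..n} {1..n}"
    by (rule bij_betw_trans[OF bij_y bij_betw_the_inv_into[OF bij_E]])
  then show ?thesis by (rule bij_betw_cong[THEN iffD1, rotated]) (simp add: label_def)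
qed

lemma label_permutes: "label permutes {1..n}"
  by (rule bij_imp_permutes[OF label_bij]) (simp add: label_def del: atLeastAtMost_iff)

lemma y_eq: "i \<in> {1..n} \<Longrightarrow> y i = E (label i)"
proof -
  assume i: "i \<in> {1..n}"
  then have "y i \<in> E ` {1..n}" using bij_y unfolding orbit_elem_syms_eq bij_betw_def by blast
  from f_the_inv_into_f[OF E_inj this] show ?thesis using i by (simp add: label_def)
qed

lemma poly_ring_on_y: "is_poly_ring_on n y T"
  by (rule is_poly_ring_on_reindex[OF is_poly_ring_on_E label_permutes y_eq])

sublocale polynomial_coordinates n y T
  by unfold_locales (rule poly_ring_on_y)

lemma y_inj: "i \<in> {1..n} \<Longrightarrow> j \<in> {1..n} \<Longrightarrow> y i = y j \<Longrightarrow> i = j"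
  using bij_y by (auto simp: bij_betw_def dest: inj_onD)

definition permutes_y :: "(nat \<Rightarrow> nat) \<Rightarrow> (nat \<Rightarrow> nat) \<Rightarrow> bool" where
  "permutes_y g \<pi> \<longleftrightarrow> \<pi> permutes {1..n} \<and> (\<forall>i\<in>{1..n}. var_act g (y i) = y (\<pi> i))"

definition y_perms :: "(nat \<Rightarrow> nat) set" where
  "y_perms = {\<pi>. \<exists>g\<in>G. permutes_y g \<pi>}"

lemma exists_y_perm:
  assumes g: "g \<in> G"
  shows "\<exists>\<pi>. permutes_y g \<pi>"
proof -
  have "\<exists>j\<in>{1..n}. var_act g (y i) = y j" if i: "i \<in> {1..n}" for i
  proof -
    have l: "label i \<in> {1..n}" using permutes_in_image[OF label_permutes] i by blast
    obtain b where b: "b \<in> block (g (label i))" "var_act g (E (label i)) = (E b :: 'k mpoly)"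
      by (rule var_act_E[OF g l])
    have "b \<in> {1..n}" using cl_sub[OF image_in[OF g l]] b(1) by blast
    then have "E b \<in> y ` {1..n}" using bij_y unfolding orbit_elem_syms_eq bij_betw_def by blast
    then show ?thesis using b(2) y_eq[OF i] by auto
  qed
  then obtain f where f: "\<forall>i\<in>{1..n}. f i \<in> {1..n} \<and> var_act g (y i) = y (f i)" by metis
  define \<pi> where "\<pi> i = (if i \<in> {1..n} then f i else i)" for i
  have inj_g: "p = q" if "var_act g p = var_act g q" for p q :: "'k mpoly"
  proof -
    have "var_act (inv' g \<circ> g) p = var_act (inv' g \<circ> g) q"
      unfolding var_act_comp that ..
    then show ?thesis unfolding permutes_inv_o(2)[OF G_perm[OF g]] var_act_id .
  qed
  have "inj_on \<pi> {1..n}"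
  proof (rule inj_onI)
    fix i j assume ij: "i \<in> {1..n}" "j \<in> {1..n}" "\<pi> i = \<pi> j"
    then have "var_act g (y i) = var_act g (y j)" using f by (simp add: \<pi>_def)
    then show "i = j" using inj_g y_inj ij by blast
  qed
  moreover have "\<pi> ` {1..n} \<subseteq> {1..n}" using f by (auto simp: \<pi>_def)
  ultimately have "bij_betw \<pi> {1..n} {1..n}" by (simp add: bij_betw_def endo_inj_surj)
  then have "\<pi> permutes {1..n}" by (rule bij_imp_permutes) (simp add: \<pi>_def del: atLeastAtMost_iff)
  then have "permutes_y g \<pi>" using f by (simp add: permutes_y_def \<pi>_def)
  then show ?thesis by blast
qed

lemma permutes_y_comp:
  assumes "permutes_y g \<pi>" "permutes_y h \<rho>"
  shows "permutes_y (g \<circ> h) (\<pi> \<circ> \<rho>)"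
proof -
  have "\<rho> permutes {1..n}" using assms(2) by (simp add: permutes_y_def)
  then have "\<rho> i \<in> {1..n}" if "i \<in> {1..n}" for i using permutes_in_image that by metis
  then show ?thesis using assms unfolding permutes_y_def
    by (simp add: permutes_compose var_act_comp del: atLeastAtMost_iff)
qed

lemma permutes_y_inv:
  assumes g: "g \<in> G" and p: "permutes_y g \<pi>"
  shows "permutes_y (inv' g) (inv' \<pi>)"
  unfolding permutes_y_def
proof (intro conjI ballI)
  have perm: "\<pi> permutes {1..n}" using p by (simp add: permutes_y_def)
  then show "inv' \<pi> permutes {1..n}" by (rule permutes_inv)
  fix i assume i: "i \<in> {1..n}"
  have j: "inv' \<pi> i \<in> {1..n}" using permutes_in_image[OF permutes_inv[OF perm]] i by blast
  have "y i = var_act g (y (inv' \<pi> i))"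
    using bspec[OF conjunct2[OF p[unfolded permutes_y_def]] j] permutes_inverses(1)[OF perm] by simp
  then have "var_act (inv' g) (y i) = var_act (inv' g \<circ> g) (y (inv' \<pi> i))"
    by (simp only: var_act_comp)
  then show "var_act (inv' g) (y i) = y (inv' \<pi> i)"
    unfolding permutes_inv_o(2)[OF G_perm[OF g]] var_act_id .
qed

lemma permutes_y_subst:
  assumes p: "permutes_y g \<pi>" and q: "q \<in> poly_ring n"
  shows "var_act g (subst y q) = subst y (var_act \<pi> q)"
proof (rule hom_determined[OF hom_comp[OF hom_var_act hom_subst] hom_comp[OF hom_subst hom_var_act]])
  fix m i assume "m \<in> keys q" "i \<in> keys m"
  then have "i \<in> {1..n}" using q unfolding poly_ring_def by blast
  then show "var_act g (subst y (Var i)) = subst y (var_act \<pi> (Var i))"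
    using p by (simp add: permutes_y_def del: atLeastAtMost_iff)
qed simp

sublocale Y: perm_set_no_transpositions n y_perms
proof
  show "\<pi> permutes {1..n}" if "\<pi> \<in> y_perms" for \<pi> using that by (auto simp: y_perms_def permutes_y_def)
  have "permutes_y id id" unfolding permutes_y_def using permutes_id by (simp only: var_act_id id_apply) simp
  then show "id \<in> y_perms" unfolding y_perms_def using G_id by blast
  show "\<pi> \<circ> \<rho> \<in> y_perms" if "\<pi> \<in> y_perms" "\<rho> \<in> y_perms" for \<pi> \<rho>
    using that permutes_y_comp G_comp unfolding y_perms_def by blast
  show "inv' \<pi> \<in> y_perms" if "\<pi> \<in> y_perms" for \<pi>
    using that permutes_y_inv G_inv unfolding y_perms_def by blast
  fix i j assume ij: "i \<in> {1..n}" "j \<in> {1..n}" "i \<noteq> j"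
  show "swap i j \<notin> y_perms"
  proof
    assume "swap i j \<in> y_perms"
    then obtain g where g: "g \<in> G" "permutes_y g (swap i j)" by (auto simp: y_perms_def)
    have act: "var_act g (E (label l)) = (E (label (swap i j l)) :: 'k mpoly)" if l: "l \<in> {1..n}" for l
    proof -
      have "swap i j l \<in> {1..n}" using permutes_in_image[OF permutes_swap_id[OF ij(1,2)]] l by blast
      then show ?thesis using g(2) l y_eq by (simp add: permutes_y_def del: atLeastAtMost_iff)
    qed
    have lab: "label l \<in> {1..n} \<longleftrightarrow> l \<in> {1..n}" for l by (rule permutes_in_image[OF label_permutes])
    have lab_inj: "label l = label l' \<longleftrightarrow> l = l'" for l l' using permutes_inj[OF label_permutes] by (simp add: inj_eq)
    show False
    proof (rule no_transposition_of_E[OF g(1), of "label i" "label j", where 'k = 'k])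
      show "label i \<in> {1..n}" "label j \<in> {1..n}" "label i \<noteq> label j" using ij lab lab_inj by auto
      show "var_act g (E (label i)) = (E (label j) :: 'k mpoly)" "var_act g (E (label j)) = (E (label i) :: 'k mpoly)"
        using act[OF ij(1)] act[OF ij(2)] by simp_all
      fix c assume c: "c \<in> {1..n}" "c \<noteq> label i" "c \<noteq> label j"
      obtain l where l: "c = label l" using permutes_surj[OF label_permutes] by (metis surjD)
      then have "l \<in> {1..n}" "l \<noteq> i" "l \<noteq> j" using c lab by auto
      then show "var_act g (E c) = (E c :: 'k mpoly)" using act[of l] by (simp add: l)
    qed
  qed
qed

sublocale YC: permuted_coordinates n y T y_perms "perm_group n G Mod N" coset_act
proof
  have key: "coset_act (N #>\<^bsub>perm_group n G\<^esub> g) (subst y q) = subst y (var_act \<pi> q) \<and>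
      coset_act (inv\<^bsub>perm_group n G Mod N\<^esub> (N #>\<^bsub>perm_group n G\<^esub> g)) (subst y q) = subst y (var_act (inv' \<pi>) q)"
    if g: "g \<in> G" and p: "permutes_y g \<pi>" and q: "q \<in> poly_ring n" for g \<pi> q
  proof
    have s: "subst y q \<in> T" using q unfolding P_eq by blast
    show "coset_act (N #>\<^bsub>perm_group n G\<^esub> g) (subst y q) = subst y (var_act \<pi> q)"
      unfolding coset_act_eq[OF g s] by (rule permutes_y_subst[OF p q])
    have carrier: "g \<in> carrier (perm_group n G)" using g by simp
    have "N #>\<^bsub>perm_group n G\<^esub> g \<in> carrier (perm_group n G Mod N)"
      unfolding carrier_FactGroup using carrier by blast
    then have "inv\<^bsub>perm_group n G Mod N\<^esub> (N #>\<^bsub>perm_group n G\<^esub> g) = N #>\<^bsub>perm_group n G\<^esub> (inv' g)"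
      by (simp only: normal.inv_FactGroup[OF normal_N] normal.rcos_inv[OF normal_N carrier] inv_G[OF g])
    then show "coset_act (inv\<^bsub>perm_group n G Mod N\<^esub> (N #>\<^bsub>perm_group n G\<^esub> g)) (subst y q) = subst y (var_act (inv' \<pi>) q)"
      using coset_act_eq[OF G_inv[OF g] s] permutes_y_subst[OF permutes_y_inv[OF g p] q] by simp
  qed
  show "\<exists>\<pi>\<in>y_perms. \<forall>q\<in>poly_ring n. coset_act c (subst y q) = subst y (var_act \<pi> q) \<and>
      coset_act (inv\<^bsub>perm_group n G Mod N\<^esub> c) (subst y q) = subst y (var_act (inv' \<pi>) q)"
    if c: "c \<in> carrier (perm_group n G Mod N)" for c
  proof -
    obtain g where g: "g \<in> G" "c = N #>\<^bsub>perm_group n G\<^esub> g" using c unfolding carrier_FactGroup by auto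
    obtain \<pi> where \<pi>: "permutes_y g \<pi>" using exists_y_perm[OF g(1)] by blast
    then have "\<pi> \<in> y_perms" using g(1) by (auto simp: y_perms_def)
    then show ?thesis using key[OF g(1) \<pi>] g(2) by blast
  qed
  show "\<exists>c\<in>carrier (perm_group n G Mod N). \<forall>q\<in>poly_ring n. coset_act c (subst y q) = subst y (var_act \<pi> q) \<and>
      coset_act (inv\<^bsub>perm_group n G Mod N\<^esub> c) (subst y q) = subst y (var_act (inv' \<pi>) q)"
    if \<pi>: "\<pi> \<in> y_perms" for \<pi>
  proof -
    obtain g where g: "g \<in> G" "permutes_y g \<pi>" using \<pi> by (auto simp: y_perms_def)
    have "N #>\<^bsub>perm_group n G\<^esub> g \<in> carrier (perm_group n G Mod N)" unfolding carrier_FactGroup using g(1) by simp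
    then show ?thesis using key[OF g] by blast
  qed
qed

text \<open>An element of \<open>R\<close> is \<open>N\<close>-invariant, hence a polynomial in the \<open>y\<^sub>i\<close>, and its \<open>G\<close>-invariance amounts to the invariance of this
polynomial under the induced permutations.\<close>

lemma inv_ring_eq: "YC.inv_ring = ring_of_invariants G (poly_ring n)"
proof (intro equalityI subsetI)
  fix p assume "p \<in> YC.inv_ring"
  then obtain q where q: "q \<in> poly_ring n" "\<forall>\<pi>\<in>y_perms. var_act \<pi> q = q" "p = subst y q"
    unfolding YC.inv_ring_def Y.R_iff[unfolded Y.invar_def] by (auto simp: Y.R_iff Y.invar_def)
  have "p \<in> T" unfolding q(3) P_eq using q(1) by blast
  moreover have "var_act g p = p" if g: "g \<in> G" for g
  proof -
    obtain \<pi> where \<pi>: "permutes_y g \<pi>" using exists_y_perm[OF g] by blast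
    then have "\<pi> \<in> y_perms" using g by (auto simp: y_perms_def)
    then show ?thesis using permutes_y_subst[OF \<pi> q(1)] q(2,3) by simp
  qed
  ultimately show "p \<in> ring_of_invariants G (poly_ring n)"
    by (simp add: ring_of_invariants_def perm_act_eq_var_act)
next
  fix p :: "'k mpoly" assume p: "p \<in> ring_of_invariants G (poly_ring n)"
  then have "p \<in> T" using N_sub_G unfolding N_eq_stab by (auto simp: ring_of_invariants_def)
  then obtain q where q: "q \<in> poly_ring n" "p = subst y q" unfolding P_eq by blast
  have "var_act \<pi> q = q" if \<pi>: "\<pi> \<in> y_perms" for \<pi>
  proof -
    obtain g where g: "g \<in> G" "permutes_y g \<pi>" using \<pi> by (auto simp: y_perms_def)
    have "subst y (var_act \<pi> q) = subst y q"
      using permutes_y_subst[OF g(2) q(1)] p g(1) q(2) by (simp add: ring_of_invariants_def perm_act_eq_var_act)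
    moreover have "var_act \<pi> q \<in> poly_ring n" using g(2) q(1) by (intro var_act_poly_ring) (auto simp: permutes_y_def)
    ultimately show ?thesis using coord_subst[of "var_act \<pi> q"] coord_subst[OF q(1)] by simp
  qed
  then have "q \<in> ring_of_invariants y_perms (poly_ring n)" using q(1) by (simp add: Y.R_iff Y.invar_def)
  then show "p \<in> YC.inv_ring" unfolding YC.inv_ring_def q(2) by blast
qed

end

lemma subst_X: "subst X p = (p :: 'k::field mpoly)"
  unfolding X_eq_Var by (rule hom_determined[OF hom_subst hom_id]) auto

theorem theorem8p3:
  fixes n :: nat
    and G N :: "(nat \<Rightarrow> nat) set"
    and S R T :: "'k::field mpoly set"
  assumes G: "subgroup G (sym_group n)"
    and S: "S = poly_ring n"
    and R: "R = ring_of_invariants G S"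
    and N: "N = generate (sym_group n) (G \<inter> transpositions n)"
    and T: "T = ring_of_invariants N S"
  shows "(G \<inter> transpositions n = {} \<longrightarrow>
            is_k_basis (restr_orbit_sum R) (pbw_orbits (perm_group n G) perm_act n X S) (diff_ops R))
       \<and> N \<lhd> perm_group n G
       \<and> (\<exists>y. bij_betw y {1..n} (orbit_elem_syms n N :: 'k mpoly set))
       \<and> (\<forall>y. bij_betw y {1..n} (orbit_elem_syms n N :: 'k mpoly set) \<longrightarrow>
            is_poly_ring_on n y T
          \<and> is_k_basis (restr_orbit_sum R)
              (pbw_orbits (perm_group n G Mod N) coset_act n y T) (diff_ops R))"
proof -
  interpret PS: perm_subgroup n G by (rule perm_subgroup.intro[OF G])
  have N_eq: "N = PS.N" unfolding N PS.N_def ..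
  have T_eq: "T = ring_of_invariants PS.stab (poly_ring n)" unfolding T S N_eq PS.N_eq_stab ..
  have a: "is_k_basis (restr_orbit_sum R) (pbw_orbits (perm_group n G) perm_act n X S) (diff_ops R)"
    if no: "G \<inter> transpositions n = {}"
  proof -
    interpret PC: permuted_coordinates n "X :: nat \<Rightarrow> 'k mpoly" S G "perm_group n G" perm_act
    proof
      show "is_poly_ring_on n (X :: nat \<Rightarrow> 'k mpoly) S"
        unfolding is_poly_ring_on_def S by (simp add: subst_X bij_betw_def inj_on_def)
      show "swap i j \<notin> G" if "i \<in> {1..n}" "j \<in> {1..n}" "i \<noteq> j" for i j
        using no that by (auto simp: transpositions_def)
    qed (auto simp: subst_X perm_act_eq_var_act PS.inv_G)
    have "PC.inv_ring = R" unfolding PC.inv_ring_def R S by (simp add: subst_X)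
    then show ?thesis using PC.pbw_orbit_sums_basis by simp
  qed
  have b: "is_poly_ring_on n y T \<and>
      is_k_basis (restr_orbit_sum R) (pbw_orbits (perm_group n G Mod N) coset_act n y T) (diff_ops R)"
    if y: "bij_betw y {1..n} (orbit_elem_syms n N :: 'k mpoly set)" for y
  proof -
    interpret SC: symmetric_coordinates n G y 
      by (intro symmetric_coordinates.intro symmetric_coordinates_axioms.intro PS.perm_subgroup_axioms)
        (use y in \<open>simp only: N_eq\<close>)
    show ?thesis using SC.poly_ring_on_y SC.YC.pbw_orbit_sums_basis
      unfolding SC.inv_ring_eq T_eq N_eq R S by blast
  qed
  show ?thesis using a b PS.normal_N PS.bij_E unfolding N_eq by blast
qed

end
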